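(* Let $m,M\ge 1$ be (finite) integers and let $K$ be a real, continuous and isotropic kernel on $S^m\times S^M$, with isotropic part $f:[-1,1]^2\to\mathbb{R}$. Then $K$ is positive definite on $S^m\times S^M$ if and only if $f$ has a representation of the form $$f(t,s)=\sum_{k,l=0}^{\infty}\hat f_{k,l}\,P_k^m(t)P_l^M(s),\qquad t,s\in[-1,1],$$ in which $\hat f_{k,l}\ge 0$ for all $k,l\in\mathbb{Z}_+$ and $\sum_{k,l=0}^{\infty}\hat f_{k,l}P_k^m(1)P_l^M(1)<\infty$.
   Context: $\mathbb{Z}_+=\{0,1,2,\ldots\}$. $S^m$ is the unit sphere in $\mathbb{R}^{m+1}$ with its geodesic distance, and $\cdot$ denotes the usual inner product. A kernel $K$ on $S^m\times S^M$ is isotropic if $K((x,z),(y,w))=f(x\cdot y,z\cdot w)$ for all $x,y\in S^m$, $z,w\in S^M$, for some function $f:[-1,1]^2\to\mathbb{R}$, called the isotropic part of $K$. A kernel $K$ on a nonempty set $X$ is positive definite if $\sum_{\mu,\nu=1}^n c_\mu c_\nu K(x_\mu,x_\nu)\ge 0$ for all $n\ge1$, all distinct $x_1,\ldots,x_n\in X$ and all real $c_1,\ldots,c_n$. $P_k^m$ is the Gegenbauer polynomial of degree $k$ with parameter $(m-1)/2$ (usual notation $C_k^{(m-1)/2}$); for $m=1$, $P_k^1$ is the Chebyshev polynomial $T_k$. The Fourier coefficients of $f\in L^1([-1,1]^2,w_{m,M})$, where $w_{m,M}(t,s)=(1-t^2)^{(m-2)/2}(1-s^2)^{(M-2)/2}$,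 are $$\hat f_{k,l}=\frac{1}{\tau_k^m\tau_l^M}\int_{[-1,1]^2}f(t,s)P_k^m(t)P_l^M(s)\,w_{m,M}(t,s)\,dt\,ds,\qquad \tau_k^m=\int_{-1}^1 P_k^m(t)^2(1-t^2)^{(m-2)/2}dt$$ (for $m\ge2$, $\tau_k^m=\frac{\tau_{m+1}}{\tau_m}\frac{m-1}{2k+m-1}P_k^m(1)$ with $\tau_{m+1}=2\pi^{(m+1)/2}/\Gamma((m+1)/2)$ the surface area of $S^m$). *)

theory Defs
  imports "HOL-Analysis.Analysis" "HOL-Computational_Algebra.Polynomial"
begin

definition positive_definite_on :: "'x set \<Rightarrow> ('x \<Rightarrow> 'x \<Rightarrow> real) \<Rightarrow> bool" where
  "positive_definite_on X K \<longleftrightarrow>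
     (\<forall>n\<ge>1. \<forall>x :: nat \<Rightarrow> 'x. \<forall>c :: nat \<Rightarrow> real.
        inj_on x {1..n} \<and> x ` {1..n} \<subseteq> X \<longrightarrow>
        0 \<le> (\<Sum>\<mu>=1..n. \<Sum>\<nu>=1..n. c \<mu> * c \<nu> * K (x \<mu>) (x \<nu>)))"

text \<open>
  The unit sphere of dimension \<open>m\<close> is \<open>sphere 0 1\<close> in a Euclidean space of dimension \<open>m + 1\<close>.
  Kernels and isotropic parts are total functions here, but only their values on the spheres and
  on \<open>[-1, 1] \<times> [-1, 1]\<close>, respectively, are ever used.
\<close>

definition isotropic_part ::
    "('a::euclidean_space \<times> 'b::euclidean_space \<Rightarrow> 'a \<times> 'b \<Rightarrow> real) \<Rightarrow>
     (real \<Rightarrow> real \<Rightarrow> real) \<Rightarrow> bool" where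
  "isotropic_part K f \<longleftrightarrow>
     (\<forall>x\<in>sphere 0 1. \<forall>y\<in>sphere 0 1. \<forall>z\<in>sphere 0 1. \<forall>w\<in>sphere 0 1.
        K (x, z) (y, w) = f (x \<bullet> y) (z \<bullet> w))"

text \<open>
  \<open>gegenbauer_poly a k\<close> is the polynomial usually written \<open>C\<^sub>k\<close> with upper index \<open>a\<close>,
  given by the classical three-term recurrence
  \<open>n C\<^sub>n(x) = 2 (n + a - 1) x C\<^sub>n\<^sub>-\<^sub>1(x) - (n + 2 a - 2) C\<^sub>n\<^sub>-\<^sub>2(x)\<close>, taken at \<open>n = k + 2\<close>.
\<close>

fun gegenbauer_poly :: "real \<Rightarrow> nat \<Rightarrow> real poly" where
  "gegenbauer_poly a 0 = 1"
| "gegenbauer_poly a (Suc 0) = [:0, 2 * a:]"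
| "gegenbauer_poly a (Suc (Suc k)) =
     smult (1 / (real k + 2))
       ([:0, 2 * (real k + 1 + a):] * gegenbauer_poly a (Suc k)
        - smult (real k + 2 * a) (gegenbauer_poly a k))"

fun chebyshev_poly :: "nat \<Rightarrow> real poly" where
  "chebyshev_poly 0 = 1"
| "chebyshev_poly (Suc 0) = [:0, 1:]"
| "chebyshev_poly (Suc (Suc k)) = [:0, 2:] * chebyshev_poly (Suc k) - chebyshev_poly k"

text \<open>The Gegenbauer recurrence degenerates at parameter \<open>0\<close>, hence the separate case \<open>m = 1\<close>.\<close>

definition gegenbauer :: "nat \<Rightarrow> nat \<Rightarrow> real \<Rightarrow> real" where
  "gegenbauer m k = poly (if m = 1 then chebyshev_poly k else gegenbauer_poly ((real m - 1) / 2) k)"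

text \<open>
  Since \<open>0 powr a = 0\<close> for every \<open>a\<close>, this weight is \<open>0\<close> at the endpoints \<open>t = 1\<close> and \<open>t = -1\<close>;
  these form a null set, so no integral below is affected.
\<close>

definition weight :: "nat \<Rightarrow> real \<Rightarrow> real" where
  "weight m t = (1 - t\<^sup>2) powr ((real m - 2) / 2)"

definition \<tau> :: "nat \<Rightarrow> nat \<Rightarrow> real" where
  "\<tau> m k = (LBINT t:{-1..1}. (gegenbauer m k t)\<^sup>2 * weight m t)"

definition fourier_coeff :: "nat \<Rightarrow> nat \<Rightarrow> (real \<Rightarrow> real \<Rightarrow> real) \<Rightarrow> nat \<Rightarrow> nat \<Rightarrow> real" where
  "fourier_coeff m M f k l =
     1 / (\<tau> m k * \<tau> M l) *
     (LBINT p:{-1..1} \<times> {-1..1}.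
        f (fst p) (snd p) * gegenbauer m k (fst p) * gegenbauer M l (snd p) * (weight m (fst p) * weight M (snd p)))"

end

theory Submission
  imports Defs "HOL-Probability.Probability_Measure"
begin

text \<open>
  This is Schoenberg's characterisation of positive definite zonal kernels, for a product of two
  spheres. Write \<open>R\<^sub>k\<close> for the Gegenbauer polynomial of degree \<open>k\<close> divided by its value at \<open>1\<close>
  (\<open>ultra\<close>), \<open>\<mu>\<close> for the weight on \<open>[-1, 1]\<close> scaled to total mass \<open>1\<close> (\<open>weight_measure\<close>), \<open>h\<^sub>k\<close> for
  the \<open>\<mu>\<close>-integral of \<open>R\<^sub>k\<^sup>2\<close> (\<open>ultra_norm\<close>) and \<open>\<sigma>\<close> for the rotation-invariant probability
  measure on the sphere (\<open>sphere_measure\<close>).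

  Everything rests on the Funk-Hecke formula (\<open>funk_hecke\<close>): for continuous \<open>g\<close> and unit vectors
  \<open>x\<close>, \<open>z\<close>, the \<open>\<sigma>\<close>-integral over \<open>y\<close> of \<open>g(x \<bullet> y) R\<^sub>k(y \<bullet> z)\<close> is \<open>R\<^sub>k(x \<bullet> z)\<close> times the
  \<open>\<mu>\<close>-integral of \<open>g R\<^sub>k\<close>. The reason is that convolution with \<open>g\<close> maps polynomials in \<open>y \<bullet> z\<close> of
  degree at most \<open>k\<close> to polynomials in \<open>x \<bullet> z\<close> of degree at most \<open>k\<close>
  (\<open>zonal_convolution_monomial\<close>) and is symmetric with respect to \<open>\<mu>\<close>, because \<open>\<mu>\<close> is the image
  of \<open>\<sigma>\<close> under \<open>y \<mapsto> x \<bullet> y\<close> (\<open>sphere_projection\<close>). It therefore also preserves the orthogonal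
  complement of the polynomials of degree less than \<open>k\<close>, so each \<open>R\<^sub>k\<close> is an eigenvector.

  If the expansion holds with nonnegative coefficients, positive definiteness follows from
  Funk-Hecke with \<open>g = R\<^sub>k\<close>: it writes \<open>h\<^sub>k R\<^sub>k(x \<bullet> z)\<close> as an inner product of the functions
  \<open>R\<^sub>k(x \<bullet> \<cdot>)\<close> and \<open>R\<^sub>k(z \<bullet> \<cdot>)\<close>, so every product kernel is a Gram matrix
  (\<open>positive_definite_product_ultra\<close>).

  Conversely, let the kernel be positive definite. Integrating it in both variables against
  \<open>u(x, z) = R\<^sub>k(x \<bullet> x\<^sub>0) R\<^sub>l(z \<bullet> z\<^sub>0)\<close> gives a nonnegative number
  (\<open>double_integral_nonneg\<close>), which Funk-Hecke evaluates as a positive multiple of the coefficient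
  of index \<open>(k, l)\<close>; so the coefficients are nonnegative (\<open>double_coeff_nonneg\<close>). Their sum at
  \<open>(1, 1)\<close> converges (\<open>double_coeff_partial_sum_bound\<close>): the average of \<open>f\<close> against the product of the
  normalised weights \<open>(1 + t)\<^sup>N\<close> and \<open>(1 + s)\<^sup>N\<close> is at most the maximum of \<open>f\<close>, these powers have
  nonnegative Gegenbauer coefficients (\<open>ultra_cone_power\<close>), and as \<open>N \<rightarrow> \<infinity>\<close> they
  concentrate at \<open>1\<close> (\<open>power_concentrates\<close>). The series then converges uniformly to a continuous
  function with the same coefficients as \<open>f\<close>, and completeness of the Gegenbauer polynomials, applied
  in one variable after the other, identifies it with \<open>f\<close> (\<open>double_coeff_unique\<close>).
\<close>

section \<open>Compactly supported Borel probability measures\<close>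

text \<open>
  All integrands against such a measure are continuous on the whole space, which makes them
  measurable, while the compact set \<open>C\<close> carrying the measure makes them bounded almost everywhere.
  This yields integrability, Fubini's theorem and continuity of parameter integrals at once.
\<close>

locale compact_prob = prob_space N for N :: "'a::euclidean_space measure" +
  fixes C :: "'a set"
  assumes sets_eq [measurable_cong]: "sets N = sets borel"
    and compact_support: "compact C"
    and AE_support: "AE x in N. x \<in> C"
begin

lemma borel_measurable_continuous: "continuous_on UNIV (g :: 'a \<Rightarrow> real) \<Longrightarrow> g \<in> borel_measurable N"
  by (metis borel_measurable_continuous_onI measurable_cong_sets sets_eq)

lemma support_nonempty: "C \<noteq> {}"
proof
  assume "C = {}"
  then have "AE x in N. False" using AE_support by simp
  then show False by simp
qed

lemma integrable_continuous:
  fixes g :: "'a \<Rightarrow> real"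
  assumes "continuous_on UNIV g"
  shows "integrable N g"
proof -
  have "compact (g ` C)"
    using assms compact_support compact_continuous_image continuous_on_subset by blast
  then obtain B where "\<And>x. x \<in> C \<Longrightarrow> norm (g x) \<le> B"
    by (metis bounded_iff compact_imp_bounded imageI)
  then have "AE x in N. norm (g x) \<le> B"
    using AE_support by fastforce
  then show ?thesis
    using borel_measurable_continuous[OF assms] integrable_const_bound by blast
qed

lemma integral_cong_support:
  fixes g h :: "'a \<Rightarrow> real"
  assumes "continuous_on UNIV g" "continuous_on UNIV h" "\<And>x. x \<in> C \<Longrightarrow> g x = h x"
  shows "integral\<^sup>L N g = integral\<^sup>L N h"
  using assms AE_support
  by (intro integral_cong_AE borel_measurable_continuous) (auto elim: eventually_mono)

lemma integral_mono_support:
  fixes g h :: "'a \<Rightarrow> real"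
  assumes "continuous_on UNIV g" "continuous_on UNIV h" "\<And>x. x \<in> C \<Longrightarrow> g x \<le> h x"
  shows "integral\<^sup>L N g \<le> integral\<^sup>L N h"
  using assms AE_support
  by (intro integral_mono_AE integrable_continuous) (auto elim: eventually_mono)

lemma abs_integral_le_support:
  fixes g :: "'a \<Rightarrow> real"
  assumes "continuous_on UNIV g" "\<And>x. x \<in> C \<Longrightarrow> \<bar>g x\<bar> \<le> B"
  shows "\<bar>integral\<^sup>L N g\<bar> \<le> B"
proof -
  have "integral\<^sup>L N g \<le> integral\<^sup>L N (\<lambda>x. B)"
    using assms by (intro integral_mono_support continuous_intros) (auto simp: abs_le_iff)
  moreover have "integral\<^sup>L N (\<lambda>x. -B) \<le> integral\<^sup>L N g"
    using assms by (intro integral_mono_support continuous_intros) (auto simp: abs_le_iff minus_le_iff)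
  ultimately show ?thesis by (simp add: prob_space)
qed

lemma tendsto_integral_uniform:
  fixes g :: "'a \<Rightarrow> real"
  assumes cont: "\<And>i. continuous_on UNIV (u i)" "continuous_on UNIV g"
    and lim: "uniform_limit C u g F"
  shows "((\<lambda>i. integral\<^sup>L N (u i)) \<longlongrightarrow> integral\<^sup>L N g) F"
proof (rule tendstoI)
  fix e :: real assume "e > 0"
  then have "e / 2 > 0" by simp
  with lim have "\<forall>\<^sub>F i in F. \<forall>x\<in>C. dist (u i x) (g x) < e / 2"
    by (rule uniform_limitD)
  then show "\<forall>\<^sub>F i in F. dist (integral\<^sup>L N (u i)) (integral\<^sup>L N g) < e"
  proof eventually_elim
    case (elim i)
    have "\<bar>integral\<^sup>L N (\<lambda>x. u i x - g x)\<bar> \<le> e / 2"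
      using elim cont by (intro abs_integral_le_support continuous_intros) (auto simp: dist_real_def less_imp_le)
    then show ?case
      using \<open>e > 0\<close> cont integrable_continuous by (simp add: dist_real_def)
  qed
qed

lemma continuous_on_integral:
  fixes g :: "'b::euclidean_space \<Rightarrow> 'a \<Rightarrow> real"
  assumes "continuous_on UNIV (\<lambda>(t, x). g t x)"
  shows "continuous_on UNIV (\<lambda>t. integral\<^sup>L N (g t))"
proof -
  have sect: "continuous_on UNIV (g t)" for t
    using continuous_on_compose2[OF assms, of UNIV "\<lambda>x. (t, x)"]
    by (simp add: continuous_on_Pair continuous_on_id continuous_on_const)
  have "(\<lambda>n. integral\<^sup>L N (g (s n))) \<longlonglongrightarrow> integral\<^sup>L N (g t)" if s: "s \<longlonglongrightarrow> t" for s t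
  proof (rule tendsto_integral_uniform[OF sect sect])
    have "compact (cball t 1 \<times> C)"
      by (simp add: compact_support compact_Times)
    then have uc: "uniformly_continuous_on (cball t 1 \<times> C) (\<lambda>(t, x). g t x)"
      using assms compact_uniformly_continuous continuous_on_subset by blast
    show "uniform_limit C (\<lambda>n. g (s n)) (g t) sequentially"
    proof (rule uniform_limitI)
      fix e :: real assume "e > 0"
      then obtain d where d: "d > 0" and *: "\<And>p q. p \<in> cball t 1 \<times> C \<Longrightarrow> q \<in> cball t 1 \<times> C \<Longrightarrow>
          dist p q < d \<Longrightarrow> dist (case p of (t, x) \<Rightarrow> g t x) (case q of (t, x) \<Rightarrow> g t x) < e"
        using uc unfolding uniformly_continuous_on_def by metis
      have "\<forall>\<^sub>F n in sequentially. dist (s n) t < min d 1"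
        using s d by (intro tendstoD) auto
      then show "\<forall>\<^sub>F n in sequentially. \<forall>x\<in>C. dist (g (s n) x) (g t x) < e"
      proof eventually_elim
        case (elim n)
        show ?case
        proof
          fix x assume "x \<in> C"
          then show "dist (g (s n) x) (g t x) < e"
            using elim *[of "(s n, x)" "(t, x)"] by (auto simp: dist_Pair_Pair dist_commute)
        qed
      qed
    qed
  qed
  then show ?thesis
    by (auto simp: continuous_on_sequentially o_def)
qed

end

lemma compact_prob_distr:
  fixes h :: "'a::euclidean_space \<Rightarrow> 'b::euclidean_space"
  assumes "compact_prob N C" "continuous_on UNIV h" "h ` C \<subseteq> D" "compact D"
  shows "compact_prob (distr N borel h) D"
proof -
  interpret compact_prob N C by fact
  have [measurable]: "h \<in> N \<rightarrow>\<^sub>M borel"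
    by (metis assms(2) borel_measurable_continuous_onI measurable_cong_sets sets_eq)
  have [measurable]: "D \<in> sets borel" using \<open>compact D\<close> by (simp add: borel_closed compact_imp_closed)
  interpret D: prob_space "distr N borel h" by (rule prob_space_distr) simp
  show ?thesis
    by unfold_locales (use AE_support assms in \<open>auto simp: AE_distr_iff elim!: eventually_mono\<close>)
qed

lemma compact_prob_pair:
  assumes "compact_prob N C" "compact_prob N' C'"
  shows "compact_prob (N \<Otimes>\<^sub>M N') (C \<times> C')"
proof -
  interpret A: compact_prob N C by fact
  interpret B: compact_prob N' C' by fact
  interpret P: pair_prob_space N N' ..
  have s: "sets (N \<Otimes>\<^sub>M N') = sets borel"
    by (metis A.sets_eq B.sets_eq borel_prod sets_pair_measure_cong)
  have CC: "compact (C \<times> C')"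
    by (simp add: compact_Times A.compact_support B.compact_support)
  have "AE p in N \<Otimes>\<^sub>M N'. p \<in> C \<times> C'"
  proof (rule P.AE_pair_measure)
    show "{p \<in> space (N \<Otimes>\<^sub>M N'). p \<in> C \<times> C'} \<in> sets (N \<Otimes>\<^sub>M N')"
      using sets.Int[OF sets.top, of "C \<times> C'" "N \<Otimes>\<^sub>M N'"] CC s
      by (simp add: Int_def borel_closed compact_imp_closed)
    show "AE x in N. AE y in N'. (x, y) \<in> C \<times> C'"
      using A.AE_support
    proof eventually_elim
      case (elim x)
      then show ?case using B.AE_support by auto
    qed
  qed
  with s CC show ?thesis by unfold_locales
qed

lemma
  fixes g :: "'a::euclidean_space \<Rightarrow> 'b::euclidean_space \<Rightarrow> real"
  assumes "compact_prob N C" "compact_prob N' C'" "continuous_on UNIV (\<lambda>(x, y). g x y)"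
  shows integral_pair_continuous:
      "integral\<^sup>L (N \<Otimes>\<^sub>M N') (\<lambda>(x, y). g x y) = (\<integral>x. (\<integral>y. g x y \<partial>N') \<partial>N)"
    and Fubini_continuous: "(\<integral>x. (\<integral>y. g x y \<partial>N') \<partial>N) = (\<integral>y. (\<integral>x. g x y \<partial>N) \<partial>N')"
proof -
  interpret A: compact_prob N C by fact
  interpret B: compact_prob N' C' by fact
  interpret P: pair_prob_space N N' ..
  interpret AB: compact_prob "N \<Otimes>\<^sub>M N'" "C \<times> C'" by (rule compact_prob_pair) fact+
  have *: "integrable (N \<Otimes>\<^sub>M N') (\<lambda>(x, y). g x y)"
    by (rule AB.integrable_continuous) fact
  show "integral\<^sup>L (N \<Otimes>\<^sub>M N') (\<lambda>(x, y). g x y) = (\<integral>x. (\<integral>y. g x y \<partial>N') \<partial>N)"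
    "(\<integral>x. (\<integral>y. g x y \<partial>N') \<partial>N) = (\<integral>y. (\<integral>x. g x y \<partial>N) \<partial>N')"
    using P.integral_fst'[OF *] P.Fubini_integral[OF *] by auto
qed

section \<open>The rotation-invariant measure on a sphere\<close>

lemma nn_integral_lborel_translate:
  fixes g :: "'a::euclidean_space \<Rightarrow> ennreal"
  assumes "g \<in> borel_measurable borel"
  shows "(\<integral>\<^sup>+x. g (c + x) \<partial>lborel) = (\<integral>\<^sup>+x. g x \<partial>lborel)"
  using nn_integral_distr[of "(+) c" lborel borel g] assms by (simp add: lborel_distr_plus)

lemma emeasure_unit_ball_nontrivial:
  "emeasure lborel (ball 0 1 :: 'a::euclidean_space set) \<noteq> 0"
  "emeasure lborel (ball 0 1 :: 'a::euclidean_space set) \<noteq> top"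
proof -
  have "unit_ball_vol (real DIM('a)) \<noteq> 0"
    by (rule less_imp_neq[OF unit_ball_vol_pos, symmetric]) simp
  then show "emeasure lborel (ball 0 1 :: 'a set) \<noteq> 0" "emeasure lborel (ball 0 1 :: 'a set) \<noteq> top"
    by (auto simp: emeasure_ball)
qed

text \<open>
  Two translation-invariant measures are proportional: for a ball \<open>A\<close> and a Borel set \<open>B\<close>,
  the volumes of \<open>A\<close> and of \<open>B\<close> can be multiplied inside a double integral, and translating the two
  variables in turn moves \<open>T\<close> from one factor to the other. The constant is \<open>1\<close> because
  \<open>T\<close> preserves the ball \<open>A\<close>.
\<close>

lemma distr_lborel_orthogonal:
  fixes T :: "'a::euclidean_space \<Rightarrow> 'a"
  assumes T: "orthogonal_transformation T"
  shows "distr lborel borel T = lborel"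
proof (rule measure_eqI)
  fix B assume "B \<in> sets (distr lborel borel T)"
  then have [measurable]: "B \<in> sets borel" by simp
  have lin: "linear T" and nT: "\<And>x. norm (T x) = norm x"
    using T by (auto simp: orthogonal_transformation)
  then have [measurable]: "T \<in> borel_measurable borel"
    by (simp add: borel_measurable_continuous_onI linear_continuous_on linear_linear)
  define A where "A = (ball 0 1 :: 'a set)"
  have [measurable]: "A \<in> sets borel" by (simp add: A_def)
  have A_fin: "emeasure lborel A \<noteq> top" "emeasure lborel A \<noteq> 0"
    by (auto simp: A_def emeasure_unit_ball_nontrivial)
  have A_vol: "(\<integral>\<^sup>+y. indicator A (c - y) \<partial>lborel) = emeasure lborel A" for c
  proof -
    have "(\<integral>\<^sup>+y. indicator A (c - y) \<partial>lborel) = (\<integral>\<^sup>+y. indicator (ball c 1) y \<partial>lborel)"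
      by (intro nn_integral_cong) (auto simp: A_def indicator_def dist_norm norm_minus_commute)
    then show ?thesis by (simp add: A_def emeasure_ball)
  qed
  have "emeasure lborel A * emeasure lborel B
      = (\<integral>\<^sup>+x. (\<integral>\<^sup>+y. indicator A x * indicator B y \<partial>lborel) \<partial>lborel)"
    by (simp add: nn_integral_cmult nn_integral_multc)
  also have "\<dots> = (\<integral>\<^sup>+x. (\<integral>\<^sup>+y. indicator A (T x) * indicator B (T x + y) \<partial>lborel) \<partial>lborel)"
  proof (rule nn_integral_cong)
    fix x
    have "(\<integral>\<^sup>+y. indicator A x * indicator B y \<partial>lborel) = (\<integral>\<^sup>+y. indicator A (T x) * indicator B y \<partial>lborel)"
      by (simp add: A_def nT indicator_def)
    also have "\<dots> = (\<integral>\<^sup>+y. indicator A (T x) * indicator B (T x + y) \<partial>lborel)"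
      by (rule nn_integral_lborel_translate[symmetric]) measurable
    finally show "(\<integral>\<^sup>+y. indicator A x * indicator B y \<partial>lborel)
      = (\<integral>\<^sup>+y. indicator A (T x) * indicator B (T x + y) \<partial>lborel)" .
  qed
  also have "\<dots> = (\<integral>\<^sup>+y. (\<integral>\<^sup>+x. indicator A (T x) * indicator B (T x + y) \<partial>lborel) \<partial>lborel)"
    by (rule lborel_pair.Fubini') measurable
  \<comment> \<open>Translate \<open>x\<close> by a preimage of \<open>- y\<close> under \<open>T\<close>.\<close>
  also have "\<dots> = (\<integral>\<^sup>+y. (\<integral>\<^sup>+x. indicator A (T x - y) * indicator B (T x) \<partial>lborel) \<partial>lborel)"
  proof (rule nn_integral_cong)
    fix y
    obtain z where z: "T z = y"
      using orthogonal_transformation_surj[OF T] by (metis surjD)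
    have "(\<integral>\<^sup>+x. indicator A (T x) * indicator B (T x + y) \<partial>lborel)
      = (\<integral>\<^sup>+x. indicator A (T (- z + x)) * indicator B (T (- z + x) + y) \<partial>lborel)"
      by (rule nn_integral_lborel_translate[symmetric]) measurable
    also have "\<dots> = (\<integral>\<^sup>+x. indicator A (T x - y) * indicator B (T x) \<partial>lborel)"
      using z by (simp add: linear_diff[OF lin])
    finally show "(\<integral>\<^sup>+x. indicator A (T x) * indicator B (T x + y) \<partial>lborel)
      = (\<integral>\<^sup>+x. indicator A (T x - y) * indicator B (T x) \<partial>lborel)" .
  qed
  also have "\<dots> = (\<integral>\<^sup>+x. (\<integral>\<^sup>+y. indicator A (T x - y) * indicator B (T x) \<partial>lborel) \<partial>lborel)"
    by (rule lborel_pair.Fubini'[symmetric]) measurable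
  also have "\<dots> = (\<integral>\<^sup>+x. emeasure lborel A * indicator B (T x) \<partial>lborel)"
    by (simp add: nn_integral_multc A_vol)
  also have "\<dots> = emeasure lborel A * (\<integral>\<^sup>+x. indicator B x \<partial>distr lborel borel T)"
    by (subst nn_integral_distr) (auto simp: nn_integral_cmult)
  also have "\<dots> = emeasure lborel A * emeasure (distr lborel borel T) B"
    by (subst nn_integral_indicator) auto
  finally show "emeasure (distr lborel borel T) B = emeasure lborel B"
    using A_fin by (simp add: ennreal_mult_cancel_left)
qed simp

text \<open>
  The uniform distribution on the unit ball, projected radially to the sphere. The value
  \<open>sgn 0 = 0\<close> only concerns a null set.
\<close>

definition sphere_measure :: "'a::euclidean_space measure" where
  "sphere_measure = distr (uniform_measure lborel (ball 0 1)) borel sgn"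

lemma compact_prob_sphere_measure:
  "compact_prob (sphere_measure :: 'a::euclidean_space measure) (sphere 0 1)"
proof -
  have [measurable]: "(sgn :: 'a \<Rightarrow> 'a) \<in> borel_measurable borel"
    unfolding sgn_div_norm by measurable
  have v: "emeasure lborel (ball 0 1 :: 'a set) \<noteq> 0" "emeasure lborel (ball 0 1 :: 'a set) \<noteq> \<infinity>"
    using emeasure_unit_ball_nontrivial by auto
  interpret U: prob_space "uniform_measure lborel (ball 0 1 :: 'a set)"
    using v by (rule prob_space_uniform_measure)
  interpret S: prob_space "sphere_measure :: 'a measure"
    unfolding sphere_measure_def by (rule U.prob_space_distr) simp
  have "AE x in lborel. x \<noteq> (0::'a)"
    by (rule AE_lborel_singleton)
  then have "AE x in uniform_measure lborel (ball 0 1 :: 'a set). x \<noteq> 0"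
    by (intro AE_uniform_measureI) (auto elim: eventually_mono)
  then have "AE x in uniform_measure lborel (ball 0 1 :: 'a set). sgn x \<in> sphere 0 1"
    by eventually_elim (simp add: norm_sgn)
  then have "AE x :: 'a in sphere_measure. x \<in> sphere 0 1"
    unfolding sphere_measure_def by (subst AE_distr_iff) (auto simp: borel_closed)
  then show ?thesis
    by unfold_locales (auto simp: sphere_measure_def)
qed

lemma integral_sphere_measure_orthogonal:
  fixes T :: "'a::euclidean_space \<Rightarrow> 'a" and g :: "'a \<Rightarrow> real"
  assumes T: "orthogonal_transformation T" and g: "continuous_on UNIV g"
  shows "(\<integral>x. g (T x) \<partial>sphere_measure) = (\<integral>x. g x \<partial>sphere_measure)"
proof -
  have lin: "linear T" and nT: "\<And>x. norm (T x) = norm x"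
    using T by (auto simp: orthogonal_transformation)
  have [measurable]: "T \<in> borel_measurable borel"
    using lin by (simp add: borel_measurable_continuous_onI linear_continuous_on linear_linear)
  have [measurable]: "g \<in> borel_measurable borel"
    using g by (rule borel_measurable_continuous_onI)
  have [measurable]: "(sgn :: 'a \<Rightarrow> 'a) \<in> borel_measurable borel"
    unfolding sgn_div_norm by measurable
  define B where "B = (ball 0 1 :: 'a set)"
  have [measurable]: "B \<in> sets borel" by (simp add: B_def)
  have eq: "(\<integral>x. h x \<partial>sphere_measure) = (\<integral>x. indicator B x * h (sgn x) \<partial>lborel) / measure lborel B"
    if [measurable]: "h \<in> borel_measurable borel" for h :: "'a \<Rightarrow> real"
  proof -
    have "(\<integral>x. h x \<partial>sphere_measure) = (\<integral>x. h (sgn x) \<partial>uniform_measure lborel B)"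
      unfolding sphere_measure_def B_def[symmetric] by (rule integral_distr) measurable
    also have "\<dots> = (\<integral>x. indicator B x * h (sgn x) \<partial>lborel) / measure lborel B"
    proof -
      have v: "emeasure lborel B \<noteq> 0" "emeasure lborel B \<noteq> top"
        by (auto simp: B_def emeasure_unit_ball_nontrivial)
      have "uniform_measure lborel B = density lborel (\<lambda>x. ennreal (indicator B x / measure lborel B))"
        unfolding uniform_measure_def using v
        by (intro density_cong) (auto simp: indicator_def emeasure_eq_ennreal_measure divide_ennreal_def
            inverse_ennreal zero_less_measure_iff field_simps intro!: AE_I2)
      then show ?thesis
        by (simp add: integral_density)
    qed
    finally show ?thesis .
  qed
  have "(\<integral>x. indicator B x * g (sgn x) \<partial>lborel)
      = (\<integral>x. indicator B x * g (sgn x) \<partial>distr lborel borel T)"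
    by (simp add: distr_lborel_orthogonal[OF T])
  also have "\<dots> = (\<integral>x. indicator B (T x) * g (sgn (T x)) \<partial>lborel)"
    by (rule integral_distr) measurable
  also have "\<dots> = (\<integral>x. indicator B x * g (T (sgn x)) \<partial>lborel)"
    using lin by (simp add: B_def nT indicator_def sgn_div_norm linear_scale)
  finally show ?thesis
    by (simp add: eq)
qed


text \<open>
  The reflection in the hyperplane orthogonal to \<open>a - b\<close>.
\<close>

lemma orthogonal_transformation_exchanging:
  fixes a b :: "'a::euclidean_space"
  assumes "norm a = norm b"
  obtains T where "orthogonal_transformation T" "T a = b" "\<And>e. e \<bullet> a = e \<bullet> b \<Longrightarrow> T e = e"
proof
  define v where "v = a - b"
  define c where "c x = 2 * (v \<bullet> x) / (v \<bullet> v)" for x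
  define T where "T x = x - c x *\<^sub>R v" for x
  have "linear T"
    by (rule linearI) (simp_all add: T_def c_def inner_add_right algebra_simps add_divide_distrib)
  moreover have "T x \<bullet> T y = x \<bullet> y" for x y
  proof -
    have c: "c x * (v \<bullet> v) = 2 * (v \<bullet> x)" for x
      by (simp add: c_def)
    have "T x \<bullet> T y = x \<bullet> y - c y * (v \<bullet> x) - c x * (v \<bullet> y) + c x * (c y * (v \<bullet> v))"
      by (simp add: T_def inner_diff_left inner_diff_right inner_commute[of x v] algebra_simps)
    also have "\<dots> = x \<bullet> y - c y * (v \<bullet> x) + c x * (v \<bullet> y)"
      unfolding c by simp
    also have "c y * (v \<bullet> x) = c x * (v \<bullet> y)"
      by (simp add: c_def)
    finally show ?thesis by simp
  qed
  ultimately show "orthogonal_transformation T"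
    by (simp add: orthogonal_transformation_def)
  have "a \<bullet> a = b \<bullet> b"
    using assms by (simp add: dot_square_norm)
  then have *: "v \<bullet> v = 2 * (v \<bullet> a)"
    by (simp add: v_def inner_diff_left inner_diff_right inner_commute)
  show "T a = b"
  proof (cases "v = 0")
    case False
    then have "c a = 1" unfolding c_def *[symmetric] by simp
    then show ?thesis by (simp add: T_def v_def)
  qed (simp add: T_def v_def)
  show "T e = e" if e: "e \<bullet> a = e \<bullet> b" for e
  proof -
    have "v \<bullet> e = a \<bullet> e - b \<bullet> e" by (simp add: v_def inner_diff_left)
    then have "v \<bullet> e = 0" using e by (simp add: inner_commute)
    then show ?thesis by (simp add: T_def c_def)
  qed
qed

text \<open>
  Reflect \<open>x\<close> to \<open>x'\<close>, then the image of \<open>z\<close> to \<open>z'\<close>; the second reflection fixes \<open>x'\<close>, since the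
  two inner products agree. So the orthogonal group acts transitively on pairs of vectors with given
  lengths and inner product, and an invariant integral depends on such a pair only through
  these numbers.
\<close>

lemma orthogonal_transformation_pair:
  fixes x z x' z' :: "'a::euclidean_space"
  assumes "norm x = norm x'" "norm z = norm z'" "x \<bullet> z = x' \<bullet> z'"
  obtains T where "orthogonal_transformation T" "T x = x'" "T z = z'"
proof -
  obtain T1 where T1: "orthogonal_transformation T1" "T1 x = x'"
    using orthogonal_transformation_exchanging[OF assms(1)] by blast
  have "norm (T1 z) = norm z'"
    using T1(1) assms(2) by (simp add: orthogonal_transformation)
  then obtain T2 where T2: "orthogonal_transformation T2" "T2 (T1 z) = z'"
      "\<And>e. e \<bullet> T1 z = e \<bullet> z' \<Longrightarrow> T2 e = e"
    using orthogonal_transformation_exchanging by blast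
  have "T1 x \<bullet> T1 z = x \<bullet> z"
    using T1(1) by (simp add: orthogonal_transformation_def)
  then have "x' \<bullet> T1 z = x' \<bullet> z'"
    using T1(2) assms(3) by simp
  with T2 have "T2 x' = x'" by blast
  with T1 T2 show ?thesis
    by (intro that[of "T2 \<circ> T1"] orthogonal_transformation_compose) auto
qed

lemma orthonormal_pair_exists:
  assumes "2 \<le> DIM('a::euclidean_space)"
  obtains x e :: "'a::euclidean_space" where "norm x = 1" "norm e = 1" "x \<bullet> e = 0"
proof -
  obtain B where B: "B \<subseteq> (Basis :: 'a set)" "card B = 2"
    using assms by (metis obtain_subset_with_card_n)
  then obtain b e :: 'a where "b \<in> Basis" "e \<in> Basis" "b \<noteq> e"
    by (auto simp: card_2_iff)
  then show ?thesis by (intro that[of b e]) (auto simp: inner_not_same_Basis)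
qed

lemma sphere_integral_pair_eq:
  fixes x z x' z' :: "'a::euclidean_space" and g :: "real \<Rightarrow> real \<Rightarrow> real"
  assumes "norm x = norm x'" "norm z = norm z'" "x \<bullet> z = x' \<bullet> z'"
    and g: "continuous_on UNIV (\<lambda>(s, t). g s t)"
  shows "(\<integral>y. g (x \<bullet> y) (y \<bullet> z) \<partial>sphere_measure) = (\<integral>y. g (x' \<bullet> y) (y \<bullet> z') \<partial>sphere_measure)"
proof -
  obtain T where T: "orthogonal_transformation T" "T x = x'" "T z = z'"
    using orthogonal_transformation_pair[OF assms(1-3)] .
  have "continuous_on UNIV (\<lambda>y. g (x' \<bullet> y) (y \<bullet> z'))"
    using continuous_on_compose2[OF g, of UNIV "\<lambda>y. (x' \<bullet> y, y \<bullet> z')"]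
    by (simp add: continuous_on_Pair continuous_on_inner continuous_on_id continuous_on_const)
  note integral_sphere_measure_orthogonal[OF T(1) this]
  moreover have "x' \<bullet> T y = x \<bullet> y" "T y \<bullet> z' = y \<bullet> z" for y
    using T by (auto simp: orthogonal_transformation_def)
  ultimately show ?thesis by simp
qed

lemma continuous_on_split:
  assumes "continuous_on UNIV (\<lambda>(s, t). g s t)" "continuous_on A u" "continuous_on A v"
  shows "continuous_on A (\<lambda>y. g (u y) (v y))"
  using continuous_on_compose2[OF assms(1), of A "\<lambda>y. (u y, v y)"] assms(2,3)
  by (simp add: continuous_on_Pair)

section \<open>Normalised Gegenbauer polynomials\<close>

text \<open>
  \<open>ultra m k\<close> is the Gegenbauer polynomial of parameter \<open>(m - 1) / 2\<close> divided by its value at \<open>1\<close>.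
  In this normalisation the three-term recurrence does not degenerate at \<open>m = 1\<close>, where it is the
  Chebyshev recurrence, so that all spheres are treated alike.
\<close>

fun ultra :: "nat \<Rightarrow> nat \<Rightarrow> real poly" where
  "ultra m 0 = 1"
| "ultra m (Suc 0) = [:0, 1:]"
| "ultra m (Suc (Suc k)) = smult (1 / (real k + real m))
     (smult (2 * real k + real m + 1) ([:0, 1:] * ultra m (Suc k)) - smult (real k + 1) (ultra m k))"

lemma ultra_rec:
  assumes "1 \<le> m"
  shows "(real k + real m) * poly (ultra m (Suc (Suc k))) t =
    (2 * real k + real m + 1) * t * poly (ultra m (Suc k)) t - (real k + 1) * poly (ultra m k) t"
  using assms by (simp add: field_simps)

lemma poly_ultra_1: "1 \<le> m \<Longrightarrow> poly (ultra m k) 1 = 1"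
proof (induction m k rule: ultra.induct)
  case (3 m k)
  then show ?case
    using ultra_rec[of m k 1] by (simp add: field_simps del: ultra.simps(3)) (simp add: field_simps)
qed auto

lemma degree_ultra_le: "degree (ultra m k) \<le> k"
proof (induction m k rule: ultra.induct)
  case (3 m k)
  have "degree ([:0, 1:] * ultra m (Suc k)) \<le> Suc (Suc k)"
    using "3.IH"(1) degree_mult_le[of "[:0, 1:]" "ultra m (Suc k)"] by simp
  then show ?case
    using "3.IH"(2) by (auto intro!: degree_diff_le order.trans[OF degree_smult_le])
qed auto

lemma coeff_ultra_pos: "1 \<le> m \<Longrightarrow> 0 < coeff (ultra m k) k"
proof (induction m k rule: ultra.induct)
  case (3 m k)
  have "coeff (ultra m k) (Suc (Suc k)) = 0"
    using degree_ultra_le[of m k] by (intro coeff_eq_0) auto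
  then show ?case
    using 3 by (auto intro!: divide_pos_pos mult_pos_pos add_nonneg_pos)
qed auto

text \<open>
  That both coefficients are nonnegative is what makes the powers \<open>(1 + t)\<^sup>N\<close> expand
  with nonnegative coefficients. For \<open>k = 0\<close> the truncated index \<open>k - 1\<close> is harmless, as \<open>b = 0\<close> there.
\<close>

lemma ultra_times_t:
  assumes "1 \<le> m"
  obtains a b where "0 \<le> a" "0 \<le> b"
    "\<And>t. t * poly (ultra m k) t = a * poly (ultra m (Suc k)) t + b * poly (ultra m (k - 1)) t"
proof (cases k)
  case 0
  then show ?thesis by (intro that[of 1 0]) auto
next
  case (Suc j)
  have pos: "2 * real j + real m + 1 > 0" by simp
  show ?thesis
  proof (rule that[of "(real j + real m) / (2 * real j + real m + 1)" "(real j + 1) / (2 * real j + real m + 1)"])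
    fix t
    show "t * poly (ultra m k) t = (real j + real m) / (2 * real j + real m + 1) * poly (ultra m (Suc k)) t
        + (real j + 1) / (2 * real j + real m + 1) * poly (ultra m (k - 1)) t"
    proof -
      have "(2 * real j + real m + 1) * (t * poly (ultra m k) t)
          = (real j + real m) * poly (ultra m (Suc k)) t + (real j + 1) * poly (ultra m (k - 1)) t"
        using ultra_rec[OF assms, of j t] Suc by (simp add: mult.assoc del: ultra.simps(3))
      then have "t * poly (ultra m k) t
          = ((real j + real m) * poly (ultra m (Suc k)) t + (real j + 1) * poly (ultra m (k - 1)) t)
            / (2 * real j + real m + 1)"
        using pos by (simp add: eq_divide_eq mult.commute del: ultra.simps(3))
      then show ?thesis
        by (simp add: add_divide_distrib algebra_simps)
    qed
  qed auto
qed

text \<open>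
  The structure relation \<open>(t\<^sup>2 - 1) R'\<^sub>k = k (t R\<^sub>k - R\<^sub>k\<^sub>-\<^sub>1)\<close>. Combined with the recurrence it also
  gives \<open>(t\<^sup>2 - 1) R'\<^sub>k = (k + m - 1) (R\<^sub>k\<^sub>+\<^sub>1 - t R\<^sub>k)\<close>; the induction differentiates the recurrence
  and needs both forms, for the two preceding indices.
\<close>

lemma ultra_deriv:
  assumes "1 \<le> m"
  shows "(t\<^sup>2 - 1) * poly (pderiv (ultra m (Suc k))) t =
     (real k + 1) * (t * poly (ultra m (Suc k)) t - poly (ultra m k) t)"
proof (induction k rule: less_induct)
  case (less k)
  show ?case
  proof (cases k)
    case 0
    then show ?thesis by (simp add: pderiv_pCons power2_eq_square)
  next
    case (Suc j)
    define A B C where "A = poly (ultra m j) t" and "B = poly (ultra m (Suc j)) t"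
      and "C = poly (ultra m (Suc (Suc j))) t"
    define A' B' C' where "A' = poly (pderiv (ultra m j)) t" and "B' = poly (pderiv (ultra m (Suc j))) t"
      and "C' = poly (pderiv (ultra m (Suc (Suc j)))) t"
    have pos: "real j + real m > 0" using assms by simp
    have rec: "(real j + real m) * C = (2 * real j + real m + 1) * t * B - (real j + 1) * A"
      using ultra_rec[OF assms, of j t] by (simp add: A_def B_def C_def)
    have "smult (real j + real m) (ultra m (Suc (Suc j))) =
       smult (2 * real j + real m + 1) ([:0, 1:] * ultra m (Suc j)) - smult (real j + 1) (ultra m j)"
      using pos by simp
    from arg_cong[OF this, of "\<lambda>p. poly (pderiv p) t"]
    have rec': "(real j + real m) * C' = (2 * real j + real m + 1) * (B + t * B') - (real j + 1) * A'"
      by (simp add: pderiv_smult pderiv_diff pderiv_mult pderiv_pCons A'_def B_def B'_def C'_def algebra_simps del: ultra.simps(3))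
    have B: "(t\<^sup>2 - 1) * B' = (real j + 1) * (t * B - A)"
      using less[of j] Suc by (simp add: A_def B_def B'_def)
    have A: "(t\<^sup>2 - 1) * A' = (real j + real m - 1) * (B - t * A)"
    proof (cases j)
      case 0
      then show ?thesis by (simp add: A'_def A_def B_def)
    next
      case (Suc i)
      have "(t\<^sup>2 - 1) * A' = (real i + 1) * (t * A - poly (ultra m i) t)"
        using less[of i] Suc \<open>k = Suc j\<close> by (simp add: A_def A'_def)
      moreover have "(real i + real m) * B = (2 * real i + real m + 1) * t * A - (real i + 1) * poly (ultra m i) t"
        using ultra_rec[OF assms, of i t] Suc by (simp add: A_def B_def)
      ultimately show ?thesis using Suc by (simp add: algebra_simps)
    qed
    have "(real j + real m) * ((t\<^sup>2 - 1) * C') = (2 * real j + real m + 1) * ((t\<^sup>2 - 1) * B + t * ((t\<^sup>2 - 1) * B'))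
        - (real j + 1) * ((t\<^sup>2 - 1) * A')"
      using rec' by algebra
    also have "\<dots> = (real j + 2) * (t * ((2 * real j + real m + 1) * t * B - (real j + 1) * A) - (real j + real m) * B)"
      unfolding A B by algebra
    also have "\<dots> = (real j + real m) * ((real j + 2) * (t * C - B))"
      unfolding rec[symmetric] by algebra
    finally have "(t\<^sup>2 - 1) * C' = (real j + 2) * (t * C - B)"
      using pos by simp
    then show ?thesis
      by (simp add: Suc B_def C_def C'_def del: ultra.simps(3))
  qed
qed

lemma gegenbauer_eq_ultra:
  assumes "1 \<le> m"
  shows "\<exists>c>0. \<forall>t. gegenbauer m k t = c * poly (ultra m k) t"
proof (cases "m = 1")
  case True
  have "poly (chebyshev_poly k) t = poly (ultra 1 k) t" for t
  proof (induction k rule: chebyshev_poly.induct)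
    case (3 k)
    then show ?case
      using ultra_rec[of 1 k t] by (simp add: field_simps del: ultra.simps(3)) (simp add: field_simps)
  qed auto
  then show ?thesis
    using True by (intro exI[of _ 1]) (auto simp: gegenbauer_def)
next
  case False
  then have m: "2 \<le> m" using assms by simp
  define c where "c k = (\<Prod>i<k. (real m - 1 + real i) / (real i + 1))" for k
  have c_Suc: "c (Suc k) * (real k + 1) = c k * (real m - 1 + real k)" for k
    by (simp add: c_def)
  have "poly (gegenbauer_poly ((real m - 1) / 2) k) t = c k * poly (ultra m k) t" for t
  proof (induction k rule: chebyshev_poly.induct)
    case (3 k)
    let ?R = "\<lambda>k. poly (ultra m k) t"
    have "(real k + 2) * poly (gegenbauer_poly ((real m - 1) / 2) (Suc (Suc k))) t
       = (2 * real k + real m + 1) * t * (c (Suc k) * ?R (Suc k)) - (real k + real m - 1) * (c k * ?R k)"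
      using 3 by (simp add: field_simps del: ultra.simps(3))
    also have "\<dots> = c (Suc k) * ((2 * real k + real m + 1) * t * ?R (Suc k) - (real k + 1) * ?R k)"
      using c_Suc[of k] by algebra
    also have "\<dots> = c (Suc k) * ((real k + real m) * ?R (Suc (Suc k)))"
      by (simp only: ultra_rec[OF assms])
    also have "\<dots> = (real k + 2) * (c (Suc (Suc k)) * ?R (Suc (Suc k)))"
    proof -
      have "c (Suc (Suc k)) * (real k + 2) = c (Suc k) * (real k + real m)"
        using c_Suc[of "Suc k"] by (simp add: algebra_simps)
      then show ?thesis by algebra
    qed
    finally show ?case by simp
  qed (auto simp: c_def)
  moreover have "c k > 0"
    unfolding c_def using m by (intro prod_pos) auto
  ultimately show ?thesis
    using False by (auto simp: gegenbauer_def)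
qed

lemma gegenbauer_normalised:
  assumes "1 \<le> m"
  shows "gegenbauer m k t = gegenbauer m k 1 * poly (ultra m k) t" "0 < gegenbauer m k 1"
  using gegenbauer_eq_ultra[OF assms, of k] by (auto simp: poly_ultra_1[OF assms])

section \<open>The Gegenbauer weight as a probability measure\<close>

lemma weight_eq:
  "1 - t\<^sup>2 > 0 \<Longrightarrow> weight m t * (1 - t\<^sup>2) = (1 - t\<^sup>2) powr (real m / 2)"
proof -
  assume t: "1 - t\<^sup>2 > 0"
  have "(1 - t\<^sup>2) powr ((real m - 2) / 2) * (1 - t\<^sup>2) powr 1 = (1 - t\<^sup>2) powr ((real m - 2) / 2 + 1)"
    by (rule powr_add[symmetric])
  also have "(real m - 2) / 2 + 1 = real m / 2" by (simp add: field_simps)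
  finally have "(1 - t\<^sup>2) powr ((real m - 2) / 2) * (1 - t\<^sup>2) powr 1 = (1 - t\<^sup>2) powr (real m / 2)" .
  then show ?thesis using t by (simp add: weight_def)
qed

lemma weight_pos: "\<bar>t\<bar> < 1 \<Longrightarrow> 0 < weight m t"
  using abs_square_less_1[of t] by (auto simp: weight_def)

lemma weight_nonneg: "0 \<le> weight m t"
  by (simp add: weight_def)

lemma weight_measurable [measurable]: "weight m \<in> borel_measurable borel"
  unfolding weight_def by measurable

text \<open>
  For \<open>m = 1\<close> the weight is unbounded, with antiderivative \<open>arcsin\<close>; for \<open>m \<ge> 2\<close> it is
  bounded by \<open>1\<close>.
\<close>

lemma weight_integrable:
  assumes "1 \<le> m"
  shows "set_integrable lborel {-1..1} (weight m)"
proof (cases "m = 1")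
  case True
  have "(weight m has_integral (arcsin 1 - arcsin (-1))) {-1..1}"
  proof (rule fundamental_theorem_of_calculus_interior)
    fix x :: real assume x: "x \<in> {-1<..<1}"
    then have p: "1 - x\<^sup>2 > 0" by (auto simp: abs_square_less_1)
    have "weight m x = inverse (sqrt (1 - x\<^sup>2))"
      using p True by (simp add: weight_def powr_minus powr_half_sqrt)
    moreover have "DERIV arcsin x :> inverse (sqrt (1 - x\<^sup>2))"
      using x by (intro DERIV_arcsin) auto
    ultimately show "(arcsin has_vector_derivative weight m x) (at x)"
      by (simp add: has_real_derivative_iff_has_vector_derivative)
  qed (auto intro: continuous_on_arcsin')
  then have "weight m absolutely_integrable_on {-1..1}"
    by (intro nonnegative_absolutely_integrable_1) (auto simp: weight_nonneg)
  then show ?thesis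
    unfolding set_integrable_def by (subst (asm) integrable_completion) auto
next
  case False
  have "norm (weight m t) \<le> 1" if "t \<in> {-1..1}" for t
  proof -
    have "(1 - t\<^sup>2) powr ((real m - 2) / 2) \<le> 1 powr ((real m - 2) / 2)"
      using that assms False by (intro powr_mono2) (auto simp: abs_square_le_1)
    then show ?thesis by (simp add: weight_def)
  qed
  then have bound: "AE t in lborel. t \<in> {-1..1} \<longrightarrow> norm (weight m t) \<le> norm (1::real)"
    by (intro AE_I2) simp
  show ?thesis
  proof (rule set_integrable_bound[OF _ _ bound])
    show "set_integrable lborel {-1..1} (\<lambda>_ :: real. 1 :: real)"
      by (simp add: set_integrable_def)
  qed (simp add: set_borel_measurable_def)
qed

text \<open>
  The set where \<open>u\<close> differs from \<open>0\<close> inside the interval is open and null, hence empty; the endpoints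
  follow by continuity.
\<close>

lemma AE_interval_zero:
  fixes u :: "real \<Rightarrow> real"
  assumes "continuous_on UNIV u" "AE t in lborel. t \<in> {-1<..<1} \<longrightarrow> u t = 0" "t \<in> {-1..1}"
  shows "u t = 0"
proof -
  define U where "U = {-1<..<1} \<inter> {t. u t \<noteq> 0}"
  have "open U"
    unfolding U_def by (intro open_Int open_Collect_neq assms(1) continuous_on_const) simp
  have "AE t in lborel. t \<notin> U"
    using assms(2) by eventually_elim (auto simp: U_def)
  then have "U \<in> null_sets lborel"
    using \<open>open U\<close> by (subst (asm) AE_iff_null_sets[symmetric]) auto
  then have "negligible U"
    by (simp add: negligible_iff_null_sets null_sets_completionI)
  then have "U = {}"
    using \<open>open U\<close> open_not_negligible by blast
  then have "\<And>t. t \<in> {-1<..<1} \<Longrightarrow> u t = 0"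
    by (auto simp: U_def)
  moreover have "closure {-1<..<1} = {-1..1::real}"
    by simp
  ultimately show ?thesis
    using continuous_constant_on_closure[of "{-1<..<1}" u 0 t] assms(3)
      continuous_on_subset[OF assms(1) subset_UNIV] by auto
qed

definition weight_mass :: "nat \<Rightarrow> real" where
  "weight_mass m = (LBINT t:{-1..1}. weight m t)"

lemma weight_mass_pos:
  assumes "1 \<le> m"
  shows "0 < weight_mass m"
proof -
  have "weight_mass m \<ge> 0"
    unfolding weight_mass_def set_lebesgue_integral_def by (intro Bochner_Integration.integral_nonneg) (auto simp: weight_nonneg)
  moreover have "weight_mass m \<noteq> 0"
  proof
    assume "weight_mass m = 0"
    then have "AE t in lborel. indicator {-1..1} t *\<^sub>R weight m t = 0"
      using weight_integrable[OF assms] unfolding weight_mass_def set_lebesgue_integral_def set_integrable_def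
      by (subst (asm) integral_nonneg_eq_0_iff_AE) (auto simp: weight_nonneg)
    then have "AE t :: real in lborel. t \<in> {-1<..<1} \<longrightarrow> (1::real) = 0"
    proof (rule eventually_mono)
      fix t :: real
      assume "indicator {-1..1} t *\<^sub>R weight m t = 0"
      then show "t \<in> {-1<..<1} \<longrightarrow> (1::real) = 0"
        using weight_pos[of t m] by (auto simp: indicator_def abs_less_iff split: if_splits)
    qed
    from AE_interval_zero[of "\<lambda>_. 1", OF _ this, of 0] show False by simp
  qed
  ultimately show ?thesis by simp
qed

definition weight_measure :: "nat \<Rightarrow> real measure" where
  "weight_measure m = density lborel (\<lambda>t. ennreal (indicator {-1..1} t * weight m t / weight_mass m))"

lemma integral_weight_measure:
  assumes "1 \<le> m" and [measurable]: "g \<in> borel_measurable borel"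
  shows "integral\<^sup>L (weight_measure m) g = (LBINT t:{-1..1}. g t * weight m t) / weight_mass m"
proof -
  have "integral\<^sup>L (weight_measure m) g = (\<integral>t. (indicator {-1..1} t * weight m t / weight_mass m) *\<^sub>R g t \<partial>lborel)"
    unfolding weight_measure_def using weight_mass_pos[OF assms(1)]
    by (intro integral_density) (auto simp: weight_nonneg)
  also have "\<dots> = (\<integral>t. (indicator {-1..1} t * (g t * weight m t)) / weight_mass m \<partial>lborel)"
    by (intro Bochner_Integration.integral_cong) auto
  finally show ?thesis
    by (simp add: set_lebesgue_integral_def)
qed

lemma compact_prob_weight_measure:
  assumes "1 \<le> m"
  shows "compact_prob (weight_measure m) {-1..1}"
proof -
  have pos: "weight_mass m > 0" by (rule weight_mass_pos) fact
  have "emeasure (weight_measure m) (space (weight_measure m))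
      = (\<integral>\<^sup>+t. ennreal (indicator {-1..1} t * weight m t / weight_mass m) \<partial>lborel)"
    by (simp add: weight_measure_def emeasure_density)
  also have "\<dots> = ennreal (\<integral>t. indicator {-1..1} t * weight m t / weight_mass m \<partial>lborel)"
    using weight_integrable[OF assms] pos
    by (intro nn_integral_eq_integral) (auto simp: set_integrable_def weight_nonneg)
  also have "(\<integral>t. indicator {-1..1} t * weight m t / weight_mass m \<partial>lborel) = 1"
    using pos by (simp add: weight_mass_def set_lebesgue_integral_def)
  finally interpret prob_space "weight_measure m"
    by (intro prob_spaceI) simp
  have "AE x in weight_measure m. x \<in> {-1..1}"
    unfolding weight_measure_def by (subst AE_density) (auto simp: indicator_def)
  then show ?thesis
    by unfold_locales (auto simp: weight_measure_def)
qed

text \<open>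
  The function \<open>q(t) (1 - t\<^sup>2)\<^sup>m\<^sup>/\<^sup>2\<close> vanishes at both endpoints, and its derivative is the weight times
  \<open>(1 - t\<^sup>2) q'(t) - m t q(t)\<close>. This identity is the only property of the weight that is used for
  moments, orthogonality and concentration.
\<close>

lemma weight_measure_by_parts:
  fixes q q' :: "real \<Rightarrow> real"
  assumes m: "1 \<le> m"
    and q: "\<And>t. (q has_real_derivative q' t) (at t)" and q': "continuous_on UNIV q'"
  shows "(\<integral>t. (1 - t\<^sup>2) * q' t \<partial>weight_measure m) = real m * (\<integral>t. t * q t \<partial>weight_measure m)"
proof -
  interpret compact_prob "weight_measure m" "{-1..1}" by (rule compact_prob_weight_measure) fact
  have cq: "continuous_on UNIV q"
    using q by (meson DERIV_isCont continuous_at_imp_continuous_on)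
  define h where "h t = (1 - t\<^sup>2) * q' t - real m * (t * q t)" for t
  have ch: "continuous_on UNIV h"
    unfolding h_def by (intro continuous_intros cq q')
  then have [measurable]: "h \<in> borel_measurable borel" by (rule borel_measurable_continuous_onI)
  define F where "F t = q t * (1 - t\<^sup>2) powr (real m / 2)" for t
  have "((\<lambda>t. h t * weight m t) has_integral (F 1 - F (-1))) {-1..1}"
  proof (rule fundamental_theorem_of_calculus_interior)
    show "continuous_on {-1..1} F"
      unfolding F_def using m
      by (intro continuous_intros continuous_on_powr' continuous_on_subset[OF cq]) (auto simp: abs_square_le_1)
    fix t :: real assume "t \<in> {-1<..<1}"
    then have p: "1 - t\<^sup>2 > 0" by (auto simp: abs_square_less_1)
    have "(F has_real_derivative (q' t * (1 - t\<^sup>2) powr (real m / 2)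
        + (real m / 2 * (1 - t\<^sup>2) powr (real m / 2 - 1) * (- 2 * t)) * q t)) (at t)"
      unfolding F_def using p
      by (auto intro!: derivative_eq_intros q simp: field_simps)
    also have "real m / 2 - 1 = (real m - 2) / 2" by (simp add: field_simps)
    also have "q' t * (1 - t\<^sup>2) powr (real m / 2)
        + (real m / 2 * (1 - t\<^sup>2) powr ((real m - 2) / 2) * (- 2 * t)) * q t = h t * weight m t"
      unfolding weight_eq[OF p, symmetric] by (simp add: h_def weight_def algebra_simps)
    finally show "(F has_vector_derivative h t * weight m t) (at t)"
      by (simp add: has_real_derivative_iff_has_vector_derivative)
  qed simp
  then have "integral {-1..1} (\<lambda>t. h t * weight m t) = 0"
    by (simp add: F_def integral_unique)
  moreover have "set_integrable lborel {-1..1} (\<lambda>t. h t * weight m t)"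
  proof -
    obtain B where B: "\<And>t. t \<in> {-1..1} \<Longrightarrow> \<bar>h t\<bar> \<le> B"
      using compact_imp_bounded[OF compact_continuous_image[OF continuous_on_subset[OF ch] compact_Icc, of "-1" 1]]
      by (auto simp: bounded_iff intro: that)
    show ?thesis
    proof (rule set_integrable_bound[OF set_integrable_mult_right[OF weight_integrable[OF m], of B]])
      show "AE t in lborel. t \<in> {-1..1} \<longrightarrow> norm (h t * weight m t) \<le> norm (B * weight m t)"
      proof (rule AE_I2, rule impI)
        fix t :: real assume "t \<in> {-1..1}"
        then have "\<bar>h t\<bar> \<le> \<bar>B\<bar>" using B by fastforce
        then show "norm (h t * weight m t) \<le> norm (B * weight m t)"
          by (simp add: abs_mult mult_right_mono)
      qed
    qed (auto simp: set_borel_measurable_def)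
  qed
  ultimately have "(LBINT t:{-1..1}. h t * weight m t) = 0"
    by (simp add: set_borel_integral_eq_integral)
  then have "integral\<^sup>L (weight_measure m) h = 0"
    using m by (subst integral_weight_measure) auto
  moreover have "integrable (weight_measure m) (\<lambda>t. (1 - t\<^sup>2) * q' t)"
      "integrable (weight_measure m) (\<lambda>t. real m * (t * q t))"
    by (intro integrable_continuous continuous_intros q' cq)+
  ultimately show ?thesis
    unfolding h_def by (subst (asm) Bochner_Integration.integral_diff) auto
qed

lemma weight_measure_zero:
  fixes u :: "real \<Rightarrow> real"
  assumes "1 \<le> m" "continuous_on UNIV u" "(\<integral>t. (u t)\<^sup>2 \<partial>weight_measure m) = 0" "t \<in> {-1..1}"
  shows "u t = 0"
proof -
  interpret compact_prob "weight_measure m" "{-1..1}" by (rule compact_prob_weight_measure) fact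
  have c: "continuous_on UNIV (\<lambda>t. (u t)\<^sup>2)" by (intro continuous_intros assms(2))
  have pos: "weight_mass m > 0" by (rule weight_mass_pos) fact
  have [measurable]: "u \<in> borel_measurable borel" using assms(2) by (rule borel_measurable_continuous_onI)
  have "AE t in weight_measure m. (u t)\<^sup>2 = 0"
    using assms(3) by (subst (asm) integral_nonneg_eq_0_iff_AE) (auto intro: integrable_continuous[OF c])
  then have "AE t in lborel. 0 < ennreal (indicator {-1..1} t * weight m t / weight_mass m) \<longrightarrow> (u t)\<^sup>2 = 0"
    unfolding weight_measure_def by (subst (asm) AE_density) auto
  then have "AE t in lborel. t \<in> {-1<..<1} \<longrightarrow> u t = 0"
  proof eventually_elim
    case (elim t)
    have "0 < weight m t / weight_mass m" if "t \<in> {-1<..<1}"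
      using pos that by (intro divide_pos_pos weight_pos) auto
    with elim show ?case by (auto simp: indicator_def)
  qed
  then show ?thesis
    using AE_interval_zero[OF assms(2) _ assms(4)] by blast
qed

section \<open>Orthogonality, completeness and concentration at one\<close>

lemma weight_measure_t:
  assumes "1 \<le> m"
  shows "(\<integral>t. t \<partial>weight_measure m) = 0"
  using weight_measure_by_parts[OF assms, of "\<lambda>_. 1" "\<lambda>_. 0"] assms by simp

text \<open>
  Integration by parts with \<open>q = R\<^sub>k\<^sub>+\<^sub>1\<close>, the structure relation and the recurrence express the integral
  of \<open>R\<^sub>k\<^sub>+\<^sub>2\<close> as \<open>k (k + 1)\<close> times a multiple of the integral of \<open>R\<^sub>k\<close>. The factor \<open>k\<close> stops
  the contribution of \<open>R\<^sub>0\<close>, so that all integrals of positive index vanish.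
\<close>

lemma integral_ultra_zero:
  assumes m: "1 \<le> m"
  shows "(\<integral>t. poly (ultra m (Suc k)) t \<partial>weight_measure m) = 0"
proof -
  interpret compact_prob "weight_measure m" "{-1..1}" by (rule compact_prob_weight_measure) fact
  have ip: "integrable (weight_measure m) (\<lambda>t. poly p t)" 
      "integrable (weight_measure m) (\<lambda>t. t * poly p t)" for p :: "real poly"
    by (intro integrable_continuous continuous_intros)+
  define I where "I k = (\<integral>t. poly (ultra m k) t \<partial>weight_measure m)" for k
  define J where "J k = (\<integral>t. t * poly (ultra m k) t \<partial>weight_measure m)" for k
  \<comment> \<open>For \<open>k = 0\<close> the right-hand side vanishes, which starts the even indices.\<close>
  have step: "(real k + real m) * (real k + 1 + real m) * I (Suc (Suc k)) = (real k + 1) * real k * I k" for k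
  proof -
    have "(\<integral>t. (1 - t\<^sup>2) * poly (pderiv (ultra m (Suc k))) t \<partial>weight_measure m) = real m * J (Suc k)"
      unfolding J_def by (intro weight_measure_by_parts[OF m] poly_DERIV continuous_intros)
    moreover have "(1 - t\<^sup>2) * poly (pderiv (ultra m (Suc k))) t
        = (real k + 1) * (poly (ultra m k) t - t * poly (ultra m (Suc k)) t)" for t
      using ultra_deriv[OF m, of t k] by algebra
    ultimately have J: "(real k + 1) * (I k - J (Suc k)) = real m * J (Suc k)"
      using ip by (simp add: I_def J_def)
    have "(\<integral>t. (real k + real m) * poly (ultra m (Suc (Suc k))) t \<partial>weight_measure m)
      = (\<integral>t. (2 * real k + real m + 1) * (t * poly (ultra m (Suc k)) t) - (real k + 1) * poly (ultra m k) t \<partial>weight_measure m)"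
      by (simp only: ultra_rec[OF m] mult.assoc)
    then have "(real k + real m) * I (Suc (Suc k)) = (2 * real k + real m + 1) * J (Suc k) - (real k + 1) * I k"
      using ip by (simp add: I_def J_def del: ultra.simps(3))
    with J show ?thesis by algebra
  qed
  show ?thesis
  proof (induction k rule: induct_nat_012)
    case 0
    then show ?case using weight_measure_t[OF m] by simp
  next
    case 1
    have "(1 + real m) * I 2 = 0"
      using step[of 0] m by (simp add: numeral_2_eq_2 del: ultra.simps(3))
    then show ?case
      using m by (simp add: I_def numeral_2_eq_2 del: ultra.simps(3))
  next
    case (ge2 n)
    have "I (Suc n) = 0" using ge2 by (simp add: I_def)
    then have "(real (Suc n) + real m) * (real (Suc n) + 1 + real m) * I (Suc (Suc (Suc n))) = 0"
      using step[of "Suc n"] by simp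
    then show ?case
      using m by (simp add: I_def del: ultra.simps(3) of_nat_Suc)
  qed
qed

text \<open>
  Each factor \<open>t\<close> lowers the index by at most one, so \<open>t\<^sup>j R\<^sub>k\<close> is a combination of polynomials \<open>R\<^sub>i\<close>
  with \<open>i > 0\<close>, which all have integral zero.
\<close>

lemma ultra_orthogonal_monomial:
  assumes m: "1 \<le> m"
  shows "j < k \<Longrightarrow> (\<integral>t. t ^ j * poly (ultra m k) t \<partial>weight_measure m) = 0"
proof (induction j arbitrary: k)
  case 0
  then show ?case using integral_ultra_zero[OF m, of "k - 1"] by simp
next
  case (Suc j)
  interpret compact_prob "weight_measure m" "{-1..1}" by (rule compact_prob_weight_measure) fact
  obtain a b where ab: "\<And>t. t * poly (ultra m k) t = a * poly (ultra m (Suc k)) t + b * poly (ultra m (k - 1)) t"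
    using ultra_times_t[OF m, of k] by metis
  have ip: "integrable (weight_measure m) (\<lambda>t. t ^ j * poly p t)" for p :: "real poly"
    by (intro integrable_continuous continuous_intros)
  have "t ^ Suc j * poly (ultra m k) t = a * (t ^ j * poly (ultra m (Suc k)) t) + b * (t ^ j * poly (ultra m (k - 1)) t)" for t
    using ab[of t] by (simp only: power_Suc2 mult.assoc) (simp add: algebra_simps)
  then have "(\<integral>t. t ^ Suc j * poly (ultra m k) t \<partial>weight_measure m)
     = a * (\<integral>t. t ^ j * poly (ultra m (Suc k)) t \<partial>weight_measure m) + b * (\<integral>t. t ^ j * poly (ultra m (k - 1)) t \<partial>weight_measure m)"
    using ip by simp
  also have "\<dots> = 0"
    using Suc.IH[of "Suc k"] Suc.IH[of "k - 1"] Suc.prems by simp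
  finally show ?case .
qed

lemma ultra_orthogonal_poly:
  assumes m: "1 \<le> m" and "degree q < k"
  shows "(\<integral>t. poly q t * poly (ultra m k) t \<partial>weight_measure m) = 0"
proof -
  interpret compact_prob "weight_measure m" "{-1..1}" by (rule compact_prob_weight_measure) fact
  have ip: "integrable (weight_measure m) (\<lambda>t. coeff q i * (t ^ i * poly (ultra m k) t))" for i
    by (intro integrable_continuous continuous_intros)
  have "(\<integral>t. poly q t * poly (ultra m k) t \<partial>weight_measure m)
    = (\<integral>t. (\<Sum>i\<le>degree q. coeff q i * (t ^ i * poly (ultra m k) t)) \<partial>weight_measure m)"
    by (simp add: poly_altdef sum_distrib_right mult.assoc)
  also have "\<dots> = (\<Sum>i\<le>degree q. coeff q i * (\<integral>t. t ^ i * poly (ultra m k) t \<partial>weight_measure m))"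
    using ip by simp
  also have "\<dots> = 0"
    using assms by (intro sum.neutral) (auto simp: ultra_orthogonal_monomial[OF m])
  finally show ?thesis .
qed

definition ultra_norm :: "nat \<Rightarrow> nat \<Rightarrow> real" where
  "ultra_norm m k = (\<integral>t. (poly (ultra m k) t)\<^sup>2 \<partial>weight_measure m)"

lemma ultra_norm_pos:
  assumes m: "1 \<le> m"
  shows "0 < ultra_norm m k"
proof -
  have "ultra_norm m k \<noteq> 0"
  proof
    assume "ultra_norm m k = 0"
    then have zero: "(\<integral>t. (poly (ultra m k) t)\<^sup>2 \<partial>weight_measure m) = 0"
      by (simp add: ultra_norm_def)
    have "continuous_on UNIV (poly (ultra m k))"
      by (intro continuous_intros)
    from weight_measure_zero[OF m this zero, of 1] have "poly (ultra m k) 1 = 0"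
      by simp
    then show False using poly_ultra_1[OF m] by simp
  qed
  moreover have "0 \<le> ultra_norm m k"
    unfolding ultra_norm_def by (intro Bochner_Integration.integral_nonneg) simp
  ultimately show ?thesis by simp
qed

lemma integral_ultra_ultra:
  assumes m: "1 \<le> m"
  shows "(\<integral>t. poly (ultra m j) t * poly (ultra m k) t \<partial>weight_measure m) = (if j = k then ultra_norm m k else 0)"
proof -
  have "(\<integral>t. poly (ultra m j) t * poly (ultra m k) t \<partial>weight_measure m) = 0" if "j < k" for j k
    using that degree_ultra_le[of m j] by (intro ultra_orthogonal_poly[OF m]) auto
  from this[of j k] this[of k j] show ?thesis
    by (cases j k rule: linorder_cases) (auto simp: ultra_norm_def power2_eq_square mult.commute)
qed

lemma Weierstrass_poly:
  fixes g :: "real \<Rightarrow> real"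
  assumes "continuous_on UNIV g" "0 < e"
  obtains p :: "real poly" where "\<And>t. t \<in> {-1..1} \<Longrightarrow> \<bar>g t - poly p t\<bar> < e"
proof -
  obtain q where q: "real_polynomial_function q" "\<And>t. t \<in> {-1..1} \<Longrightarrow> \<bar>g t - q t\<bar> < e"
    using Stone_Weierstrass_real_polynomial_function[of "{-1..1}" g e] assms continuous_on_subset by blast
  then obtain a n where "q = (\<lambda>x. \<Sum>i\<le>n. a i * x ^ i)"
    by (auto simp: real_polynomial_function_iff_sum)
  then have "q t = poly (\<Sum>i\<le>n. monom (a i) i) t" for t
    by (simp add: poly_sum poly_monom)
  with q that show ?thesis by metis
qed

lemma compact_prob_eq_if_moments_eq:
  fixes N N' :: "real measure" and g :: "real \<Rightarrow> real"
  assumes "compact_prob N {-1..1}" "compact_prob N' {-1..1}"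
    and eq: "\<And>n. (\<integral>t. t ^ n \<partial>N) = (\<integral>t. t ^ n \<partial>N')"
    and g: "continuous_on UNIV g"
  shows "integral\<^sup>L N g = integral\<^sup>L N' g"
proof -
  interpret A: compact_prob N "{-1..1}" by fact
  interpret B: compact_prob N' "{-1..1}" by fact
  have polys: "(\<integral>t. poly p t \<partial>N) = (\<integral>t. poly p t \<partial>N')" for p :: "real poly"
  proof -
    have "integrable N (\<lambda>t. c * t ^ i)" "integrable N' (\<lambda>t. c * t ^ i)" for c :: real and i
      by (intro A.integrable_continuous B.integrable_continuous continuous_intros)+
    then show ?thesis
      by (simp add: poly_altdef eq)
  qed
  have "\<bar>integral\<^sup>L N g - integral\<^sup>L N' g\<bar> \<le> e" if "e > 0" for e
  proof -
    obtain p :: "real poly" where p: "\<And>t. t \<in> {-1..1} \<Longrightarrow> \<bar>g t - poly p t\<bar> < e / 2"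
      using Weierstrass_poly[OF g, of "e / 2"] \<open>e > 0\<close> by auto
    have c: "continuous_on UNIV (\<lambda>t. g t - poly p t)" by (intro continuous_intros g)
    have cp: "continuous_on UNIV (poly p)" by (intro continuous_intros)
    have "\<bar>\<integral>t. g t - poly p t \<partial>N\<bar> \<le> e / 2" "\<bar>\<integral>t. g t - poly p t \<partial>N'\<bar> \<le> e / 2"
      by (rule A.abs_integral_le_support[OF c less_imp_le[OF p]] B.abs_integral_le_support[OF c less_imp_le[OF p]],
          assumption)+
    moreover have "(\<integral>t. g t - poly p t \<partial>N) = integral\<^sup>L N g - integral\<^sup>L N (poly p)"
      by (intro Bochner_Integration.integral_diff A.integrable_continuous g cp)
    moreover have "(\<integral>t. g t - poly p t \<partial>N') = integral\<^sup>L N' g - integral\<^sup>L N' (poly p)"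
      by (intro Bochner_Integration.integral_diff B.integrable_continuous g cp)
    ultimately show ?thesis
      using polys[of p] by argo
  qed
  then show ?thesis
    by (metis abs_le_zero_iff dense_ge diff_0_right eq_iff_diff_eq_0)
qed

text \<open>
  Vanishing against all \<open>R\<^sub>k\<close> is inherited by \<open>t u(t)\<close> through the three-term recurrence, so \<open>u\<close> is
  orthogonal to all polynomials and, by Weierstrass approximation, to itself.
\<close>

lemma ultra_complete:
  fixes u :: "real \<Rightarrow> real"
  assumes m: "1 \<le> m" and u: "continuous_on UNIV u"
    and zero: "\<And>k. (\<integral>t. u t * poly (ultra m k) t \<partial>weight_measure m) = 0"
    and t: "t \<in> {-1..1}"
  shows "u t = 0"
proof -
  interpret compact_prob "weight_measure m" "{-1..1}" by (rule compact_prob_weight_measure) fact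
  have ip: "integrable (weight_measure m) (\<lambda>t. u t * t ^ n * poly p t)" for n and p :: "real poly"
    by (intro integrable_continuous continuous_intros u)
  have "(\<integral>t. u t * t ^ n * poly (ultra m k) t \<partial>weight_measure m) = 0" for n k
  proof (induction n arbitrary: k)
    case 0
    then show ?case using zero by simp
  next
    case (Suc n)
    obtain a b where ab: "\<And>t. t * poly (ultra m k) t = a * poly (ultra m (Suc k)) t + b * poly (ultra m (k - 1)) t"
      using ultra_times_t[OF m, of k] by metis
    have "u t * t ^ Suc n * poly (ultra m k) t
        = a * (u t * t ^ n * poly (ultra m (Suc k)) t) + b * (u t * t ^ n * poly (ultra m (k - 1)) t)" for t
      using ab[of t] by (simp only: power_Suc2 mult.assoc) (simp add: algebra_simps)
    then show ?case
      using ip Suc.IH[of "Suc k"] Suc.IH[of "k - 1"] by simp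
  qed
  from this[of _ 0] have mono: "(\<integral>t. u t * t ^ n \<partial>weight_measure m) = 0" for n
    by simp
  have polys: "(\<integral>t. u t * poly p t \<partial>weight_measure m) = 0" for p :: "real poly"
  proof -
    have i: "integrable (weight_measure m) (\<lambda>t. coeff p i * (u t * t ^ i))" for i
      by (intro integrable_continuous continuous_intros u)
    have "(\<integral>t. u t * poly p t \<partial>weight_measure m) = (\<integral>t. (\<Sum>i\<le>degree p. coeff p i * (u t * t ^ i)) \<partial>weight_measure m)"
      by (simp add: poly_altdef sum_distrib_left mult_ac)
    also have "\<dots> = (\<Sum>i\<le>degree p. coeff p i * (\<integral>t. u t * t ^ i \<partial>weight_measure m))"
      using i by simp
    finally show ?thesis by (simp add: mono)
  qed
  obtain B where B: "\<And>t. t \<in> {-1..1} \<Longrightarrow> \<bar>u t\<bar> \<le> B"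
    using compact_imp_bounded[OF compact_continuous_image[OF continuous_on_subset[OF u] compact_Icc, of "-1" 1]]
    by (auto simp: bounded_iff intro: that)
  have "B \<ge> 0" using B[of 0] by simp
  have "(\<integral>t. (u t)\<^sup>2 \<partial>weight_measure m) \<le> e" if "e > 0" for e
  proof -
    have "e / (B + 1) > 0" using that \<open>B \<ge> 0\<close> by simp
    then obtain p :: "real poly" where p: "\<And>t. t \<in> {-1..1} \<Longrightarrow> \<bar>u t - poly p t\<bar> < e / (B + 1)"
      using Weierstrass_poly[OF u] by metis
    have i: "integrable (weight_measure m) (\<lambda>t. (u t)\<^sup>2)" "integrable (weight_measure m) (\<lambda>t. u t * poly p t)"
      by (intro integrable_continuous continuous_intros u)+
    have "\<bar>\<integral>t. u t * (u t - poly p t) \<partial>weight_measure m\<bar> \<le> (B + 1) * (e / (B + 1))"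
    proof (rule abs_integral_le_support)
      show "\<bar>u t * (u t - poly p t)\<bar> \<le> (B + 1) * (e / (B + 1))" if "t \<in> {-1..1}" for t
        unfolding abs_mult using B[OF that] p[OF that] \<open>B \<ge> 0\<close> by (intro mult_mono) auto
    qed (intro continuous_intros u)
    also have "(\<integral>t. u t * (u t - poly p t) \<partial>weight_measure m) = (\<integral>t. (u t)\<^sup>2 \<partial>weight_measure m)"
      using i polys[of p] by (simp add: right_diff_distrib power2_eq_square)
    finally show ?thesis using \<open>B \<ge> 0\<close> by simp
  qed
  then have "(\<integral>t. (u t)\<^sup>2 \<partial>weight_measure m) \<le> 0"
    by (rule dense_ge)
  moreover have "(\<integral>t. (u t)\<^sup>2 \<partial>weight_measure m) \<ge> 0"
    by (intro Bochner_Integration.integral_nonneg) simp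
  ultimately show ?thesis
    using weight_measure_zero[OF m u _ t] by simp
qed

definition ultra_cone :: "nat \<Rightarrow> nat \<Rightarrow> (real \<Rightarrow> real) \<Rightarrow> bool" where
  "ultra_cone m n g \<longleftrightarrow> (\<exists>c. (\<forall>k. 0 \<le> c k) \<and> (\<forall>t. g t = (\<Sum>k\<le>n. c k * poly (ultra m k) t)))"

lemma ultra_cone_add:
  assumes "ultra_cone m n g" "ultra_cone m n h"
  shows "ultra_cone m n (\<lambda>t. g t + h t)"
proof -
  obtain c d where "\<forall>k. 0 \<le> c k" "\<forall>k. 0 \<le> d k"
    "\<forall>t. g t = (\<Sum>k\<le>n. c k * poly (ultra m k) t)" "\<forall>t. h t = (\<Sum>k\<le>n. d k * poly (ultra m k) t)"
    using assms unfolding ultra_cone_def by blast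
  then show ?thesis
    unfolding ultra_cone_def
    by (intro exI[of _ "\<lambda>k. c k + d k"]) (simp add: sum.distrib distrib_right)
qed

lemma ultra_cone_scale:
  assumes "ultra_cone m n g" "0 \<le> a"
  shows "ultra_cone m n (\<lambda>t. a * g t)"
proof -
  obtain c where "\<forall>k. 0 \<le> c k" "\<forall>t. g t = (\<Sum>k\<le>n. c k * poly (ultra m k) t)"
    using assms unfolding ultra_cone_def by blast
  then show ?thesis
    unfolding ultra_cone_def using assms(2)
    by (intro exI[of _ "\<lambda>k. a * c k"]) (simp add: sum_distrib_left mult.assoc)
qed

lemma ultra_cone_ultra:
  assumes "k \<le> n"
  shows "ultra_cone m n (poly (ultra m k))"
  unfolding ultra_cone_def using assms
  by (intro exI[of _ "\<lambda>j. if j = k then 1 else 0"]) (simp add: if_distrib[of "\<lambda>c. c * _"] cong: if_cong)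

lemma ultra_cone_sum:
  assumes "finite A" "\<And>i. i \<in> A \<Longrightarrow> ultra_cone m n (g i)"
  shows "ultra_cone m n (\<lambda>t. \<Sum>i\<in>A. g i t)"
  using assms
proof (induction A rule: finite_induct)
  case empty
  then show ?case unfolding ultra_cone_def by (intro exI[of _ "\<lambda>_. 0"]) simp
next
  case (insert x A)
  then show ?case using ultra_cone_add[of m n "g x" "\<lambda>t. \<Sum>i\<in>A. g i t"] by simp
qed

text \<open>
  Multiplication by \<open>1 + t\<close> preserves nonnegative combinations of the \<open>R\<^sub>k\<close>, by \<open>ultra_times_t\<close>.
\<close>

lemma ultra_cone_power:
  assumes m: "1 \<le> m"
  shows "ultra_cone m n (\<lambda>t. (1 + t) ^ n)"
proof (induction n)
  case 0
  have "(\<lambda>t. (1 + t) ^ 0) = poly (ultra m 0)" by (rule ext) simp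
  then show ?case using ultra_cone_ultra[of 0 0 m] by (metis le_refl)
next
  case (Suc n)
  then obtain c where c: "\<forall>k. 0 \<le> c k" "\<forall>t. (1 + t) ^ n = (\<Sum>k\<le>n. c k * poly (ultra m k) t)"
    unfolding ultra_cone_def by blast
  have "ultra_cone m (Suc n) (\<lambda>t. (1 + t) * poly (ultra m k) t)" if "k \<le> n" for k
  proof -
    obtain a b where ab: "0 \<le> a" "0 \<le> b"
      "\<And>t. t * poly (ultra m k) t = a * poly (ultra m (Suc k)) t + b * poly (ultra m (k - 1)) t"
      using ultra_times_t[OF m, of k] by metis
    have "ultra_cone m (Suc n) (\<lambda>t. poly (ultra m k) t + (a * poly (ultra m (Suc k)) t + b * poly (ultra m (k - 1)) t))"
      using that ab by (intro ultra_cone_add ultra_cone_scale ultra_cone_ultra) auto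
    then show ?thesis by (simp add: distrib_right ab(3) del: ultra.simps(3))
  qed
  then have "ultra_cone m (Suc n) (\<lambda>t. \<Sum>k\<le>n. c k * ((1 + t) * poly (ultra m k) t))"
    using c(1) by (intro ultra_cone_sum ultra_cone_scale) auto
  moreover have "(\<Sum>k\<le>n. c k * ((1 + t) * poly (ultra m k) t)) = (1 + t) ^ Suc n" for t
    by (simp add: c(2) sum_distrib_left mult_ac)
  ultimately show ?case by simp
qed

text \<open>
  The recursion for the masses of \<open>(1 + t)\<^sup>n\<close> is integration by parts with \<open>q(t) = (1 + t)\<^sup>n\<close>. Consecutive
  masses have a ratio tending to \<open>2\<close>, the value of \<open>1 + t\<close> at \<open>t = 1\<close>, which forces concentration there.
\<close>

lemma integral_power_pos:
  assumes m: "1 \<le> m"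
  shows "0 < (\<integral>t. (1 + t) ^ n \<partial>weight_measure m)"
    and "(\<integral>t. (1 + t) ^ Suc n \<partial>weight_measure m) * (real n + real m)
      = (\<integral>t. (1 + t) ^ n \<partial>weight_measure m) * (2 * real n + real m)"
proof -
  interpret compact_prob "weight_measure m" "{-1..1}" by (rule compact_prob_weight_measure) fact
  have i: "integrable (weight_measure m) (\<lambda>t. (1 + t) ^ n)" for n
    by (intro integrable_continuous continuous_intros)
  have rec: "(\<integral>t. (1 + t) ^ Suc n \<partial>weight_measure m) * (real n + real m)
      = (\<integral>t. (1 + t) ^ n \<partial>weight_measure m) * (2 * real n + real m)" for n
  proof -
    have "(\<integral>t. (1 - t\<^sup>2) * (real n * (1 + t) ^ (n - 1)) \<partial>weight_measure m)
        = real m * (\<integral>t. t * (1 + t) ^ n \<partial>weight_measure m)"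
      by (rule weight_measure_by_parts[OF m]) (auto intro!: derivative_eq_intros continuous_intros)
    also have "(\<lambda>t. (1 - t\<^sup>2) * (real n * (1 + t) ^ (n - 1)))
        = (\<lambda>t :: real. real n * (2 * (1 + t) ^ n - (1 + t) ^ Suc n))"
      by (rule ext, cases n) (auto simp: algebra_simps power2_eq_square)
    also have "(\<lambda>t. t * (1 + t) ^ n) = (\<lambda>t :: real. (1 + t) ^ Suc n - (1 + t) ^ n)"
      by (rule ext) (simp add: algebra_simps)
    finally have "real n * (2 * (\<integral>t. (1 + t) ^ n \<partial>weight_measure m) - (\<integral>t. (1 + t) ^ Suc n \<partial>weight_measure m))
        = real m * ((\<integral>t. (1 + t) ^ Suc n \<partial>weight_measure m) - (\<integral>t. (1 + t) ^ n \<partial>weight_measure m))"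
      using i by (simp del: power_Suc)
    then show ?thesis
      by (simp add: algebra_simps del: power_Suc)
  qed
  show "(\<integral>t. (1 + t) ^ Suc n \<partial>weight_measure m) * (real n + real m)
      = (\<integral>t. (1 + t) ^ n \<partial>weight_measure m) * (2 * real n + real m)"
    by (rule rec)
  show "0 < (\<integral>t. (1 + t) ^ n \<partial>weight_measure m)"
  proof (induction n)
    case (Suc n)
    have "0 < (\<integral>t. (1 + t) ^ n \<partial>weight_measure m) * (2 * real n + real m)"
      using Suc m by (intro mult_pos_pos) auto
    then show ?case
      unfolding rec[symmetric] using m by (simp add: zero_less_mult_iff)
  qed (simp add: prob_space)
qed

text \<open>
  Since \<open>q(t) - q(1)\<close> is divisible by \<open>1 - t\<close>, it suffices that the normalised mean of \<open>1 - t\<close> against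
  \<open>(1 + t)\<^sup>n\<close>, which equals \<open>m / (n + m)\<close> by the recursion for the masses, tends to zero.
\<close>

lemma power_concentrates:
  assumes m: "1 \<le> m"
  shows "(\<lambda>n. (\<integral>t. (1 + t) ^ n * poly q t \<partial>weight_measure m) / (\<integral>t. (1 + t) ^ n \<partial>weight_measure m))
     \<longlonglongrightarrow> poly q 1"
proof -
  interpret compact_prob "weight_measure m" "{-1..1}" by (rule compact_prob_weight_measure) fact
  define b where "b n = (\<integral>t. (1 + t) ^ n \<partial>weight_measure m)" for n
  have b_pos: "b n > 0" and b_Suc: "b (Suc n) * (real n + real m) = b n * (2 * real n + real m)" for n
    unfolding b_def by (rule integral_power_pos[OF m])+
  obtain s where s: "q - [:poly q 1:] = [:-1, 1:] * s"
    using poly_eq_0_iff_dvd[of "q - [:poly q 1:]" 1] by (auto simp: dvd_def)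
  have qs: "poly q t = poly q 1 - (1 - t) * poly s t" for t
    using arg_cong[OF s, of "\<lambda>p. poly p t"] by (simp add: algebra_simps)
  have cs: "continuous_on UNIV (poly s)" by (intro continuous_intros)
  obtain B where B: "\<And>t. t \<in> {-1..1} \<Longrightarrow> \<bar>poly s t\<bar> \<le> B"
    using compact_imp_bounded[OF compact_continuous_image[OF continuous_on_subset[OF cs] compact_Icc, of "-1" 1]]
    by (auto simp: bounded_iff intro: that)
  have i: "integrable (weight_measure m) (\<lambda>t. (1 + t) ^ n)" 
      "integrable (weight_measure m) (\<lambda>t. (1 + t) ^ n * ((1 - t) * poly s t))" for n
    by (intro integrable_continuous continuous_intros)+
  have bound: "\<bar>(\<integral>t. (1 + t) ^ n * poly q t \<partial>weight_measure m) / b n - poly q 1\<bar> \<le> B * (real m / (real n + real m))" for n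
  proof -
    have "(\<integral>t. (1 + t) ^ n * poly q t \<partial>weight_measure m)
      = (\<integral>t. poly q 1 * (1 + t) ^ n - (1 + t) ^ n * ((1 - t) * poly s t) \<partial>weight_measure m)"
      by (subst qs) (simp add: algebra_simps)
    also have "\<dots> = poly q 1 * b n - (\<integral>t. (1 + t) ^ n * ((1 - t) * poly s t) \<partial>weight_measure m)"
      using i by (simp add: b_def)
    finally have eq0: "(\<integral>t. (1 + t) ^ n * poly q t \<partial>weight_measure m)
        = poly q 1 * b n - (\<integral>t. (1 + t) ^ n * ((1 - t) * poly s t) \<partial>weight_measure m)" .
    have "(x * y - z) / y - x = - z / y" if "0 < y" for x y z :: real
      using that by (simp add: field_simps)
    from this[OF b_pos] have eq: "(\<integral>t. (1 + t) ^ n * poly q t \<partial>weight_measure m) / b n - poly q 1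
        = - (\<integral>t. (1 + t) ^ n * ((1 - t) * poly s t) \<partial>weight_measure m) / b n"
      unfolding eq0 .
    have bd: "\<bar>(1 + t) ^ n * ((1 - t) * poly s t)\<bar> \<le> B * ((1 + t) ^ n * (1 - t))" if "t \<in> {-1..1}" for t
    proof -
      have nonneg: "0 \<le> (1 + t) ^ n * (1 - t)"
        using that by (intro mult_nonneg_nonneg zero_le_power) auto
      have "\<bar>((1 + t) ^ n * (1 - t)) * poly s t\<bar> = ((1 + t) ^ n * (1 - t)) * \<bar>poly s t\<bar>"
        by (simp only: abs_mult[of "(1 + t) ^ n * (1 - t)"] abs_of_nonneg[OF nonneg])
      also have "\<dots> \<le> ((1 + t) ^ n * (1 - t)) * B"
        by (rule mult_left_mono[OF B[OF that] nonneg])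
      finally show ?thesis by (simp only: mult.assoc mult.commute[of _ B])
    qed
    have "\<bar>\<integral>t. (1 + t) ^ n * ((1 - t) * poly s t) \<partial>weight_measure m\<bar>
        \<le> (\<integral>t. \<bar>(1 + t) ^ n * ((1 - t) * poly s t)\<bar> \<partial>weight_measure m)"
      by (rule integral_abs_bound)
    also have "\<dots> \<le> (\<integral>t. B * ((1 + t) ^ n * (1 - t)) \<partial>weight_measure m)"
      by (intro integral_mono_support bd continuous_intros)
    also have "\<dots> = (\<integral>t. B * (2 * (1 + t) ^ n - (1 + t) ^ Suc n) \<partial>weight_measure m)"
      by (intro Bochner_Integration.integral_cong) (auto simp: algebra_simps)
    also have "\<dots> = B * (2 * b n - b (Suc n))"
      using i by (simp add: b_def del: power_Suc)
    also have "b (Suc n) = b n * (2 * real n + real m) / (real n + real m)"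
      using b_Suc[of n] m by (simp add: eq_divide_eq)
    also have "2 * b n - b n * (2 * real n + real m) / (real n + real m) = b n * (real m / (real n + real m))"
      using m by (simp add: field_simps)
    finally show ?thesis
      unfolding eq using b_pos[of n] by (simp add: abs_divide divide_le_eq mult_ac)
  qed
  have lim: "(\<lambda>n. B * (real m / (real n + real m))) \<longlonglongrightarrow> 0"
  proof -
    have "(\<lambda>n. real m * inverse (real (n + m))) \<longlonglongrightarrow> real m * 0"
      by (intro tendsto_intros LIMSEQ_ignore_initial_segment[OF lim_inverse_n])
    from tendsto_mult_left[OF this, of B] show ?thesis
      by (simp add: divide_inverse)
  qed
  have "(\<lambda>n. (\<integral>t. (1 + t) ^ n * poly q t \<partial>weight_measure m) / b n - poly q 1) \<longlonglongrightarrow> 0"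
    by (rule Lim_null_comparison[OF always_eventually lim]) (use bound in simp)
  then show ?thesis
    unfolding b_def by (simp add: LIM_zero_iff)
qed

section \<open>The Funk-Hecke formula\<close>

lemma sphere_moment_odd:
  fixes x :: "'a::euclidean_space"
  assumes "odd n"
  shows "(\<integral>y. (x \<bullet> y) ^ n \<partial>sphere_measure) = 0"
proof -
  have T: "orthogonal_transformation (\<lambda>y :: 'a. - y)"
    by (simp add: orthogonal_transformation_neg)
  have "(\<integral>y. (x \<bullet> (- y)) ^ n \<partial>sphere_measure) = (\<integral>y. (x \<bullet> y) ^ n \<partial>sphere_measure)"
    by (rule integral_sphere_measure_orthogonal[OF T]) (intro continuous_intros)
  with assms show ?thesis by simp
qed

lemma sphere_moment_scale:
  fixes x b :: "'a::euclidean_space"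
  assumes "norm b = 1"
  shows "(\<integral>y. (x \<bullet> y) ^ n \<partial>sphere_measure) = norm x ^ n * (\<integral>y. (b \<bullet> y) ^ n \<partial>sphere_measure)"
proof -
  have "(\<integral>y. (x \<bullet> y) ^ n \<partial>sphere_measure) = (\<integral>y. ((norm x *\<^sub>R b) \<bullet> y) ^ n \<partial>sphere_measure)"
    using sphere_integral_pair_eq[of x "norm x *\<^sub>R b" x "norm x *\<^sub>R b" "\<lambda>s t. s ^ n"] assms
    by (simp add: dot_square_norm case_prod_unfold power2_eq_square continuous_on_power continuous_on_fst continuous_on_id)
  then show ?thesis
    by (simp add: power_mult_distrib)
qed

lemma coeff_2_power: "coeff ([:1, 0, 1:] ^ n :: real poly) 2 = real n"
proof -
  have "coeff ([:1, 0, 1:] ^ n :: real poly) 0 = 1" "coeff ([:1, 0, 1:] ^ n :: real poly) 2 = real n"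
    by (induction n) (auto simp: numeral_2_eq_2)
  then show ?thesis by simp
qed

text \<open>
  For odd \<open>n\<close> both sides vanish under \<open>y \<mapsto> - y\<close>. For even \<open>n\<close> the moment of order \<open>n + 2\<close> of
  \<open>(b + u e) \<bullet> y\<close> equals \<open>(1 + u\<^sup>2)\<^bsup>(n + 2) / 2\<^esup>\<close> times that of \<open>b \<bullet> y\<close>, as \<open>b + u e\<close> has squared length
  \<open>1 + u\<^sup>2\<close>. Both sides are polynomials in \<open>u\<close>; comparing the coefficients of \<open>u\<^sup>2\<close> gives the claim.
\<close>

lemma sphere_moment_mixed:
  fixes b e :: "'a::euclidean_space"
  assumes "norm b = 1" "norm e = 1" "b \<bullet> e = 0"
  shows "(real n + 1) * (\<integral>y. (b \<bullet> y) ^ n * (e \<bullet> y)\<^sup>2 \<partial>sphere_measure) = (\<integral>y. (b \<bullet> y) ^ (n + 2) \<partial>sphere_measure)"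
proof (cases "even n")
  case False
  have T: "orthogonal_transformation (\<lambda>y :: 'a. - y)"
    by (simp add: orthogonal_transformation_neg)
  have "(\<integral>y. (b \<bullet> (- y)) ^ n * (e \<bullet> (- y))\<^sup>2 \<partial>sphere_measure) = (\<integral>y. (b \<bullet> y) ^ n * (e \<bullet> y)\<^sup>2 \<partial>sphere_measure)"
    by (rule integral_sphere_measure_orthogonal[OF T]) (intro continuous_intros)
  with False have "(\<integral>y. (b \<bullet> y) ^ n * (e \<bullet> y)\<^sup>2 \<partial>sphere_measure) = 0"
    by simp
  then show ?thesis using False sphere_moment_odd[of "n + 2" b] by simp
next
  case True
  interpret compact_prob "sphere_measure :: 'a measure" "sphere 0 1" by (rule compact_prob_sphere_measure)
  define M where "M = (\<integral>y. (b \<bullet> y) ^ (n + 2) \<partial>sphere_measure)"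
  define c where "c i = real (n + 2 choose i) * (\<integral>y. (e \<bullet> y) ^ i * (b \<bullet> y) ^ (n + 2 - i) \<partial>sphere_measure)" for i
  obtain j where j: "n = 2 * j" using True by blast
  have i: "integrable sphere_measure (\<lambda>y. r * ((e \<bullet> y) ^ i * (b \<bullet> y) ^ k))" for r i k
    by (intro integrable_continuous continuous_intros)
  have "poly (\<Sum>i\<le>n + 2. monom (c i) i) u = poly (smult M ([:1, 0, 1:] ^ (j + 1))) u" for u
  proof -
    have "(norm (b + u *\<^sub>R e))\<^sup>2 = (b + u *\<^sub>R e) \<bullet> (b + u *\<^sub>R e)"
      by (rule power2_norm_eq_inner)
    also have "\<dots> = b \<bullet> b + 2 * u * (b \<bullet> e) + u\<^sup>2 * (e \<bullet> e)"
      by (simp add: inner_add_left inner_add_right inner_commute[of e b] power2_eq_square algebra_simps)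
    also have "\<dots> = 1 + u\<^sup>2"
      using assms by (simp add: norm_eq_1)
    finally have "((norm (b + u *\<^sub>R e))\<^sup>2) ^ (j + 1) = (1 + u\<^sup>2) ^ (j + 1)"
      by (rule arg_cong)
    then have "norm (b + u *\<^sub>R e) ^ (n + 2) = (1 + u\<^sup>2) ^ (j + 1)"
      unfolding power_mult[symmetric] by (simp add: j)
    then have int: "(\<integral>y. ((b + u *\<^sub>R e) \<bullet> y) ^ (n + 2) \<partial>sphere_measure) = (1 + u\<^sup>2) ^ (j + 1) * M"
      unfolding M_def using sphere_moment_scale[OF assms(1)] by metis
    have expand: "((b + u *\<^sub>R e) \<bullet> y) ^ (n + 2)
        = (\<Sum>i\<le>n + 2. (real (n + 2 choose i) * u ^ i) * ((e \<bullet> y) ^ i * (b \<bullet> y) ^ (n + 2 - i)))" for y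
    proof -
      have "(b + u *\<^sub>R e) \<bullet> y = u * (e \<bullet> y) + b \<bullet> y"
        by (simp add: inner_add_left)
      then show ?thesis
        unfolding \<open>(b + u *\<^sub>R e) \<bullet> y = u * (e \<bullet> y) + b \<bullet> y\<close> binomial_ring
        by (simp add: power_mult_distrib mult_ac)
    qed
    have total: "(\<Sum>i\<le>n + 2. (real (n + 2 choose i) * u ^ i) * (\<integral>y. (e \<bullet> y) ^ i * (b \<bullet> y) ^ (n + 2 - i) \<partial>sphere_measure))
        = (1 + u\<^sup>2) ^ (j + 1) * M"
      using int unfolding expand by (subst (asm) Bochner_Integration.integral_sum) (use i in auto)
    have "poly (\<Sum>i\<le>n + 2. monom (c i) i) u = (1 + u\<^sup>2) ^ (j + 1) * M"
      unfolding total[symmetric] by (simp only: poly_sum poly_monom c_def mult_ac)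
    moreover have "poly [:1, 0, 1:] u = 1 + u\<^sup>2"
      by (simp add: power2_eq_square)
    ultimately show ?thesis
      by (simp only: poly_smult poly_power mult.commute)
  qed
  then have "(\<Sum>i\<le>n + 2. monom (c i) i) = smult M ([:1, 0, 1:] ^ (j + 1))"
    by (intro poly_ext)
  from arg_cong[OF this, of "\<lambda>p. coeff p 2"]
  have "(\<Sum>i\<le>n + 2. if i = 2 then c i else 0) = M * real (j + 1)"
    unfolding coeff_smult coeff_2_power coeff_sum coeff_monom .
  then have "c 2 = M * real (j + 1)"
    by (subst (asm) sum.delta) simp_all
  moreover have "c 2 = real (n + 2 choose 2) * (\<integral>y. (b \<bullet> y) ^ n * (e \<bullet> y)\<^sup>2 \<partial>sphere_measure)"
    by (simp add: c_def mult.commute)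
  moreover have "real (n + 2 choose 2) = (real n + 1) * real (j + 1)"
    by (simp add: choose_two j) (simp add: algebra_simps)
  ultimately show ?thesis
    by (simp add: M_def)
qed

text \<open>
  Insert \<open>1 = \<bar>y\<bar>\<^sup>2\<close>, the sum of the squared coordinates, into the moment of order \<open>n\<close>. One
  coordinate contributes the moment of order \<open>n + 2\<close> and each of the other \<open>m\<close> contributes its
  multiple by \<open>1 / (n + 1)\<close>.
\<close>

lemma sphere_moment_rec:
  fixes x :: "'a::euclidean_space"
  assumes "norm x = 1" and dim: "DIM('a) = m + 1"
  shows "(real n + 1 + real m) * (\<integral>y. (x \<bullet> y) ^ (n + 2) \<partial>sphere_measure)
     = (real n + 1) * (\<integral>y. (x \<bullet> y) ^ n \<partial>sphere_measure)"
proof -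
  interpret compact_prob "sphere_measure :: 'a measure" "sphere 0 1" by (rule compact_prob_sphere_measure)
  obtain b :: 'a where b: "b \<in> Basis" by (meson nonempty_Basis ex_in_conv)
  define M where "M n = (\<integral>y. (b \<bullet> y) ^ n \<partial>sphere_measure)" for n
  have xb: "(\<integral>y. (x \<bullet> y) ^ n \<partial>sphere_measure) = M n" for n
    unfolding M_def using sphere_moment_scale[of b x n] b assms(1) by simp
  have i: "integrable sphere_measure (\<lambda>y. (b \<bullet> y) ^ n * (e \<bullet> y)\<^sup>2)" for e
    by (intro integrable_continuous continuous_intros)
  have "M n = (\<integral>y. (b \<bullet> y) ^ n * (norm y)\<^sup>2 \<partial>sphere_measure)"
    unfolding M_def by (intro integral_cong_support continuous_intros) auto
  also have "\<dots> = (\<integral>y. (\<Sum>e\<in>Basis. (b \<bullet> y) ^ n * (e \<bullet> y)\<^sup>2) \<partial>sphere_measure)"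
  proof (rule Bochner_Integration.integral_cong)
    fix y :: 'a
    have "(norm y)\<^sup>2 = (\<Sum>e\<in>Basis. (e \<bullet> y)\<^sup>2)"
      unfolding power2_norm_eq_inner euclidean_inner[of y y] by (simp add: power2_eq_square inner_commute)
    then show "(b \<bullet> y) ^ n * (norm y)\<^sup>2 = (\<Sum>e\<in>Basis. (b \<bullet> y) ^ n * (e \<bullet> y)\<^sup>2)"
      by (simp add: sum_distrib_left)
  qed simp
  also have "\<dots> = (\<Sum>e\<in>Basis. (\<integral>y. (b \<bullet> y) ^ n * (e \<bullet> y)\<^sup>2 \<partial>sphere_measure))"
    using i by (intro Bochner_Integration.integral_sum) auto
  also have "\<dots> = (\<integral>y. (b \<bullet> y) ^ n * (b \<bullet> y)\<^sup>2 \<partial>sphere_measure)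
      + (\<Sum>e\<in>Basis - {b}. (\<integral>y. (b \<bullet> y) ^ n * (e \<bullet> y)\<^sup>2 \<partial>sphere_measure))"
    using b by (intro sum.remove) auto
  also have "(\<Sum>e\<in>Basis - {b}. (\<integral>y. (b \<bullet> y) ^ n * (e \<bullet> y)\<^sup>2 \<partial>sphere_measure)) = (\<Sum>e\<in>Basis - {b}. M (n + 2) / (real n + 1))"
  proof (rule sum.cong)
    fix e assume "e \<in> Basis - {b}"
    then have "(real n + 1) * (\<integral>y. (b \<bullet> y) ^ n * (e \<bullet> y)\<^sup>2 \<partial>sphere_measure) = M (n + 2)"
      unfolding M_def using b by (intro sphere_moment_mixed) (auto simp: inner_not_same_Basis)
    then show "(\<integral>y. (b \<bullet> y) ^ n * (e \<bullet> y)\<^sup>2 \<partial>sphere_measure) = M (n + 2) / (real n + 1)"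
      by (simp add: field_simps)
  qed simp
  also have "\<dots> = real m * (M (n + 2) / (real n + 1))"
    using b dim by (simp add: card_Diff_singleton)
  also have "(\<integral>y. (b \<bullet> y) ^ n * (b \<bullet> y)\<^sup>2 \<partial>sphere_measure) = M (n + 2)"
    by (simp only: M_def power_add)
  finally have "M n = M (n + 2) + real m * (M (n + 2) / (real n + 1))" .
  then have "(real n + 1) * M n = (real n + 1 + real m) * M (n + 2)"
    by (simp add: field_simps)
  then show ?thesis unfolding xb by simp
qed

lemma weight_moment_rec:
  assumes m: "1 \<le> m"
  shows "(real n + 1 + real m) * (\<integral>t. t ^ (n + 2) \<partial>weight_measure m) = (real n + 1) * (\<integral>t. t ^ n \<partial>weight_measure m)"
proof -
  interpret compact_prob "weight_measure m" "{-1..1}" by (rule compact_prob_weight_measure) fact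
  have i: "integrable (weight_measure m) (\<lambda>t. t ^ n)" for n
    by (intro integrable_continuous continuous_intros)
  have "(\<integral>t. (1 - t\<^sup>2) * ((real n + 1) * t ^ n) \<partial>weight_measure m) = real m * (\<integral>t. t * t ^ (n + 1) \<partial>weight_measure m)"
  proof (rule weight_measure_by_parts[OF m])
    show "((\<lambda>t. t ^ (n + 1)) has_real_derivative (real n + 1) * t ^ n) (at t)" for t
      using DERIV_pow[of "n + 1" t UNIV] by (simp add: add.commute)
  qed (intro continuous_intros)
  also have "(\<lambda>t. (1 - t\<^sup>2) * ((real n + 1) * t ^ n)) = (\<lambda>t :: real. (real n + 1) * (t ^ n - t ^ (n + 2)))"
    by (rule ext) (simp add: algebra_simps power2_eq_square)
  also have "(\<lambda>t. t * t ^ (n + 1)) = (\<lambda>t :: real. t ^ (n + 2))"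
    by (rule ext) simp
  finally have "(real n + 1) * ((\<integral>t. t ^ n \<partial>weight_measure m) - (\<integral>t. t ^ (n + 2) \<partial>weight_measure m))
     = real m * (\<integral>t. t ^ (n + 2) \<partial>weight_measure m)"
    using i by (simp del: power_Suc add_2_eq_Suc')
  then show ?thesis
    by (simp add: algebra_simps del: power_Suc add_2_eq_Suc')
qed

text \<open>
  Both measures on \<open>[-1, 1]\<close> have the moments \<open>1\<close> and \<open>0\<close> of orders \<open>0\<close> and \<open>1\<close> and obey the
  same recursion, so all their moments agree.
\<close>

lemma sphere_projection:
  fixes x :: "'a::euclidean_space" and g :: "real \<Rightarrow> real"
  assumes m: "1 \<le> m" and dim: "DIM('a) = m + 1" and x: "norm x = 1" and g: "continuous_on UNIV g"
  shows "(\<integral>y. g (x \<bullet> y) \<partial>sphere_measure) = integral\<^sup>L (weight_measure m) g"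
proof -
  interpret W: compact_prob "weight_measure m" "{-1..1}" by (rule compact_prob_weight_measure) fact
  interpret S: compact_prob "sphere_measure :: 'a measure" "sphere 0 1" by (rule compact_prob_sphere_measure)
  have meas: "(\<lambda>y. x \<bullet> y) \<in> sphere_measure \<rightarrow>\<^sub>M borel"
    by (intro S.borel_measurable_continuous continuous_intros)
  have distr: "integral\<^sup>L (distr sphere_measure borel (\<lambda>y. x \<bullet> y)) h = (\<integral>y. h (x \<bullet> y) \<partial>sphere_measure)"
    if "continuous_on UNIV h" for h :: "real \<Rightarrow> real"
    using meas borel_measurable_continuous_onI[OF that] by (rule integral_distr)
  have D: "compact_prob (distr sphere_measure borel (\<lambda>y. x \<bullet> y)) {-1..1}"
  proof (rule compact_prob_distr[OF compact_prob_sphere_measure])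
    show "(\<lambda>y. x \<bullet> y) ` sphere 0 1 \<subseteq> {-1..1}"
    proof safe
      fix y :: 'a assume "y \<in> sphere 0 1"
      then have "\<bar>x \<bullet> y\<bar> \<le> 1" using Cauchy_Schwarz_ineq2[of x y] x by simp
      then show "x \<bullet> y \<in> {-1..1}" by (auto simp: abs_le_iff)
    qed
  qed (auto intro: continuous_intros)
  have "(\<integral>y. (x \<bullet> y) ^ n \<partial>sphere_measure) = (\<integral>t. t ^ n \<partial>weight_measure m)" for n
  proof (induction n rule: induct_nat_012)
    case 0
    then show ?case by (simp add: W.prob_space S.prob_space)
  next
    case 1
    then show ?case using sphere_moment_odd[of 1 x] weight_measure_t[OF m] by simp
  next
    case (ge2 n)
    then have "(real n + 1 + real m) * (\<integral>y. (x \<bullet> y) ^ (n + 2) \<partial>sphere_measure)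
        = (real n + 1 + real m) * (\<integral>t. t ^ (n + 2) \<partial>weight_measure m)"
      by (simp only: sphere_moment_rec[OF x dim] weight_moment_rec[OF m])
    then show ?case by (simp add: add_eq_0_iff)
  qed
  then have "integral\<^sup>L (distr sphere_measure borel (\<lambda>y. x \<bullet> y)) (\<lambda>t. t ^ n) = (\<integral>t. t ^ n \<partial>weight_measure m)" for n
    by (subst distr) (auto intro: continuous_intros)
  from compact_prob_eq_if_moments_eq[OF D W.compact_prob_axioms this g] show ?thesis
    by (simp add: distr[OF g])
qed

text \<open>
  By transitivity the integral may be computed for the fixed unit vector \<open>b\<close> in place of \<open>x\<close> and
  \<open>t b + s e\<close> in place of \<open>z\<close>, where \<open>t = x \<bullet> z\<close>, \<open>s\<^sup>2 = 1 - t\<^sup>2\<close> and \<open>e\<close> is a unit vector orthogonal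
  to \<open>b\<close>. The binomial theorem yields a sum of terms \<open>t\<^sup>n\<^sup>-\<^sup>i s\<^sup>i\<close>; those with odd \<open>i\<close> vanish by reflection
  along \<open>e\<close>, and for even \<open>i\<close> the factor \<open>s\<^sup>i\<close> is a polynomial in \<open>t\<close> of degree \<open>i\<close>.
\<close>

lemma zonal_convolution_monomial:
  fixes g :: "real \<Rightarrow> real"
  assumes dim: "2 \<le> DIM('a::euclidean_space)" and g: "continuous_on UNIV g"
  obtains p :: "real poly" where "degree p \<le> n"
    "\<And>x z :: 'a. norm x = 1 \<Longrightarrow> norm z = 1 \<Longrightarrow> (\<integral>y. g (x \<bullet> y) * (y \<bullet> z) ^ n \<partial>sphere_measure) = poly p (x \<bullet> z)"
proof -
  interpret compact_prob "sphere_measure :: 'a measure" "sphere 0 1" by (rule compact_prob_sphere_measure)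
  obtain b e :: 'a where ne: "norm b = 1" "norm e = 1" "b \<bullet> e = 0"
    using orthonormal_pair_exists[OF dim] by blast
  define c where "c i = (\<integral>y. g (b \<bullet> y) * ((e \<bullet> y) ^ i * (b \<bullet> y) ^ (n - i)) \<partial>sphere_measure)" for i
  have c_odd: "c i = 0" if i: "odd i" for i
  proof -
    obtain T where T: "orthogonal_transformation T" "T e = - e" "T b = b"
      using orthogonal_transformation_exchanging[of e "- e"] ne by (metis inner_minus_right minus_zero norm_minus_cancel)
    have "c i = (\<integral>y. g (b \<bullet> T y) * ((e \<bullet> T y) ^ i * (b \<bullet> T y) ^ (n - i)) \<partial>sphere_measure)"
      unfolding c_def
      by (rule integral_sphere_measure_orthogonal[OF T(1), symmetric])
        (intro continuous_intros continuous_on_compose2[OF g]; simp)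
    moreover have "b \<bullet> T y = b \<bullet> y" "e \<bullet> T y = - (e \<bullet> y)" for y
      using T by (metis inner_minus_left orthogonal_transformation_def minus_minus)+
    ultimately have "c i = - c i" using i by (simp add: c_def)
    then show ?thesis by simp
  qed
  define p :: "real poly" where "p = (\<Sum>i\<le>n. smult (real (n choose i) * c i) ([:1, 0, -1:] ^ (i div 2) * [:0, 1:] ^ (n - i)))"
  have "degree p \<le> n"
    unfolding p_def
  proof (rule degree_sum_le)
    fix i assume "i \<in> {..n}"
    have "degree ([:1, 0, -1:] ^ (i div 2) * [:0, 1:] ^ (n - i) :: real poly) \<le> degree ([:1, 0, -1:] ^ (i div 2) :: real poly) + degree ([:0, 1:] ^ (n - i) :: real poly)"
      by (rule degree_mult_le)
    also have "\<dots> \<le> 2 * (i div 2) + 1 * (n - i)"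
      by (intro add_mono order.trans[OF degree_power_le]) auto
    also have "\<dots> \<le> n" using \<open>i \<in> {..n}\<close> by auto
    finally show "degree (smult (real (n choose i) * c i) ([:1, 0, -1:] ^ (i div 2) * [:0, 1:] ^ (n - i))) \<le> n"
      using degree_smult_le order.trans by blast
  qed simp
  moreover have "(\<integral>y. g (x \<bullet> y) * (y \<bullet> z) ^ n \<partial>sphere_measure) = poly p (x \<bullet> z)"
    if x: "norm x = 1" and z: "norm z = 1" for x z :: 'a
  proof -
    define t where "t = x \<bullet> z"
    have "\<bar>t\<bar> \<le> 1" using Cauchy_Schwarz_ineq2[of x z] x z by (simp add: t_def)
    then have t: "1 - t\<^sup>2 \<ge> 0" by (simp add: abs_square_le_1)
    define s where "s = sqrt (1 - t\<^sup>2)"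
    have s: "s\<^sup>2 = 1 - t\<^sup>2" using t by (simp add: s_def)
    define z' where "z' = t *\<^sub>R b + s *\<^sub>R e"
    have "z' \<bullet> z' = t\<^sup>2 + s\<^sup>2"
      using ne by (simp add: z'_def inner_add_left inner_add_right inner_commute[of e b] norm_eq_1 power2_eq_square)
    then have z': "norm z' = 1" using s by (simp add: norm_eq_1)
    have "b \<bullet> z' = t" using ne by (simp add: z'_def inner_add_right norm_eq_1)
    have "(\<integral>y. g (x \<bullet> y) * (y \<bullet> z) ^ n \<partial>sphere_measure) = (\<integral>y. g (b \<bullet> y) * (y \<bullet> z') ^ n \<partial>sphere_measure)"
    proof (rule sphere_integral_pair_eq[where g = "\<lambda>s t. g s * t ^ n"])
      show "continuous_on UNIV (\<lambda>(s, t). g s * t ^ n)"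
        unfolding case_prod_unfold by (intro continuous_intros continuous_on_compose2[OF g]) auto
    qed (use x z ne z' \<open>b \<bullet> z' = t\<close> t_def in auto)
    also have "\<dots> = (\<integral>y. (\<Sum>i\<le>n. (real (n choose i) * (s ^ i * t ^ (n - i))) * (g (b \<bullet> y) * ((e \<bullet> y) ^ i * (b \<bullet> y) ^ (n - i)))) \<partial>sphere_measure)"
    proof (rule Bochner_Integration.integral_cong)
      fix y :: 'a
      have "y \<bullet> z' = s * (e \<bullet> y) + t * (b \<bullet> y)"
        by (simp add: z'_def inner_add_right inner_commute)
      then show "g (b \<bullet> y) * (y \<bullet> z') ^ n = (\<Sum>i\<le>n. (real (n choose i) * (s ^ i * t ^ (n - i))) * (g (b \<bullet> y) * ((e \<bullet> y) ^ i * (b \<bullet> y) ^ (n - i))))"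
        by (simp only: binomial_ring sum_distrib_left power_mult_distrib) (simp add: mult_ac)
    qed simp
    also have "\<dots> = (\<Sum>i\<le>n. (real (n choose i) * (s ^ i * t ^ (n - i))) * c i)"
    proof -
      have "integrable sphere_measure (\<lambda>y. g (b \<bullet> y) * ((e \<bullet> y) ^ i * (b \<bullet> y) ^ (n - i)))" for i
        by (intro integrable_continuous continuous_intros continuous_on_compose2[OF g]) auto
      then show ?thesis
        by (subst Bochner_Integration.integral_sum) (auto simp: c_def)
    qed
    also have "\<dots> = poly p t"
      unfolding p_def poly_sum
    proof (rule sum.cong)
      fix i
      show "(real (n choose i) * (s ^ i * t ^ (n - i))) * c i
          = poly (smult (real (n choose i) * c i) ([:1, 0, -1:] ^ (i div 2) * [:0, 1:] ^ (n - i))) t"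
      proof (cases "even i")
        case True
        then have "s ^ i = (1 - t * t) ^ (i div 2)"
          using s by (metis dvd_mult_div_cancel power2_eq_square power_mult)
        then show ?thesis by (simp add: poly_power)
      qed (simp add: c_odd)
    qed simp
    finally show ?thesis by (simp add: t_def)
  qed
  ultimately show ?thesis using that by blast
qed


lemma zonal_convolution_poly:
  fixes g :: "real \<Rightarrow> real"
  assumes dim: "2 \<le> DIM('a::euclidean_space)" and g: "continuous_on UNIV g"
  obtains p :: "real poly" where "degree p \<le> degree q"
    "\<And>x z :: 'a. norm x = 1 \<Longrightarrow> norm z = 1 \<Longrightarrow> (\<integral>y. g (x \<bullet> y) * poly q (y \<bullet> z) \<partial>sphere_measure) = poly p (x \<bullet> z)"
proof -
  interpret compact_prob "sphere_measure :: 'a measure" "sphere 0 1" by (rule compact_prob_sphere_measure)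
  have "\<exists>p :: real poly. degree p \<le> n \<and> (\<forall>x z :: 'a. norm x = 1 \<longrightarrow> norm z = 1 \<longrightarrow>
      (\<integral>y. g (x \<bullet> y) * (y \<bullet> z) ^ n \<partial>sphere_measure) = poly p (x \<bullet> z))" for n
    using zonal_convolution_monomial[OF dim g] by metis
  then obtain P :: "nat \<Rightarrow> real poly" where P: "\<And>n. degree (P n) \<le> n"
    "\<And>n x z :: 'a. norm x = 1 \<Longrightarrow> norm z = 1 \<Longrightarrow> (\<integral>y. g (x \<bullet> y) * (y \<bullet> z) ^ n \<partial>sphere_measure) = poly (P n) (x \<bullet> z)"
    by metis
  define p where "p = (\<Sum>i\<le>degree q. smult (coeff q i) (P i))"
  have "degree p \<le> degree q"
    unfolding p_def
  proof (rule degree_sum_le)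
    fix i assume "i \<in> {..degree q}"
    then show "degree (smult (coeff q i) (P i)) \<le> degree q"
      using P(1)[of i] degree_smult_le[of "coeff q i" "P i"] by simp
  qed simp
  moreover have "(\<integral>y. g (x \<bullet> y) * poly q (y \<bullet> z) \<partial>sphere_measure) = poly p (x \<bullet> z)"
    if "norm x = 1" "norm z = 1" for x z :: 'a
  proof -
    have i: "integrable sphere_measure (\<lambda>y. g (x \<bullet> y) * (y \<bullet> z) ^ i)" for i
      by (intro integrable_continuous continuous_intros continuous_on_compose2[OF g]) auto
    have "(\<integral>y. g (x \<bullet> y) * poly q (y \<bullet> z) \<partial>sphere_measure)
      = (\<integral>y. (\<Sum>i\<le>degree q. coeff q i * (g (x \<bullet> y) * (y \<bullet> z) ^ i)) \<partial>sphere_measure)"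
      by (simp add: poly_altdef sum_distrib_left mult_ac)
    also have "\<dots> = (\<Sum>i\<le>degree q. coeff q i * poly (P i) (x \<bullet> z))"
      by (subst Bochner_Integration.integral_sum) (auto simp: i P(2)[OF that])
    finally show ?thesis
      by (simp add: p_def poly_sum)
  qed
  ultimately show ?thesis using that by blast
qed

text \<open>
  The convolution of \<open>R\<^sub>k\<close> with \<open>g\<close> is a polynomial \<open>p\<close> of degree at most \<open>k\<close>. By Fubini's theorem, its
  integral against a polynomial \<open>q\<close> of smaller degree is that of \<open>R\<^sub>k\<close> against the convolution of \<open>q\<close>,
  which also has degree less than \<open>k\<close>; so it vanishes. This makes \<open>p\<close> a multiple of \<open>R\<^sub>k\<close>, and the
  factor is found at \<open>x = z\<close>.
\<close>

lemma funk_hecke: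
  fixes g :: "real \<Rightarrow> real" and x z :: "'a::euclidean_space"
  assumes m: "1 \<le> m" and dim: "DIM('a) = m + 1" and g: "continuous_on UNIV g"
    and x: "norm x = 1" and z: "norm z = 1"
  shows "(\<integral>y. g (x \<bullet> y) * poly (ultra m k) (y \<bullet> z) \<partial>sphere_measure)
     = (\<integral>t. g t * poly (ultra m k) t \<partial>weight_measure m) * poly (ultra m k) (x \<bullet> z)"
proof -
  interpret W: compact_prob "weight_measure m" "{-1..1}" by (rule compact_prob_weight_measure) fact
  interpret S: compact_prob "sphere_measure :: 'a measure" "sphere 0 1" by (rule compact_prob_sphere_measure)
  have dim2: "2 \<le> DIM('a)" using m dim by simp
  obtain p :: "real poly" where deg: "degree p \<le> degree (ultra m k)"
    and p: "\<And>x z :: 'a. norm x = 1 \<Longrightarrow> norm z = 1 \<Longrightarrow>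
      (\<integral>y. g (x \<bullet> y) * poly (ultra m k) (y \<bullet> z) \<partial>sphere_measure) = poly p (x \<bullet> z)"
    using zonal_convolution_poly[OF dim2 g, of "ultra m k"] by metis
  have orth: "(\<integral>t. poly p t * poly q t \<partial>weight_measure m) = 0" if q: "degree q < k" for q
  proof -
    \<comment> \<open>Fubini transfers the convolution from \<open>R\<^sub>k\<close> to \<open>q\<close>.\<close>
    obtain q' :: "real poly" where deg': "degree q' \<le> degree q"
      and q': "\<And>x z :: 'a. norm x = 1 \<Longrightarrow> norm z = 1 \<Longrightarrow>
        (\<integral>y. g (x \<bullet> y) * poly q (y \<bullet> z) \<partial>sphere_measure) = poly q' (x \<bullet> z)"
      using zonal_convolution_poly[OF dim2 g, of q] by metis
    have c: "continuous_on UNIV (\<lambda>(x, y). g (x \<bullet> y) * poly (ultra m k) (y \<bullet> z) * poly q (x \<bullet> z))"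
      "continuous_on UNIV (\<lambda>(y, x). g (x \<bullet> y) * poly (ultra m k) (y \<bullet> z) * poly q (x \<bullet> z))"
      unfolding case_prod_unfold by (intro continuous_intros continuous_on_compose2[OF g]; simp)+
    have "(\<integral>t. poly p t * poly q t \<partial>weight_measure m) = (\<integral>x. poly p (z \<bullet> x) * poly q (z \<bullet> x) \<partial>sphere_measure)"
      by (rule sphere_projection[OF m dim z, symmetric]) (intro continuous_intros)
    also have "\<dots> = (\<integral>x. (\<integral>y. g (x \<bullet> y) * poly (ultra m k) (y \<bullet> z) * poly q (x \<bullet> z) \<partial>sphere_measure) \<partial>sphere_measure)"
    proof (rule S.integral_cong_support[OF _ S.continuous_on_integral[OF c(1)]])
      fix x :: 'a assume "x \<in> sphere 0 1"
      then have "norm x = 1" by simp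
      from p[OF this z] show "poly p (z \<bullet> x) * poly q (z \<bullet> x)
          = (\<integral>y. g (x \<bullet> y) * poly (ultra m k) (y \<bullet> z) * poly q (x \<bullet> z) \<partial>sphere_measure)"
        by (simp add: inner_commute[of z x])
    qed (intro continuous_intros)
    also have "\<dots> = (\<integral>y. (\<integral>x. g (x \<bullet> y) * poly (ultra m k) (y \<bullet> z) * poly q (x \<bullet> z) \<partial>sphere_measure) \<partial>sphere_measure)"
      by (rule Fubini_continuous[OF S.compact_prob_axioms S.compact_prob_axioms c(1)])
    also have "\<dots> = (\<integral>y. poly q' (z \<bullet> y) * poly (ultra m k) (z \<bullet> y) \<partial>sphere_measure)"
    proof (rule S.integral_cong_support[OF S.continuous_on_integral[OF c(2)]])
      fix y :: 'a assume "y \<in> sphere 0 1"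
      then have "norm y = 1" by simp
      have "(\<integral>x. g (x \<bullet> y) * poly (ultra m k) (y \<bullet> z) * poly q (x \<bullet> z) \<partial>sphere_measure)
          = (\<integral>x. poly (ultra m k) (y \<bullet> z) * (g (y \<bullet> x) * poly q (x \<bullet> z)) \<partial>sphere_measure)"
        by (simp add: inner_commute[of _ y] mult_ac)
      also have "\<dots> = poly (ultra m k) (y \<bullet> z) * poly q' (y \<bullet> z)"
        using q'[OF \<open>norm y = 1\<close> z] by simp
      finally show "(\<integral>x. g (x \<bullet> y) * poly (ultra m k) (y \<bullet> z) * poly q (x \<bullet> z) \<partial>sphere_measure)
          = poly q' (z \<bullet> y) * poly (ultra m k) (z \<bullet> y)"
        by (simp add: inner_commute[of y z] mult.commute)
    qed (intro continuous_intros)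
    also have "\<dots> = (\<integral>t. poly q' t * poly (ultra m k) t \<partial>weight_measure m)"
      by (rule sphere_projection[OF m dim z]) (intro continuous_intros)
    also have "\<dots> = 0"
      using deg' q by (intro ultra_orthogonal_poly[OF m]) simp
    finally show ?thesis .
  qed
  define c where "c = coeff p k / coeff (ultra m k) k"
  define r where "r = p - smult c (ultra m k)"
  have "degree r \<le> k"
    unfolding r_def using deg degree_ultra_le[of m k]
    by (intro degree_diff_le order.trans[OF degree_smult_le]) auto
  moreover have "coeff r k = 0"
    using coeff_ultra_pos[OF m, of k] by (simp add: r_def c_def)
  ultimately have r: "r = 0 \<or> degree r < k"
    by (metis le_neq_implies_less leading_coeff_0_iff)
  have i: "integrable (weight_measure m) (\<lambda>t. poly p t * poly r t)"
      "integrable (weight_measure m) (\<lambda>t. poly r t * poly (ultra m k) t)"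
    by (intro W.integrable_continuous continuous_intros)+
  \<comment> \<open>The remainder \<open>r\<close> is zero or of degree less than \<open>k\<close>, and orthogonal to \<open>p\<close> and \<open>R\<^sub>k\<close>, hence to itself.\<close>
  have "(\<integral>t. (poly r t)\<^sup>2 \<partial>weight_measure m)
      = (\<integral>t. poly p t * poly r t - c * (poly r t * poly (ultra m k) t) \<partial>weight_measure m)"
    by (simp add: r_def power2_eq_square algebra_simps)
  also have "\<dots> = (\<integral>t. poly p t * poly r t \<partial>weight_measure m) - c * (\<integral>t. poly r t * poly (ultra m k) t \<partial>weight_measure m)"
    using i by simp
  also have "\<dots> = 0"
    using r orth[of r] ultra_orthogonal_poly[OF m, of r k] by auto
  finally have zero: "(\<integral>t. (poly r t)\<^sup>2 \<partial>weight_measure m) = 0" .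
  have "continuous_on UNIV (poly r)" by (intro continuous_intros)
  from weight_measure_zero[OF m this zero] have pc: "poly p t = c * poly (ultra m k) t" if "t \<in> {-1..1}" for t
    using that by (simp add: r_def)
  have "c = poly p (z \<bullet> z)"
    using pc[of 1] z by (simp add: poly_ultra_1[OF m] norm_eq_1)
  also have "\<dots> = (\<integral>y. g (z \<bullet> y) * poly (ultra m k) (y \<bullet> z) \<partial>sphere_measure)"
    by (rule p[OF z z, symmetric])
  also have "\<dots> = (\<integral>y. g (z \<bullet> y) * poly (ultra m k) (z \<bullet> y) \<partial>sphere_measure)"
    by (simp only: inner_commute[of _ z])
  also have "\<dots> = (\<integral>t. g t * poly (ultra m k) t \<partial>weight_measure m)"
    by (rule sphere_projection[OF m dim z]) (intro continuous_intros g)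
  finally have c: "c = (\<integral>t. g t * poly (ultra m k) t \<partial>weight_measure m)" .
  have "\<bar>x \<bullet> z\<bar> \<le> 1" using Cauchy_Schwarz_ineq2[of x z] x z by simp
  then have "x \<bullet> z \<in> {-1..1}" by (auto simp: abs_le_iff)
  from pc[OF this] show ?thesis
    by (simp add: p[OF x z] c)
qed

section \<open>Integrals of positive definite kernels\<close>

text \<open>
  The weights are attached to the points themselves instead of an enumeration of them.
\<close>

lemma positive_definite_on_iff_finite:
  "positive_definite_on X K \<longleftrightarrow>
     (\<forall>A c. finite A \<and> A \<subseteq> X \<longrightarrow> 0 \<le> (\<Sum>p\<in>A. \<Sum>q\<in>A. c p * c q * K p q))"
proof (intro iffI allI impI)
  fix A :: "'a set" and c :: "'a \<Rightarrow> real"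
  assume pd: "positive_definite_on X K" and A: "finite A \<and> A \<subseteq> X"
  show "0 \<le> (\<Sum>p\<in>A. \<Sum>q\<in>A. c p * c q * K p q)"
  proof (cases "A = {}")
    case False
    obtain h where h: "bij_betw h {1..card A} A"
      using A ex_bij_betw_nat_finite_1 by blast
    have "1 \<le> card A" using A False by (simp add: Suc_le_eq card_gt_0_iff)
    moreover have "inj_on h {1..card A} \<and> h ` {1..card A} \<subseteq> X"
      using h A by (auto simp: bij_betw_def)
    ultimately have "0 \<le> (\<Sum>i=1..card A. \<Sum>j=1..card A. c (h i) * c (h j) * K (h i) (h j))"
      using pd[unfolded positive_definite_on_def, rule_format, of "card A" h "c \<circ> h"] by simp
    also have "\<dots> = (\<Sum>p\<in>A. \<Sum>j=1..card A. c p * c (h j) * K p (h j))"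
      by (rule sum.reindex_bij_betw[OF h])
    also have "\<dots> = (\<Sum>p\<in>A. \<Sum>q\<in>A. c p * c q * K p q)"
      by (intro sum.cong refl sum.reindex_bij_betw[OF h])
    finally show ?thesis .
  qed simp
next
  assume *: "\<forall>A c. finite A \<and> A \<subseteq> X \<longrightarrow> 0 \<le> (\<Sum>p\<in>A. \<Sum>q\<in>A. c p * c q * K p q)"
  show "positive_definite_on X K"
    unfolding positive_definite_on_def
  proof (intro allI impI)
    fix n :: nat and x :: "nat \<Rightarrow> 'a" and c :: "nat \<Rightarrow> real"
    assume x: "inj_on x {1..n} \<and> x ` {1..n} \<subseteq> X"
    define d where "d p = c (inv_into {1..n} x p)" for p
    have "0 \<le> (\<Sum>p\<in>x ` {1..n}. \<Sum>q\<in>x ` {1..n}. d p * d q * K p q)"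
      using * x by blast
    also have "\<dots> = (\<Sum>\<mu>=1..n. \<Sum>\<nu>=1..n. d (x \<mu>) * d (x \<nu>) * K (x \<mu>) (x \<nu>))"
      using x by (simp add: sum.reindex)
    also have "\<dots> = (\<Sum>\<mu>=1..n. \<Sum>\<nu>=1..n. c \<mu> * c \<nu> * K (x \<mu>) (x \<nu>))"
      using x by (intro sum.cong refl) (simp add: d_def)
    finally show "0 \<le> (\<Sum>\<mu>=1..n. \<Sum>\<nu>=1..n. c \<mu> * c \<nu> * K (x \<mu>) (x \<nu>))" .
  qed
qed

text \<open>
  Tent functions of a finite \<open>d\<close>-net, divided by their sum. Replacing the denominator by its maximum
  with the least value that the sum takes on \<open>C\<close> keeps the quotients continuous on the whole space.
\<close>

lemma compact_partition_of_unity: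
  fixes C :: "'a::euclidean_space set"
  assumes "compact C" "C \<noteq> {}" "0 < d"
  obtains A and \<phi> :: "'a \<Rightarrow> 'a \<Rightarrow> real" where "finite A" "A \<subseteq> C"
    "\<And>c. continuous_on UNIV (\<phi> c)" "\<And>c p. 0 \<le> \<phi> c p"
    "\<And>p. p \<in> C \<Longrightarrow> (\<Sum>c\<in>A. \<phi> c p) = 1" "\<And>c p. \<phi> c p \<noteq> 0 \<Longrightarrow> dist c p < d"
proof -
  have "C \<subseteq> (\<Union>c\<in>C. ball c d)" using assms(3) by auto
  then obtain A where A: "finite A" "A \<subseteq> C" "C \<subseteq> (\<Union>c\<in>A. ball c d)"
    using compactE_image[OF assms(1), of C "\<lambda>c. ball c d"] by (metis open_ball)
  define \<psi> where "\<psi> c p = max 0 (d - dist c p)" for c p :: 'a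
  have \<psi>_cont: "continuous_on UNIV (\<psi> c)" for c
    unfolding \<psi>_def by (intro continuous_intros)
  define S where "S p = (\<Sum>c\<in>A. \<psi> c p)" for p
  have S_cont: "continuous_on UNIV S"
    unfolding S_def by (intro continuous_intros \<psi>_cont)
  have S_pos: "0 < S p" if "p \<in> C" for p
  proof -
    obtain c where "c \<in> A" "dist c p < d" using A(3) \<open>p \<in> C\<close> by auto
    then have "0 < \<psi> c p" by (simp add: \<psi>_def)
    also have "\<psi> c p \<le> S p"
      unfolding S_def using A(1) \<open>c \<in> A\<close> by (intro member_le_sum) (auto simp: \<psi>_def)
    finally show ?thesis .
  qed
  obtain p0 where p0: "p0 \<in> C" "\<And>p. p \<in> C \<Longrightarrow> S p0 \<le> S p"
    using continuous_attains_inf[OF assms(1,2) continuous_on_subset[OF S_cont]] by auto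
  define \<phi> where "\<phi> c p = \<psi> c p / max (S p) (S p0)" for c p
  have den: "0 < max (S p) (S p0)" for p
    using S_pos[OF p0(1)] by (simp add: less_max_iff_disj)
  have den': "max (S p) (S p0) \<noteq> 0" for p
    using den[of p] by linarith
  show ?thesis
  proof
    show "continuous_on UNIV (\<phi> c)" for c
      unfolding \<phi>_def by (intro continuous_intros \<psi>_cont S_cont ballI den')
    show "0 \<le> \<phi> c p" for c p
      using den[of p] by (simp add: \<phi>_def \<psi>_def)
    show "(\<Sum>c\<in>A. \<phi> c p) = 1" if "p \<in> C" for p
    proof -
      have "max (S p) (S p0) = S p" using p0(2)[OF that] by simp
      then show ?thesis
        using S_pos[OF that] by (simp add: \<phi>_def sum_divide_distrib[symmetric] S_def)
    qed
    show "dist c p < d" if "\<phi> c p \<noteq> 0" for c p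
      using that by (auto simp: \<phi>_def \<psi>_def max_def split: if_splits)
  qed fact+
qed

text \<open>
  Up to an arbitrarily small error, a partition of unity turns the double integral into a quadratic
  form of the kernel at the points of the net, weighted by the masses of the parts.
\<close>

lemma (in compact_prob) double_integral_nonneg:
  fixes G :: "'a \<Rightarrow> 'a \<Rightarrow> real"
  assumes G: "continuous_on UNIV (\<lambda>(p, q). G p q)"
    and pd: "\<And>A c. finite A \<Longrightarrow> A \<subseteq> C \<Longrightarrow> 0 \<le> (\<Sum>p\<in>A. \<Sum>q\<in>A. c p * c q * G p q)"
  shows "0 \<le> (\<integral>p. (\<integral>q. G p q \<partial>N) \<partial>N)"
proof -
  have "- e \<le> (\<integral>p. (\<integral>q. G p q \<partial>N) \<partial>N)" if "0 < e" for e
  proof -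
    have "uniformly_continuous_on (C \<times> C) (\<lambda>(p, q). G p q)"
      using compact_Times[OF compact_support compact_support] continuous_on_subset[OF G subset_UNIV]
      by (rule compact_uniformly_continuous[rotated])
    then obtain d where d: "0 < d" "\<And>x y. x \<in> C \<times> C \<Longrightarrow> y \<in> C \<times> C \<Longrightarrow> dist x y < d \<Longrightarrow>
        dist (case x of (p, q) \<Rightarrow> G p q) (case y of (p, q) \<Rightarrow> G p q) < e"
      using \<open>0 < e\<close> unfolding uniformly_continuous_on_def by metis
    obtain A \<phi> where A: "finite A" "A \<subseteq> C" and
      \<phi>: "\<And>c. continuous_on UNIV (\<phi> c)" "\<And>c p. 0 \<le> (\<phi> c p :: real)"
        "\<And>p. p \<in> C \<Longrightarrow> (\<Sum>c\<in>A. \<phi> c p) = 1" "\<And>c p. \<phi> c p \<noteq> 0 \<Longrightarrow> dist c p < d / 2"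
      using compact_partition_of_unity[OF compact_support support_nonempty, of "d / 2"] \<open>0 < d\<close>
      by (metis half_gt_zero)
    define H where "H p q = (\<Sum>a\<in>A. \<Sum>b\<in>A. \<phi> a p * (\<phi> b q * G a b))" for p q
    have H: "continuous_on UNIV (\<lambda>(p, q). H p q)"
      unfolding H_def case_prod_unfold
      by (intro continuous_intros continuous_on_compose2[OF \<phi>(1)]) auto
    have close: "H p q - e \<le> G p q" if "p \<in> C" "q \<in> C" for p q
    proof -
      have "\<phi> a p * (\<phi> b q * G a b) \<le> \<phi> a p * (\<phi> b q * (G p q + e))" if ab: "a \<in> A" "b \<in> A" for a b
      proof (cases "\<phi> a p = 0 \<or> \<phi> b q = 0")
        case False
        then have "dist a p < d / 2" "dist b q < d / 2" using \<phi>(4) by auto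
        then have "dist (a, b) (p, q) < d"
          using sqrt_sum_squares_le_sum[of "dist a p" "dist b q"] by (simp add: dist_Pair_Pair)
        then have "\<bar>G a b - G p q\<bar> < e"
          using d(2)[of "(a, b)" "(p, q)"] A(2) ab \<open>p \<in> C\<close> \<open>q \<in> C\<close> by (auto simp: dist_real_def)
        then show ?thesis by (intro mult_left_mono \<phi>(2)) auto
      qed auto
      then have "H p q \<le> (\<Sum>a\<in>A. \<Sum>b\<in>A. \<phi> a p * (\<phi> b q * (G p q + e)))"
        unfolding H_def by (intro sum_mono)
      also have "\<dots> = (\<Sum>a\<in>A. \<phi> a p) * ((\<Sum>b\<in>A. \<phi> b q) * (G p q + e))"
        by (simp only: sum_distrib_right) (simp only: sum_distrib_left)
      finally show ?thesis using \<phi>(3) that by simp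
    qed
    have sect: "continuous_on UNIV (G p)" "continuous_on UNIV (H p)" for p
      using continuous_on_split[OF G, of UNIV "\<lambda>_. p" "\<lambda>q. q"] continuous_on_split[OF H, of UNIV "\<lambda>_. p" "\<lambda>q. q"]
      by (auto intro: continuous_intros)
    define w where "w a = (\<integral>q. \<phi> a q \<partial>N)" for a
    have i\<phi>: "integrable N (\<phi> a)" for a using \<phi>(1) by (rule integrable_continuous)
    have "(\<integral>p. (\<integral>q. H p q \<partial>N) \<partial>N) = (\<integral>p. (\<Sum>a\<in>A. \<Sum>b\<in>A. \<phi> a p * (w b * G a b)) \<partial>N)"
      using i\<phi> by (simp add: H_def w_def)
    also have "\<dots> = (\<Sum>a\<in>A. \<Sum>b\<in>A. w a * w b * G a b)"
      using i\<phi> by (simp add: w_def mult.assoc)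
    finally have "0 \<le> (\<integral>p. (\<integral>q. H p q \<partial>N) \<partial>N)"
      using pd[OF A, of w] by simp
    then have "- e \<le> (\<integral>p. (\<integral>q. H p q \<partial>N) - e \<partial>N)"
      using integrable_continuous[OF continuous_on_integral[OF H]] by (simp add: prob_space)
    also have "\<dots> \<le> (\<integral>p. (\<integral>q. G p q \<partial>N) \<partial>N)"
    proof (rule integral_mono_support)
      show "continuous_on UNIV (\<lambda>p. (\<integral>q. H p q \<partial>N) - e)" "continuous_on UNIV (\<lambda>p. \<integral>q. G p q \<partial>N)"
        by (intro continuous_intros continuous_on_integral H G)+
      fix p assume "p \<in> C"
      have "(\<integral>q. H p q \<partial>N) - e = (\<integral>q. H p q - e \<partial>N)"
        using integrable_continuous[OF sect(2)] by (simp add: prob_space)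
      also have "\<dots> \<le> (\<integral>q. G p q \<partial>N)"
        using \<open>p \<in> C\<close> by (intro integral_mono_support continuous_intros sect close)
      finally show "(\<integral>q. H p q \<partial>N) - e \<le> (\<integral>q. G p q \<partial>N)" .
    qed
    finally show ?thesis .
  qed
  then have "\<And>e. 0 < e \<Longrightarrow> - (\<integral>p. (\<integral>q. G p q \<partial>N) \<partial>N) \<le> e"
    by (simp add: minus_le_iff)
  then have "- (\<integral>p. (\<integral>q. G p q \<partial>N) \<partial>N) \<le> 0" by (rule dense_ge)
  then show ?thesis by simp
qed

lemma ultra_reproducing:
  fixes x z :: "'a::euclidean_space"
  assumes m: "1 \<le> m" and dim: "DIM('a) = m + 1" and "norm x = 1" "norm z = 1"
  shows "(\<integral>y. poly (ultra m k) (x \<bullet> y) * poly (ultra m k) (z \<bullet> y) \<partial>sphere_measure)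
    = ultra_norm m k * poly (ultra m k) (x \<bullet> z)"
proof -
  have "continuous_on UNIV (poly (ultra m k))" by (intro continuous_intros)
  from funk_hecke[OF m dim this assms(3,4), of k] show ?thesis
    by (simp add: ultra_norm_def power2_eq_square inner_commute)
qed

section \<open>Nonnegativity and summability of the coefficients\<close>

text \<open>
  An isotropic part is determined on \<open>[-1, 1]\<close> in each variable only. Composing with the
  retraction \<open>clip\<close> produces functions that are continuous on the whole line.
\<close>

definition clip :: "real \<Rightarrow> real" where
  "clip t = max (-1) (min 1 t)"

lemma clip_range: "clip t \<in> {-1..1}"
  by (auto simp: clip_def)

lemma clip_id: "t \<in> {-1..1} \<Longrightarrow> clip t = t"
  by (auto simp: clip_def)

lemma continuous_on_clip: "continuous_on A clip"
  unfolding clip_def by (intro continuous_intros)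

text \<open>
  For orthonormal \<open>x\<close> and \<open>e\<close>, the point of the great half-circle from \<open>x\<close> through \<open>e\<close> to \<open>- x\<close>
  that has inner product \<open>clip t\<close> with \<open>x\<close>.
\<close>

definition arc :: "'a::euclidean_space \<Rightarrow> 'a \<Rightarrow> real \<Rightarrow> 'a" where
  "arc x e t = clip t *\<^sub>R x + sqrt (1 - (clip t)\<^sup>2) *\<^sub>R e"

lemma continuous_on_arc: "continuous_on A (arc x e)"
  unfolding arc_def by (intro continuous_intros continuous_on_clip)

lemma arc_sphere:
  assumes "norm x = 1" "norm e = 1" "x \<bullet> e = 0"
  shows "norm (arc x e t) = 1" "x \<bullet> arc x e t = clip t"
proof -
  define s where "s = sqrt (1 - (clip t)\<^sup>2)"
  have s: "s\<^sup>2 = 1 - (clip t)\<^sup>2"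
    using clip_range[of t] by (simp add: s_def abs_square_le_1 abs_le_iff)
  have arc: "arc x e t = clip t *\<^sub>R x + s *\<^sub>R e"
    by (simp add: arc_def s_def)
  have "arc x e t \<bullet> arc x e t = (clip t)\<^sup>2 * (x \<bullet> x) + 2 * clip t * s * (x \<bullet> e) + s\<^sup>2 * (e \<bullet> e)"
    unfolding arc by (simp add: inner_add_left inner_add_right inner_commute[of e x] power2_eq_square algebra_simps)
  then show "norm (arc x e t) = 1"
    using assms s by (simp add: norm_eq_1)
  show "x \<bullet> arc x e t = clip t"
    using assms by (simp add: arc inner_add_right norm_eq_1)
qed

lemma inner_unit_vectors_range:
  fixes x y :: "'a::euclidean_space"
  assumes "norm x = 1" "norm y = 1"
  shows "x \<bullet> y \<in> {-1..1}"
  using Cauchy_Schwarz_ineq2[of x y] assms by (auto simp: abs_le_iff)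

text \<open>
  By the reproducing formula \<open>h\<^sub>k R\<^sub>k(x \<bullet> z)\<close> is the integral of a product of two functions whose squares
  both have integral \<open>h\<^sub>k\<close>.
\<close>

lemma abs_ultra_le_1:
  fixes t :: real
  assumes m: "1 \<le> m" and dim: "DIM('a::euclidean_space) = m + 1" and t: "t \<in> {-1..1}"
  shows "\<bar>poly (ultra m k) t\<bar> \<le> 1"
proof -
  interpret S: compact_prob "sphere_measure :: 'a measure" "sphere 0 1" by (rule compact_prob_sphere_measure)
  have "2 \<le> DIM('a)" using m dim by simp
  then obtain x e :: 'a where xe: "norm x = 1" "norm e = 1" "x \<bullet> e = 0"
    by (rule orthonormal_pair_exists)
  define z where "z = arc x e t"
  have z: "norm z = 1" "x \<bullet> z = t"
    using arc_sphere[OF xe, of t] t by (simp_all add: z_def clip_id)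
  let ?R = "poly (ultra m k)"
  have sq: "(\<integral>y. (?R (v \<bullet> y))\<^sup>2 \<partial>sphere_measure) = ultra_norm m k" if "norm v = 1" for v :: 'a
    unfolding ultra_norm_def by (rule sphere_projection[OF m dim that]) (intro continuous_intros)
  have i: "integrable sphere_measure (\<lambda>y. (?R (v \<bullet> y))\<^sup>2)" for v :: 'a
    by (intro S.integrable_continuous continuous_intros)
  have "\<bar>\<integral>y. ?R (x \<bullet> y) * ?R (z \<bullet> y) \<partial>sphere_measure\<bar> \<le> (\<integral>y. \<bar>?R (x \<bullet> y) * ?R (z \<bullet> y)\<bar> \<partial>sphere_measure)"
    by (rule integral_abs_bound)
  also have "\<dots> \<le> (\<integral>y. ((?R (x \<bullet> y))\<^sup>2 + (?R (z \<bullet> y))\<^sup>2) / 2 \<partial>sphere_measure)"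
  proof (rule S.integral_mono_support)
    fix y
    have "0 \<le> (\<bar>?R (x \<bullet> y)\<bar> - \<bar>?R (z \<bullet> y)\<bar>)\<^sup>2" by simp
    also have "\<dots> = (?R (x \<bullet> y))\<^sup>2 + (?R (z \<bullet> y))\<^sup>2 - 2 * \<bar>?R (x \<bullet> y) * ?R (z \<bullet> y)\<bar>"
      by (simp add: power2_diff abs_mult)
    finally show "\<bar>?R (x \<bullet> y) * ?R (z \<bullet> y)\<bar> \<le> ((?R (x \<bullet> y))\<^sup>2 + (?R (z \<bullet> y))\<^sup>2) / 2"
      by simp
  qed (intro continuous_intros; simp)+
  also have "\<dots> = ultra_norm m k"
    using i[of x] i[of z] by (simp add: sq xe z)
  finally have "\<bar>ultra_norm m k * ?R t\<bar> \<le> ultra_norm m k"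
    using ultra_reproducing[OF m dim xe(1) z(1), of k] z(2) by simp
  then show ?thesis
    using ultra_norm_pos[OF m, of k] by (simp add: abs_mult)
qed

text \<open>
  The Fourier coefficient of \<open>F\<close> of index \<open>(k, l)\<close>, up to the positive factor computed in
  \<open>fourier_coeff_eq_double_coeff\<close>.
\<close>

definition double_coeff :: "nat \<Rightarrow> nat \<Rightarrow> (real \<Rightarrow> real \<Rightarrow> real) \<Rightarrow> nat \<Rightarrow> nat \<Rightarrow> real" where
  "double_coeff m M F k l =
     (\<integral>t. (\<integral>s. F t s * poly (ultra M l) s \<partial>weight_measure M) * poly (ultra m k) t \<partial>weight_measure m)"

lemma product_ultra_square:
  fixes x :: "'a::euclidean_space" and z :: "'b::euclidean_space"
  assumes m: "1 \<le> m" "DIM('a) = m + 1" and M: "1 \<le> M" "DIM('b) = M + 1"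
    and x: "norm x = 1" and z: "norm z = 1" and x': "norm x' = 1" and z': "norm z' = 1"
  shows "(\<integral>p. (poly (ultra m k) (x \<bullet> fst p) * poly (ultra M l) (z \<bullet> snd p))
        * (poly (ultra m k) (x' \<bullet> fst p) * poly (ultra M l) (z' \<bullet> snd p)) \<partial>(sphere_measure \<Otimes>\<^sub>M sphere_measure))
    = ultra_norm m k * ultra_norm M l * (poly (ultra m k) (x \<bullet> x') * poly (ultra M l) (z \<bullet> z'))"
proof -
  let ?g = "\<lambda>(y :: 'a) (w :: 'b). (poly (ultra m k) (x \<bullet> y) * poly (ultra M l) (z \<bullet> w))
        * (poly (ultra m k) (x' \<bullet> y) * poly (ultra M l) (z' \<bullet> w))"
  have "continuous_on UNIV (\<lambda>(y, w). ?g y w)"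
    unfolding case_prod_unfold by (intro continuous_intros)
  from integral_pair_continuous[OF compact_prob_sphere_measure compact_prob_sphere_measure this]
  have "(\<integral>p. ?g (fst p) (snd p) \<partial>(sphere_measure \<Otimes>\<^sub>M sphere_measure))
     = (\<integral>y. (\<integral>w. (poly (ultra m k) (x \<bullet> y) * poly (ultra m k) (x' \<bullet> y)) * (poly (ultra M l) (z \<bullet> w) * poly (ultra M l) (z' \<bullet> w)) \<partial>sphere_measure) \<partial>sphere_measure)"
    by (simp add: case_prod_unfold mult_ac)
  also have "\<dots> = (ultra_norm m k * poly (ultra m k) (x \<bullet> x')) * (ultra_norm M l * poly (ultra M l) (z \<bullet> z'))"
    by (simp add: ultra_reproducing[OF m x x'] ultra_reproducing[OF M z z'])
  finally show ?thesis by (simp only: mult_ac)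
qed

text \<open>
  With \<open>u(x, z) = R\<^sub>k(x \<bullet> x\<^sub>0) R\<^sub>l(z \<bullet> z\<^sub>0)\<close>, integrating the kernel against \<open>u\<close> in one variable
  returns \<open>u\<close> times the coefficient, by Funk-Hecke on each sphere. Hence the nonnegative double integral
  of the kernel against \<open>u\<close> in both variables is the coefficient times the integral of \<open>u\<^sup>2\<close>.
\<close>

lemma double_coeff_nonneg:
  fixes F :: "real \<Rightarrow> real \<Rightarrow> real"
  assumes m: "1 \<le> m" "DIM('a::euclidean_space) = m + 1" and M: "1 \<le> M" "DIM('b::euclidean_space) = M + 1"
    and F: "continuous_on UNIV (\<lambda>(t, s). F t s)"
    and pd: "positive_definite_on (sphere 0 1 \<times> sphere 0 1)
        (\<lambda>(p :: 'a \<times> 'b) q. F (fst p \<bullet> fst q) (snd p \<bullet> snd q))"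
  shows "0 \<le> double_coeff m M F k l"
proof -
  let ?S = "sphere_measure :: 'a measure" and ?T = "sphere_measure :: 'b measure"
  let ?R = "poly (ultra m k)" and ?Q = "poly (ultra M l)"
  interpret S: compact_prob ?S "sphere 0 1" by (rule compact_prob_sphere_measure)
  interpret T: compact_prob ?T "sphere 0 1" by (rule compact_prob_sphere_measure)
  interpret WM: compact_prob "weight_measure M" "{-1..1}" by (rule compact_prob_weight_measure) fact
  interpret P: compact_prob "?S \<Otimes>\<^sub>M ?T" "sphere 0 1 \<times> sphere 0 1"
    by (rule compact_prob_pair) (rule compact_prob_sphere_measure)+
  obtain x0 :: 'a where x0: "norm x0 = 1" using vector_choose_size[of 1] by auto
  obtain z0 :: 'b where z0: "norm z0 = 1" using vector_choose_size[of 1] by auto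
  define u where "u p = ?R (fst p \<bullet> x0) * ?Q (snd p \<bullet> z0)" for p :: "'a \<times> 'b"
  define G where "G p q = F (fst p \<bullet> fst q) (snd p \<bullet> snd q) * (u p * u q)" for p q
  have u_cont: "continuous_on UNIV u"
    unfolding u_def by (intro continuous_intros)
  have G_cont: "continuous_on UNIV (\<lambda>(p, q). G p q)"
    unfolding G_def case_prod_unfold
    by (intro continuous_intros continuous_on_split[OF F] continuous_on_compose2[OF u_cont]) auto
  have "0 \<le> (\<integral>p. (\<integral>q. G p q \<partial>(?S \<Otimes>\<^sub>M ?T)) \<partial>(?S \<Otimes>\<^sub>M ?T))"
  proof (rule P.double_integral_nonneg[OF G_cont])
    fix A :: "('a \<times> 'b) set" and c
    assume "finite A" "A \<subseteq> sphere 0 1 \<times> sphere 0 1"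
    then have "0 \<le> (\<Sum>p\<in>A. \<Sum>q\<in>A. (c p * u p) * (c q * u q) * F (fst p \<bullet> fst q) (snd p \<bullet> snd q))"
      using pd[unfolded positive_definite_on_iff_finite, rule_format, of A "\<lambda>p. c p * u p"] by simp
    then show "0 \<le> (\<Sum>p\<in>A. \<Sum>q\<in>A. c p * c q * G p q)"
      by (simp add: G_def mult_ac)
  qed
  also have "\<dots> = (\<integral>p. double_coeff m M F k l * (u p * u p) \<partial>(?S \<Otimes>\<^sub>M ?T))"
  proof (rule P.integral_cong_support)
    show "continuous_on UNIV (\<lambda>p. \<integral>q. G p q \<partial>(?S \<Otimes>\<^sub>M ?T))"
      by (rule P.continuous_on_integral[OF G_cont])
    show "continuous_on UNIV (\<lambda>p. double_coeff m M F k l * (u p * u p))"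
      by (intro continuous_intros u_cont)
    fix p :: "'a \<times> 'b"
    assume "p \<in> sphere 0 1 \<times> sphere 0 1"
    then obtain x z where p: "p = (x, z)" and x: "norm x = 1" and z: "norm z = 1" by auto
    have Fx: "continuous_on UNIV (F t)" for t
      by (rule continuous_on_split[OF F]) (intro continuous_intros)+
    define L where "L t = (\<integral>s. F t s * ?Q s \<partial>weight_measure M)" for t
    have L_cont: "continuous_on UNIV L"
      unfolding L_def
      by (rule WM.continuous_on_integral)
        (unfold case_prod_unfold, intro continuous_intros continuous_on_split[OF F])
    have c: "continuous_on UNIV (\<lambda>(y, w). F (x \<bullet> y) (z \<bullet> w) * (?R (y \<bullet> x0) * ?Q (w \<bullet> z0)))"
      unfolding case_prod_unfold by (intro continuous_intros continuous_on_split[OF F])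
    have "(\<integral>q. G p q \<partial>(?S \<Otimes>\<^sub>M ?T))
        = (\<integral>q. u p * (case q of (y, w) \<Rightarrow> F (x \<bullet> y) (z \<bullet> w) * (?R (y \<bullet> x0) * ?Q (w \<bullet> z0))) \<partial>(?S \<Otimes>\<^sub>M ?T))"
      by (simp add: G_def p u_def case_prod_unfold mult_ac)
    also have "\<dots> = u p * (\<integral>y. (\<integral>w. F (x \<bullet> y) (z \<bullet> w) * (?R (y \<bullet> x0) * ?Q (w \<bullet> z0)) \<partial>?T) \<partial>?S)"
      using integral_pair_continuous[OF S.compact_prob_axioms T.compact_prob_axioms c] by simp
    also have "(\<lambda>y. \<integral>w. F (x \<bullet> y) (z \<bullet> w) * (?R (y \<bullet> x0) * ?Q (w \<bullet> z0)) \<partial>?T)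
        = (\<lambda>y. ?Q (z \<bullet> z0) * (L (x \<bullet> y) * ?R (y \<bullet> x0)))"
    proof
      fix y
      have "(\<integral>w. F (x \<bullet> y) (z \<bullet> w) * (?R (y \<bullet> x0) * ?Q (w \<bullet> z0)) \<partial>?T)
          = (\<integral>w. ?R (y \<bullet> x0) * (F (x \<bullet> y) (z \<bullet> w) * ?Q (w \<bullet> z0)) \<partial>?T)"
        by (simp add: mult_ac)
      also have "\<dots> = ?R (y \<bullet> x0) * (L (x \<bullet> y) * ?Q (z \<bullet> z0))"
        using funk_hecke[OF M Fx z z0, of "x \<bullet> y" l] by (simp add: L_def)
      finally show "(\<integral>w. F (x \<bullet> y) (z \<bullet> w) * (?R (y \<bullet> x0) * ?Q (w \<bullet> z0)) \<partial>?T)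
        = ?Q (z \<bullet> z0) * (L (x \<bullet> y) * ?R (y \<bullet> x0))" by simp
    qed
    also have "(\<integral>y. ?Q (z \<bullet> z0) * (L (x \<bullet> y) * ?R (y \<bullet> x0)) \<partial>?S)
        = ?Q (z \<bullet> z0) * (double_coeff m M F k l * ?R (x \<bullet> x0))"
      using funk_hecke[OF m L_cont x x0, of k] by (simp add: double_coeff_def L_def)
    finally show "(\<integral>q. G p q \<partial>(?S \<Otimes>\<^sub>M ?T)) = double_coeff m M F k l * (u p * u p)"
      by (simp add: u_def p)
  qed
  also have "\<dots> = double_coeff m M F k l * (ultra_norm m k * ultra_norm M l)"
    using product_ultra_square[OF m M x0 z0 x0 z0, of k l] x0 z0
    by (simp add: u_def inner_commute norm_eq_1 poly_ultra_1[OF m(1)] poly_ultra_1[OF M(1)])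
  finally show ?thesis
    using mult_pos_pos[OF ultra_norm_pos[OF m(1), of k] ultra_norm_pos[OF M(1), of l]]
    by (simp add: zero_le_mult_iff)
qed

text \<open>
  Average \<open>F\<close> against \<open>(1 + t)\<^sup>N (1 + s)\<^sup>N\<close>, normalised to total mass \<open>1\<close>. The average is at most \<open>B\<close>, and
  expanding the powers turns it into the coefficient sum with weights \<open>\<gamma> m N k * \<gamma> M N l \<ge> 0\<close>. All terms are
  nonnegative, so the sum may be truncated at \<open>n\<close>, and each weight tends to \<open>1\<close> as \<open>N\<close> grows.
\<close>

lemma double_coeff_partial_sum_bound:
  fixes F :: "real \<Rightarrow> real \<Rightarrow> real"
  assumes m: "1 \<le> m" and M: "1 \<le> M"
    and F: "continuous_on UNIV (\<lambda>(t, s). F t s)"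
    and nonneg: "\<And>k l. 0 \<le> double_coeff m M F k l"
    and B: "\<And>t s. t \<in> {-1..1} \<Longrightarrow> s \<in> {-1..1} \<Longrightarrow> F t s \<le> B"
  shows "(\<Sum>k\<le>n. \<Sum>l\<le>n. double_coeff m M F k l / (ultra_norm m k * ultra_norm M l)) \<le> B"
proof -
  let ?\<mu> = "weight_measure m" and ?\<nu> = "weight_measure M"
  interpret A: compact_prob ?\<mu> "{-1..1}" by (rule compact_prob_weight_measure) fact
  interpret B: compact_prob ?\<nu> "{-1..1}" by (rule compact_prob_weight_measure) fact
  define \<beta> where "\<beta> m N = (\<integral>t. (1 + t) ^ N \<partial>weight_measure m)" for m N
  define \<gamma> where "\<gamma> m N k = (\<integral>t. (1 + t) ^ N * poly (ultra m k) t \<partial>weight_measure m) / \<beta> m N" for m N k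
  have \<beta>: "0 < \<beta> m N" "0 < \<beta> M N" for N
    unfolding \<beta>_def by (rule integral_power_pos[OF m] integral_power_pos[OF M])+
  have Fx: "continuous_on UNIV (F t)" for t
    by (rule continuous_on_split[OF F]) (intro continuous_intros)+
  have inner_cont: "continuous_on UNIV (\<lambda>t. \<integral>s. F t s * g s \<partial>?\<nu>)" if "continuous_on UNIV g" for g
    by (rule B.continuous_on_integral)
      (unfold case_prod_unfold, intro continuous_intros continuous_on_split[OF F] continuous_on_compose2[OF that]; simp)
  have expansion: "\<exists>c. (\<forall>k. 0 \<le> c k) \<and> (\<forall>t. (1 + t) ^ N = (\<Sum>k\<le>N. c k * poly (ultra m k) t)) \<and>
      (\<forall>k\<le>N. \<gamma> m N k = c k * ultra_norm m k / \<beta> m N)" if m: "1 \<le> m" for m N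
  proof -
    interpret W: compact_prob "weight_measure m" "{-1..1}" by (rule compact_prob_weight_measure) fact
    obtain c where c: "\<forall>k. 0 \<le> c k" "\<forall>t. (1 + t) ^ N = (\<Sum>k\<le>N. c k * poly (ultra m k) t)"
      using ultra_cone_power[OF m, of N] unfolding ultra_cone_def by blast
    have i: "integrable (weight_measure m) (\<lambda>t. poly (ultra m j) t * poly (ultra m k) t)" for j k
      by (intro W.integrable_continuous continuous_intros)
    have "(\<integral>t. (1 + t) ^ N * poly (ultra m k) t \<partial>weight_measure m) = c k * ultra_norm m k" if "k \<le> N" for k
    proof -
      have "(\<integral>t. (1 + t) ^ N * poly (ultra m k) t \<partial>weight_measure m)
          = (\<integral>t. (\<Sum>j\<le>N. c j * (poly (ultra m j) t * poly (ultra m k) t)) \<partial>weight_measure m)"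
        by (simp add: c(2) sum_distrib_right mult.assoc)
      also have "\<dots> = (\<Sum>j\<le>N. c j * (if j = k then ultra_norm m k else 0))"
        using i by (simp add: integral_ultra_ultra[OF m])
      also have "\<dots> = c k * ultra_norm m k"
        using that by (simp add: if_distrib[of "\<lambda>x. _ * x"] cong: if_cong)
      finally show ?thesis .
    qed
    with c show ?thesis by (auto simp: \<gamma>_def)
  qed
  have bound: "(\<Sum>k\<le>n. \<Sum>l\<le>n. double_coeff m M F k l / (ultra_norm m k * ultra_norm M l) * (\<gamma> m N k * \<gamma> M N l)) \<le> B"
    if N: "n \<le> N" for N
  proof -
    obtain c where c: "\<forall>k. 0 \<le> c k" "\<forall>t. (1 + t) ^ N = (\<Sum>k\<le>N. c k * poly (ultra m k) t)"
      "\<forall>k\<le>N. \<gamma> m N k = c k * ultra_norm m k / \<beta> m N"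
      using expansion[OF m] by metis
    obtain d where d: "\<forall>k. 0 \<le> d k" "\<forall>t. (1 + t) ^ N = (\<Sum>k\<le>N. d k * poly (ultra M k) t)"
      "\<forall>k\<le>N. \<gamma> M N k = d k * ultra_norm M k / \<beta> M N"
      using expansion[OF M] by metis
    define \<Lambda> where "\<Lambda> l t = (\<integral>s. F t s * poly (ultra M l) s \<partial>?\<nu>)" for l t
    have \<Lambda>: "continuous_on UNIV (\<Lambda> l)" for l
      unfolding \<Lambda>_def by (rule inner_cont) (intro continuous_intros)
    have ints: "integrable ?\<nu> (\<lambda>s. F t s * poly (ultra M l) s)" for t l
      by (intro B.integrable_continuous continuous_intros Fx)
    have intt: "integrable ?\<mu> (\<lambda>t. \<Lambda> l t * poly (ultra m k) t)" for k l
      by (intro A.integrable_continuous continuous_intros \<Lambda>)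
    have "(\<integral>t. (\<integral>s. F t s * (1 + s) ^ N \<partial>?\<nu>) * (1 + t) ^ N \<partial>?\<mu>)
        = (\<integral>t. (\<Sum>l\<le>N. d l * \<Lambda> l t) * (1 + t) ^ N \<partial>?\<mu>)"
    proof -
      have "(\<integral>s. F t s * (1 + s) ^ N \<partial>?\<nu>) = (\<integral>s. (\<Sum>l\<le>N. d l * (F t s * poly (ultra M l) s)) \<partial>?\<nu>)" for t
        by (simp add: d(2) sum_distrib_left mult_ac)
      then show ?thesis using ints by (simp add: \<Lambda>_def)
    qed
    also have "\<dots> = (\<integral>t. (\<Sum>l\<le>N. \<Sum>k\<le>N. d l * c k * (\<Lambda> l t * poly (ultra m k) t)) \<partial>?\<mu>)"
      by (simp only: c(2)[rule_format] sum_product) (simp only: mult_ac)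
    also have "\<dots> = (\<Sum>l\<le>N. \<Sum>k\<le>N. d l * c k * double_coeff m M F k l)"
      using intt by (simp add: double_coeff_def \<Lambda>_def)
    finally have eq: "(\<integral>t. (\<integral>s. F t s * (1 + s) ^ N \<partial>?\<nu>) * (1 + t) ^ N \<partial>?\<mu>)
        = (\<Sum>k\<le>N. \<Sum>l\<le>N. d l * c k * double_coeff m M F k l)"
      by (subst sum.swap)
    have "(\<integral>t. (\<integral>s. F t s * (1 + s) ^ N \<partial>?\<nu>) * (1 + t) ^ N \<partial>?\<mu>) \<le> (\<integral>t. (B * \<beta> M N) * (1 + t) ^ N \<partial>?\<mu>)"
    proof (rule A.integral_mono_support)
      show "continuous_on UNIV (\<lambda>t. (\<integral>s. F t s * (1 + s) ^ N \<partial>?\<nu>) * (1 + t) ^ N)"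
        by (intro continuous_intros inner_cont)
      show "continuous_on UNIV (\<lambda>t. (B * \<beta> M N) * (1 + t) ^ N)"
        by (intro continuous_intros)
      fix t :: real assume t: "t \<in> {-1..1}"
      have "(\<integral>s. F t s * (1 + s) ^ N \<partial>?\<nu>) \<le> (\<integral>s. B * (1 + s) ^ N \<partial>?\<nu>)"
        using t B by (intro B.integral_mono_support continuous_intros Fx mult_right_mono) auto
      also have "\<dots> = B * \<beta> M N"
        by (simp add: \<beta>_def)
      finally show "(\<integral>s. F t s * (1 + s) ^ N \<partial>?\<nu>) * (1 + t) ^ N \<le> (B * \<beta> M N) * (1 + t) ^ N"
        using t by (intro mult_right_mono) auto
    qed
    also have "\<dots> = B * \<beta> M N * \<beta> m N"
      by (simp add: \<beta>_def)
    finally have le: "(\<Sum>k\<le>N. \<Sum>l\<le>N. d l * c k * double_coeff m M F k l) / (\<beta> m N * \<beta> M N) \<le> B"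
      unfolding eq using \<beta>[of N] by (simp add: divide_le_eq mult_ac)
    have "(\<Sum>k\<le>n. \<Sum>l\<le>n. double_coeff m M F k l / (ultra_norm m k * ultra_norm M l) * (\<gamma> m N k * \<gamma> M N l))
        = (\<Sum>k\<le>n. \<Sum>l\<le>n. d l * c k * double_coeff m M F k l / (\<beta> m N * \<beta> M N))"
    proof (intro sum.cong refl)
      fix k l assume "k \<in> {..n}" "l \<in> {..n}"
      then have "\<gamma> m N k = c k * ultra_norm m k / \<beta> m N" "\<gamma> M N l = d l * ultra_norm M l / \<beta> M N"
        using c(3) d(3) N by auto
      then show "double_coeff m M F k l / (ultra_norm m k * ultra_norm M l) * (\<gamma> m N k * \<gamma> M N l)
          = d l * c k * double_coeff m M F k l / (\<beta> m N * \<beta> M N)"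
        using ultra_norm_pos[OF m, of k] ultra_norm_pos[OF M, of l] by (simp add: field_simps)
    qed
    also have "\<dots> \<le> (\<Sum>k\<le>N. \<Sum>l\<le>N. d l * c k * double_coeff m M F k l / (\<beta> m N * \<beta> M N))"
      using N c(1) d(1) nonneg \<beta>[of N]
      by (intro order.trans[OF sum_mono[OF sum_mono2] sum_mono2])
        (auto intro!: sum_nonneg divide_nonneg_pos mult_nonneg_nonneg mult_pos_pos)
    also have "\<dots> = (\<Sum>k\<le>N. \<Sum>l\<le>N. d l * c k * double_coeff m M F k l) / (\<beta> m N * \<beta> M N)"
      by (simp add: sum_divide_distrib)
    also note le
    finally show ?thesis .
  qed
  have \<gamma>_lim: "(\<lambda>N. \<gamma> m N k) \<longlonglongrightarrow> 1" if "1 \<le> m" for m k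
    using power_concentrates[OF that, of "ultra m k"] by (simp add: \<gamma>_def \<beta>_def poly_ultra_1[OF that])
  have "(\<lambda>N. \<Sum>k\<le>n. \<Sum>l\<le>n. double_coeff m M F k l / (ultra_norm m k * ultra_norm M l) * (\<gamma> m N k * \<gamma> M N l))
      \<longlonglongrightarrow> (\<Sum>k\<le>n. \<Sum>l\<le>n. double_coeff m M F k l / (ultra_norm m k * ultra_norm M l) * (1 * 1))"
    by (intro tendsto_intros \<gamma>_lim m M)
  then have "(\<Sum>k\<le>n. \<Sum>l\<le>n. double_coeff m M F k l / (ultra_norm m k * ultra_norm M l) * (1 * 1)) \<le> B"
    by (rule LIMSEQ_le_const2) (use bound in blast)
  then show ?thesis by simp
qed

section \<open>The expansion of a function with nonnegative coefficients\<close>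

lemma double_coeff_eq_pair:
  fixes F :: "real \<Rightarrow> real \<Rightarrow> real"
  assumes m: "1 \<le> m" and M: "1 \<le> M" and F: "continuous_on UNIV (\<lambda>(t, s). F t s)"
  shows "double_coeff m M F k l = (\<integral>p. F (fst p) (snd p) * (poly (ultra m k) (fst p) * poly (ultra M l) (snd p))
      \<partial>(weight_measure m \<Otimes>\<^sub>M weight_measure M))"
proof -
  have "continuous_on UNIV (\<lambda>(t, s). F t s * (poly (ultra m k) t * poly (ultra M l) s))"
    unfolding case_prod_unfold by (intro continuous_intros continuous_on_split[OF F])
  from integral_pair_continuous[OF compact_prob_weight_measure[OF m] compact_prob_weight_measure[OF M] this]
  have "(\<integral>p. F (fst p) (snd p) * (poly (ultra m k) (fst p) * poly (ultra M l) (snd p)) \<partial>(weight_measure m \<Otimes>\<^sub>M weight_measure M))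
     = (\<integral>t. (\<integral>s. (F t s * poly (ultra M l) s) * poly (ultra m k) t \<partial>weight_measure M) \<partial>weight_measure m)"
    by (simp add: case_prod_unfold mult_ac)
  then show ?thesis
    unfolding double_coeff_def by (simp only: integral_mult_left_zero)
qed

text \<open>
  For the difference \<open>D\<close>, completeness in the first variable annihilates the function
  \<open>t \<mapsto> \<integral> D(t, s) R\<^sub>l(s) d\<nu>(s)\<close> for every \<open>l\<close>, and then completeness in the second variable
  annihilates \<open>D(t, \<cdot>)\<close>.
\<close>

lemma double_coeff_unique:
  fixes F G :: "real \<Rightarrow> real \<Rightarrow> real"
  assumes m: "1 \<le> m" and M: "1 \<le> M"
    and F: "continuous_on UNIV (\<lambda>(t, s). F t s)" and G: "continuous_on UNIV (\<lambda>(t, s). G t s)"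
    and eq: "\<And>k l. double_coeff m M F k l = double_coeff m M G k l"
    and t: "t \<in> {-1..1}" and s: "s \<in> {-1..1}"
  shows "F t s = G t s"
proof -
  interpret B: compact_prob "weight_measure M" "{-1..1}" by (rule compact_prob_weight_measure) fact
  interpret P: compact_prob "weight_measure m \<Otimes>\<^sub>M weight_measure M" "{-1..1} \<times> {-1..1}"
    by (intro compact_prob_pair compact_prob_weight_measure m M)
  define D where "D t s = F t s - G t s" for t s
  have D: "continuous_on UNIV (\<lambda>(t, s). D t s)"
    unfolding D_def case_prod_unfold
    by (intro continuous_intros continuous_on_split[OF F] continuous_on_split[OF G])
  have i: "integrable (weight_measure m \<Otimes>\<^sub>M weight_measure M)
      (\<lambda>p. H (fst p) (snd p) * (poly (ultra m k) (fst p) * poly (ultra M l) (snd p)))"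
    if "continuous_on UNIV (\<lambda>(t, s). H t s)" for H :: "real \<Rightarrow> real \<Rightarrow> real" and k l
    by (intro P.integrable_continuous continuous_intros continuous_on_split[OF that])
  have zero: "double_coeff m M D k l = 0" for k l
    using eq[of k l] i[OF F, of k l] i[OF G, of k l]
    unfolding double_coeff_eq_pair[OF m M F] double_coeff_eq_pair[OF m M G] double_coeff_eq_pair[OF m M D]
    by (simp add: D_def left_diff_distrib)
  have "(\<integral>s. D t s * poly (ultra M l) s \<partial>weight_measure M) = 0" for l
  proof (rule ultra_complete[OF m _ _ t])
    show "continuous_on UNIV (\<lambda>t. \<integral>s. D t s * poly (ultra M l) s \<partial>weight_measure M)"
      by (rule B.continuous_on_integral)
        (unfold case_prod_unfold, intro continuous_intros continuous_on_split[OF D])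
  qed (use zero in \<open>simp add: double_coeff_def\<close>)
  moreover have "continuous_on UNIV (D t)"
    by (rule continuous_on_split[OF D]) (intro continuous_intros)+
  ultimately have "D t s = 0"
    using ultra_complete[OF M _ _ s] by blast
  then show ?thesis by (simp add: D_def)
qed

text \<open>
  Since \<open>\<bar>R\<^sub>k\<bar> \<le> 1\<close> on \<open>[-1, 1]\<close>, the summable numbers \<open>a k l\<close> majorise the series. It converges
  uniformly to a continuous function, whose coefficients may be computed term by term, and these
  are the coefficients of \<open>F\<close>.
\<close>

lemma nonneg_double_coeff_expansion:
  fixes F :: "real \<Rightarrow> real \<Rightarrow> real"
  assumes m: "1 \<le> m" "DIM('a::euclidean_space) = m + 1" and M: "1 \<le> M" "DIM('b::euclidean_space) = M + 1"
    and F: "continuous_on UNIV (\<lambda>(t, s). F t s)"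
    and nonneg: "\<And>k l. 0 \<le> double_coeff m M F k l"
  defines "a \<equiv> \<lambda>k l. double_coeff m M F k l / (ultra_norm m k * ultra_norm M l)"
  shows "(\<lambda>(k, l). a k l) summable_on UNIV"
    and "\<lbrakk>t \<in> {-1..1}; s \<in> {-1..1}\<rbrakk> \<Longrightarrow>
      ((\<lambda>(k, l). a k l * poly (ultra m k) t * poly (ultra M l) s) has_sum F t s) UNIV"
proof -
  have h: "0 < ultra_norm m k" "0 < ultra_norm M l" for k l
    using ultra_norm_pos m M by auto
  have a_nonneg: "0 \<le> a k l" for k l
    unfolding a_def using nonneg[of k l] h(1)[of k] h(2)[of l] by (intro divide_nonneg_pos mult_pos_pos)
  have "compact ({-1..1} \<times> {-1..1} :: (real \<times> real) set)"
    by (intro compact_Times compact_Icc)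
  then have "bounded ((\<lambda>(t, s). F t s) ` ({-1..1} \<times> {-1..1}))"
    using continuous_on_subset[OF F subset_UNIV] compact_continuous_image compact_imp_bounded by blast
  then obtain B where B: "\<And>t s. t \<in> {-1..1} \<Longrightarrow> s \<in> {-1..1} \<Longrightarrow> F t s \<le> B"
    unfolding bounded_iff by (force simp: abs_le_iff)
  have "sum (\<lambda>(k, l). a k l) X \<le> B" if "finite X" for X
  proof -
    have "finite (fst ` X \<union> snd ` X)" using that by simp
    then obtain n where n: "\<And>i. i \<in> fst ` X \<union> snd ` X \<Longrightarrow> i \<le> n"
      by (meson finite_nat_set_iff_bounded_le)
    have "X \<subseteq> {..n} \<times> {..n}"
      using n by force
    then have "sum (\<lambda>(k, l). a k l) X \<le> sum (\<lambda>(k, l). a k l) ({..n} \<times> {..n})"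
      by (intro sum_mono2) (auto simp: a_nonneg)
    also have "\<dots> = (\<Sum>k\<le>n. \<Sum>l\<le>n. a k l)"
      by (simp add: sum.cartesian_product)
    also have "\<dots> \<le> B"
      unfolding a_def by (rule double_coeff_partial_sum_bound[OF m(1) M(1) F nonneg B])
    finally show ?thesis .
  qed
  then show summable: "(\<lambda>(k, l). a k l) summable_on UNIV"
    by (intro nonneg_bdd_above_summable_on bdd_aboveI[of _ B]) (auto simp: a_nonneg)
  let ?P = "weight_measure m \<Otimes>\<^sub>M weight_measure M"
  interpret P: compact_prob ?P "{-1..1} \<times> {-1..1}"
    by (intro compact_prob_pair compact_prob_weight_measure m M)
  define v where "v = (\<lambda>(k, l) p. poly (ultra m k) (clip (fst p)) * poly (ultra M l) (clip (snd p)))"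
  have v_cont: "continuous_on UNIV (v x)" for x
    unfolding v_def case_prod_unfold
    by (intro continuous_intros continuous_on_compose2[OF continuous_on_clip]) auto
  have v_le: "\<bar>v x p\<bar> \<le> 1" for x p
    unfolding v_def case_prod_unfold abs_mult
    by (intro mult_le_one abs_ultra_le_1[OF m] abs_ultra_le_1[OF M] clip_range) auto
  define S where "S p = (\<Sum>\<^sub>\<infinity>x. (case x of (k, l) \<Rightarrow> a k l) * v x p)" for p
  have term_le: "norm ((case x of (k, l) \<Rightarrow> a k l) * v x p) \<le> (case x of (k, l) \<Rightarrow> a k l)" for x p
  proof -
    obtain k l where x: "x = (k, l)" by fastforce
    have "\<bar>a k l\<bar> * \<bar>v x p\<bar> \<le> a k l * 1"
      using v_le[of x p] a_nonneg[of k l] by (intro mult_mono) auto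
    then show ?thesis by (simp add: x abs_mult)
  qed
  have S_sum: "((\<lambda>x. (case x of (k, l) \<Rightarrow> a k l) * v x p) has_sum S p) UNIV" for p
  proof -
    have "(\<lambda>x. norm ((case x of (k, l) \<Rightarrow> a k l) * v x p)) summable_on UNIV"
      by (rule Infinite_Sum.abs_summable_on_comparison_test'[OF summable term_le])
    then show ?thesis
      unfolding S_def by (rule has_sum_infsum[OF abs_summable_summable])
  qed
  have S_cont: "continuous_on UNIV S"
  proof (rule uniform_limit_theorem)
    show "uniform_limit UNIV (\<lambda>X p. \<Sum>x\<in>X. (case x of (k, l) \<Rightarrow> a k l) * v x p) S (finite_subsets_at_top UNIV)"
      by (rule Weierstrass_m_test_general'[OF term_le S_sum summable])
    show "\<forall>\<^sub>F X in finite_subsets_at_top UNIV. continuous_on UNIV (\<lambda>p. \<Sum>x\<in>X. (case x of (k, l) \<Rightarrow> a k l) * v x p)"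
      by (intro always_eventually allI continuous_intros v_cont)
  qed simp
  have S_cont': "continuous_on UNIV (\<lambda>(t, s). S (t, s))"
    using S_cont by (simp add: case_prod_unfold)
  have "double_coeff m M (\<lambda>t s. S (t, s)) k l = double_coeff m M F k l" for k l
  proof -
    define w where "w p = poly (ultra m k) (fst p) * poly (ultra M l) (snd p)" for p
    have w_cont: "continuous_on UNIV w"
      unfolding w_def by (intro continuous_intros)
    have w_le: "\<bar>w p\<bar> \<le> 1" if "p \<in> {-1..1} \<times> {-1..1}" for p
      unfolding w_def abs_mult using that
      by (intro mult_le_one abs_ultra_le_1[OF m] abs_ultra_le_1[OF M]) auto
    have vw: "(\<integral>p. v x p * w p \<partial>?P) = (if x = (k, l) then ultra_norm m k * ultra_norm M l else 0)" for x
    proof -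
      obtain i j where x: "x = (i, j)" by fastforce
      have "(\<integral>p. v x p * w p \<partial>?P) = (\<integral>p. poly (ultra m i) (fst p) * poly (ultra M j) (snd p) * w p \<partial>?P)"
        by (intro P.integral_cong_support continuous_intros v_cont w_cont) (auto simp: v_def x clip_id)
      also have "\<dots> = double_coeff m M (\<lambda>t s. poly (ultra m i) t * poly (ultra M j) s) k l"
        unfolding w_def by (rule double_coeff_eq_pair[OF m(1) M(1), symmetric])
          (unfold case_prod_unfold, intro continuous_intros)
      also have "\<dots> = (\<integral>t. (poly (ultra m i) t * poly (ultra m k) t)
          * (\<integral>s. poly (ultra M j) s * poly (ultra M l) s \<partial>weight_measure M) \<partial>weight_measure m)"
        unfolding double_coeff_def
        by (simp only: mult.assoc integral_mult_right_zero) (simp only: mult.commute mult.left_commute)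
      also have "\<dots> = (if x = (k, l) then ultra_norm m k * ultra_norm M l else 0)"
        by (simp add: integral_ultra_ultra[OF m(1)] integral_ultra_ultra[OF M(1)] x)
      finally show ?thesis .
    qed
    have ivw: "integrable ?P (\<lambda>p. v x p * w p)" for x
      by (intro P.integrable_continuous continuous_intros v_cont w_cont)
    have lim: "((\<lambda>X. (\<integral>p. (\<Sum>x\<in>X. (case x of (k, l) \<Rightarrow> a k l) * v x p * w p) \<partial>?P)) \<longlongrightarrow> (\<integral>p. S p * w p \<partial>?P)) (finite_subsets_at_top UNIV)"
    proof (rule P.tendsto_integral_uniform)
      show "continuous_on UNIV (\<lambda>p. \<Sum>x\<in>X. (case x of (k, l) \<Rightarrow> a k l) * v x p * w p)" for X
        by (intro continuous_intros v_cont w_cont)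
      show "continuous_on UNIV (\<lambda>p. S p * w p)"
        by (intro continuous_intros S_cont w_cont)
      show "uniform_limit ({-1..1} \<times> {-1..1}) (\<lambda>X p. \<Sum>x\<in>X. (case x of (k, l) \<Rightarrow> a k l) * v x p * w p)
          (\<lambda>p. S p * w p) (finite_subsets_at_top UNIV)"
      proof (rule Weierstrass_m_test_general'[OF _ _ summable])
        fix x p assume p: "p \<in> {-1..1 :: real} \<times> {-1..1 :: real}"
        have "norm ((case x of (k, l) \<Rightarrow> a k l) * v x p * w p) = norm ((case x of (k, l) \<Rightarrow> a k l) * v x p) * \<bar>w p\<bar>"
          by (simp add: abs_mult)
        also have "\<dots> \<le> (case x of (k, l) \<Rightarrow> a k l) * 1"
          using term_le[of x p] w_le[OF p] by (intro mult_mono) (auto simp: a_nonneg split: prod.split)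
        finally show "norm ((case x of (k, l) \<Rightarrow> a k l) * v x p * w p) \<le> (case x of (k, l) \<Rightarrow> a k l)"
          by simp
      qed (intro has_sum_cmult_left S_sum)
    qed
    have "(\<integral>p. (\<Sum>x\<in>X. (case x of (k, l) \<Rightarrow> a k l) * v x p * w p) \<partial>?P) = double_coeff m M F k l"
      if X: "finite X" "(k, l) \<in> X" for X
    proof -
      have "(\<integral>p. (\<Sum>x\<in>X. (case x of (k, l) \<Rightarrow> a k l) * v x p * w p) \<partial>?P)
          = (\<Sum>x\<in>X. (case x of (k, l) \<Rightarrow> a k l) * (\<integral>p. v x p * w p \<partial>?P))"
        using ivw by (simp add: mult.assoc)
      also have "\<dots> = (\<Sum>x\<in>X. if x = (k, l) then a k l * (ultra_norm m k * ultra_norm M l) else 0)"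
        unfolding vw by (intro sum.cong) auto
      also have "\<dots> = a k l * (ultra_norm m k * ultra_norm M l)"
        using X by simp
      also have "\<dots> = double_coeff m M F k l"
        using h(1)[of k] h(2)[of l] by (simp add: a_def)
      finally show ?thesis .
    qed
    then have ev: "\<forall>\<^sub>F X in finite_subsets_at_top UNIV.
        (\<integral>p. (\<Sum>x\<in>X. (case x of (k, l) \<Rightarrow> a k l) * v x p * w p) \<partial>?P) = double_coeff m M F k l"
      by (auto simp: eventually_finite_subsets_at_top intro!: exI[of _ "{(k, l)}"])
    have "(\<integral>p. S p * w p \<partial>?P) = double_coeff m M F k l"
      by (rule tendsto_unique[OF finite_subsets_at_top_neq_bot lim tendsto_eventually[OF ev]])
    then show ?thesis
      by (simp add: double_coeff_eq_pair[OF m(1) M(1) S_cont'] w_def)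
  qed
  note coeff = this
  show "((\<lambda>(k, l). a k l * poly (ultra m k) t * poly (ultra M l) s) has_sum F t s) UNIV"
    if t: "t \<in> {-1..1}" and s: "s \<in> {-1..1}"
  proof -
    have "S (t, s) = F t s"
      by (rule double_coeff_unique[OF m(1) M(1) S_cont' F coeff t s])
    then show ?thesis
      using S_sum[of "(t, s)"] t s by (simp add: v_def case_prod_unfold clip_id mult.assoc)
  qed
qed

section \<open>Fourier coefficients\<close>

lemma \<tau>_eq:
  assumes m: "1 \<le> m"
  shows "\<tau> m k = (gegenbauer m k 1)\<^sup>2 * (weight_mass m * ultra_norm m k)"
proof -
  have "(\<lambda>t. (poly (ultra m k) t)\<^sup>2) \<in> borel_measurable borel"
    by (intro borel_measurable_continuous_onI continuous_intros)
  from integral_weight_measure[OF m this]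
  have "(LBINT t:{-1..1}. (poly (ultra m k) t)\<^sup>2 * weight m t) = weight_mass m * ultra_norm m k"
    using weight_mass_pos[OF m] by (simp add: ultra_norm_def field_simps)
  moreover have "(gegenbauer m k t)\<^sup>2 * weight m t = (gegenbauer m k 1)\<^sup>2 * ((poly (ultra m k) t)\<^sup>2 * weight m t)" for t
    by (subst gegenbauer_normalised(1)[OF m]) (simp add: power_mult_distrib)
  ultimately show ?thesis
    unfolding \<tau>_def by (simp only: set_integral_mult_right)
qed

lemma integral_pair_weight_measure:
  fixes G :: "real \<times> real \<Rightarrow> real"
  assumes m: "1 \<le> m" and M: "1 \<le> M" and G: "continuous_on UNIV G"
  shows "(LBINT p:{-1..1} \<times> {-1..1}. G p * (weight m (fst p) * weight M (snd p)))
    = weight_mass m * weight_mass M * integral\<^sup>L (weight_measure m \<Otimes>\<^sub>M weight_measure M) G"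
proof -
  interpret B: compact_prob "weight_measure M" "{-1..1}" by (rule compact_prob_weight_measure) fact
  define d where "d m t = indicator {-1..1} t * weight m t / weight_mass m" for m t
  have d_meas [measurable]: "d m \<in> borel_measurable borel" for m
    unfolding d_def by measurable
  have d_nonneg: "0 \<le> d m t" if "1 \<le> m" for m t
    using weight_mass_pos[OF that] by (simp add: d_def weight_nonneg)
  have wd: "weight_measure m = density lborel (\<lambda>t. ennreal (d m t))" for m
    by (simp add: weight_measure_def d_def)
  have [measurable]: "G \<in> borel_measurable borel"
    using G by (rule borel_measurable_continuous_onI)
  have "weight_measure m \<Otimes>\<^sub>M weight_measure M
      = density (lborel \<Otimes>\<^sub>M lborel) (\<lambda>(t, s). ennreal (d m t) * ennreal (d M s))"
    unfolding wd
    by (rule pair_measure_density) (use B.sigma_finite_measure_axioms in \<open>auto simp: wd sigma_finite_lborel\<close>)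
  also have "\<dots> = density lborel (\<lambda>p. ennreal (d m (fst p) * d M (snd p)))"
    unfolding lborel_prod
    by (simp only: case_prod_unfold ennreal_mult[OF d_nonneg[OF m] d_nonneg[OF M]])
  finally have eq: "weight_measure m \<Otimes>\<^sub>M weight_measure M = density lborel (\<lambda>p. ennreal (d m (fst p) * d M (snd p)))" .
  have "integral\<^sup>L (weight_measure m \<Otimes>\<^sub>M weight_measure M) G
      = (\<integral>p. (d m (fst p) * d M (snd p)) *\<^sub>R G p \<partial>lborel)"
    unfolding eq
  proof (rule integral_density)
    show "(\<lambda>p. d m (fst p) * d M (snd p)) \<in> borel_measurable lborel"
      unfolding lborel_prod[symmetric] by measurable
    show "AE p in lborel. 0 \<le> d m (fst p) * d M (snd p)"
      by (intro AE_I2 mult_nonneg_nonneg d_nonneg m M)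
  qed simp
  also have "\<dots> = (\<integral>p. (indicator ({-1..1} \<times> {-1..1}) p *\<^sub>R (G p * (weight m (fst p) * weight M (snd p)))) / (weight_mass m * weight_mass M) \<partial>lborel)"
    by (intro Bochner_Integration.integral_cong) (auto simp: d_def indicator_def)
  also have "\<dots> = (LBINT p:{-1..1} \<times> {-1..1}. G p * (weight m (fst p) * weight M (snd p))) / (weight_mass m * weight_mass M)"
    by (simp add: set_lebesgue_integral_def)
  finally show ?thesis
    using weight_mass_pos[OF m] weight_mass_pos[OF M] by simp
qed

lemma fourier_coeff_eq_double_coeff:
  fixes F f :: "real \<Rightarrow> real \<Rightarrow> real"
  assumes m: "1 \<le> m" and M: "1 \<le> M" and F: "continuous_on UNIV (\<lambda>(t, s). F t s)"
    and Ff: "\<And>t s. t \<in> {-1..1} \<Longrightarrow> s \<in> {-1..1} \<Longrightarrow> F t s = f t s"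
  shows "fourier_coeff m M f k l * (gegenbauer m k 1 * gegenbauer M l 1)
     = double_coeff m M F k l / (ultra_norm m k * ultra_norm M l)"
proof -
  let ?g = "gegenbauer m k 1" and ?h = "gegenbauer M l 1"
  define G where "G p = F (fst p) (snd p) * (poly (ultra m k) (fst p) * poly (ultra M l) (snd p))" for p
  have G: "continuous_on UNIV G"
    unfolding G_def by (intro continuous_intros continuous_on_split[OF F])
  have "(LBINT p:{-1..1} \<times> {-1..1}. f (fst p) (snd p) * gegenbauer m k (fst p) * gegenbauer M l (snd p) * (weight m (fst p) * weight M (snd p)))
      = (LBINT p:{-1..1} \<times> {-1..1}. (?g * ?h) * (G p * (weight m (fst p) * weight M (snd p))))"
    unfolding set_lebesgue_integral_def
  proof (rule Bochner_Integration.integral_cong)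
    fix p :: "real \<times> real"
    show "indicator ({-1..1} \<times> {-1..1}) p *\<^sub>R (f (fst p) (snd p) * gegenbauer m k (fst p) * gegenbauer M l (snd p) * (weight m (fst p) * weight M (snd p)))
        = indicator ({-1..1} \<times> {-1..1}) p *\<^sub>R ((?g * ?h) * (G p * (weight m (fst p) * weight M (snd p))))"
      unfolding gegenbauer_normalised(1)[OF m, of k "fst p"] gegenbauer_normalised(1)[OF M, of l "snd p"]
      by (auto simp: indicator_def G_def Ff)
  qed simp
  also have "\<dots> = (?g * ?h) * (weight_mass m * weight_mass M * double_coeff m M F k l)"
    unfolding double_coeff_eq_pair[OF m M F] G_def[symmetric]
    by (simp only: set_integral_mult_right integral_pair_weight_measure[OF m M G])
  finally show ?thesis
    using gegenbauer_normalised(2)[OF m, of k] gegenbauer_normalised(2)[OF M, of l]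
      weight_mass_pos[OF m] weight_mass_pos[OF M] ultra_norm_pos[OF m, of k] ultra_norm_pos[OF M, of l]
    by (simp add: fourier_coeff_def \<tau>_eq[OF m] \<tau>_eq[OF M] field_simps power2_eq_square)
qed

section \<open>Positive definite zonal kernels on a product of spheres\<close>

lemma has_sum_sum:
  fixes f :: "'i \<Rightarrow> 'k \<Rightarrow> real"
  assumes "finite A" "\<And>i. i \<in> A \<Longrightarrow> (f i has_sum s i) X"
  shows "((\<lambda>x. \<Sum>i\<in>A. f i x) has_sum (\<Sum>i\<in>A. s i)) X"
  using assms
proof (induction A rule: finite_induct)
  case (insert i A)
  then have "((\<lambda>x. f i x + (\<Sum>i\<in>A. f i x)) has_sum (s i + (\<Sum>i\<in>A. s i))) X"
    by (intro has_sum_add) auto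
  with insert show ?case by simp
qed simp

text \<open>
  By the reproducing formula the quadratic form, multiplied by \<open>h\<^sub>k h\<^sub>l > 0\<close>, is the integral of the
  square of a linear combination of the functions \<open>u p\<close>.
\<close>

lemma positive_definite_product_ultra:
  assumes m: "1 \<le> m" "DIM('a::euclidean_space) = m + 1" and M: "1 \<le> M" "DIM('b::euclidean_space) = M + 1"
    and A: "finite A" "A \<subseteq> sphere 0 1 \<times> sphere 0 1"
  shows "0 \<le> (\<Sum>p\<in>A. \<Sum>q\<in>A. c p * c q *
      (poly (ultra m k) (fst (p :: 'a \<times> 'b) \<bullet> fst q) * poly (ultra M l) (snd p \<bullet> snd q)))"
proof -
  let ?P = "(sphere_measure :: 'a measure) \<Otimes>\<^sub>M (sphere_measure :: 'b measure)"
  interpret P: compact_prob ?P "sphere 0 1 \<times> sphere 0 1"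
    by (rule compact_prob_pair) (rule compact_prob_sphere_measure)+
  define u where "u p r = poly (ultra m k) (fst p \<bullet> fst r) * poly (ultra M l) (snd p \<bullet> snd r)" for p r :: "'a \<times> 'b"
  have i: "integrable ?P (\<lambda>r. (c p * c q) * (u p r * u q r))" for p q
    unfolding u_def by (intro P.integrable_continuous continuous_intros)
  have "0 \<le> (\<integral>r. (\<Sum>p\<in>A. c p * u p r)\<^sup>2 \<partial>?P)"
    by (intro Bochner_Integration.integral_nonneg) simp
  also have "\<dots> = (\<integral>r. (\<Sum>p\<in>A. \<Sum>q\<in>A. (c p * c q) * (u p r * u q r)) \<partial>?P)"
    by (simp only: power2_eq_square sum_product) (simp only: mult_ac)
  also have "\<dots> = (\<Sum>p\<in>A. \<Sum>q\<in>A. (c p * c q) * (\<integral>r. u p r * u q r \<partial>?P))"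
    using i by simp
  also have "\<dots> = (\<Sum>p\<in>A. \<Sum>q\<in>A. (c p * c q) * (ultra_norm m k * ultra_norm M l *
      (poly (ultra m k) (fst p \<bullet> fst q) * poly (ultra M l) (snd p \<bullet> snd q))))"
  proof (intro sum.cong refl)
    fix p q assume "p \<in> A" "q \<in> A"
    then have "norm (fst p) = 1" "norm (snd p) = 1" "norm (fst q) = 1" "norm (snd q) = 1"
      using A(2) by auto
    then show "(c p * c q) * (\<integral>r. u p r * u q r \<partial>?P) = (c p * c q) * (ultra_norm m k * ultra_norm M l *
      (poly (ultra m k) (fst p \<bullet> fst q) * poly (ultra M l) (snd p \<bullet> snd q)))"
      unfolding u_def by (subst product_ultra_square[OF m M]) auto
  qed
  also have "\<dots> = (ultra_norm m k * ultra_norm M l) * (\<Sum>p\<in>A. \<Sum>q\<in>A. c p * c q *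
      (poly (ultra m k) (fst p \<bullet> fst q) * poly (ultra M l) (snd p \<bullet> snd q)))"
    by (simp add: sum_distrib_left mult_ac)
  finally show ?thesis
    using mult_pos_pos[OF ultra_norm_pos[OF m(1), of k] ultra_norm_pos[OF M(1), of l]]
    by (simp add: zero_le_mult_iff)
qed

lemma positive_definite_on_cong:
  assumes "\<And>p q. p \<in> X \<Longrightarrow> q \<in> X \<Longrightarrow> K p q = L p q"
  shows "positive_definite_on X K \<longleftrightarrow> positive_definite_on X L"
proof -
  have "(\<Sum>p\<in>A. \<Sum>q\<in>A. c p * c q * K p q) = (\<Sum>p\<in>A. \<Sum>q\<in>A. c p * c q * L p q)" if "A \<subseteq> X" for A c
    using that assms by (intro sum.cong refl) (auto simp: subset_iff)
  then show ?thesis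
    unfolding positive_definite_on_iff_finite by auto
qed

theorem theorem2p9:
  fixes K :: "'a::euclidean_space \<times> 'b::euclidean_space \<Rightarrow> 'a \<times> 'b \<Rightarrow> real"
    and f :: "real \<Rightarrow> real \<Rightarrow> real"
    and m M :: nat
  assumes "1 \<le> m" and "1 \<le> M"
    and "DIM('a) = m + 1" and "DIM('b) = M + 1"
    and "continuous_on ((sphere 0 1 \<times> sphere 0 1) \<times> (sphere 0 1 \<times> sphere 0 1)) (\<lambda>(p, q). K p q)"
    and "isotropic_part K f"
  shows "positive_definite_on (sphere 0 1 \<times> sphere 0 1) K \<longleftrightarrow>
    (\<forall>t\<in>{-1..1}. \<forall>s\<in>{-1..1}.
       ((\<lambda>(k, l). fourier_coeff m M f k l * gegenbauer m k t * gegenbauer M l s) has_sum f t s) UNIV) \<and>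
    (\<forall>k l. 0 \<le> fourier_coeff m M f k l) \<and>
    (\<lambda>(k, l). fourier_coeff m M f k l * gegenbauer m k 1 * gegenbauer M l 1) summable_on UNIV"
proof -
  note m = assms(1,3) and M = assms(2,4)
  have iso: "K (x, z) (y, w) = f (x \<bullet> y) (z \<bullet> w)"
    if "norm x = 1" "norm y = 1" "norm z = 1" "norm w = 1" for x y z w
    using assms(6) that by (simp add: isotropic_part_def)
  define F where "F t s = f (clip t) (clip s)" for t s
  have Ff: "F t s = f t s" if "t \<in> {-1..1}" "s \<in> {-1..1}" for t s
    using that by (simp add: F_def clip_id)
  \<comment> \<open>\<open>F\<close> is \<open>K\<close> read off along great half-circles of the two spheres.\<close>
  have F: "continuous_on UNIV (\<lambda>(t, s). F t s)"
  proof -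
    have "2 \<le> DIM('a)" "2 \<le> DIM('b)" using m M by auto
    then obtain x e :: 'a and z d :: 'b where xe: "norm x = 1" "norm e = 1" "x \<bullet> e = 0"
      and zd: "norm z = 1" "norm d = 1" "z \<bullet> d = 0"
      by (metis orthonormal_pair_exists)
    have "continuous_on UNIV (\<lambda>r. case ((x, z), (arc x e (fst r), arc z d (snd r))) of (p, q) \<Rightarrow> K p q)"
      by (rule continuous_on_compose2[OF assms(5)])
        (auto intro!: continuous_intros continuous_on_compose2[OF continuous_on_arc] simp: arc_sphere xe zd)
    then show ?thesis
      by (simp add: case_prod_unfold F_def iso arc_sphere xe zd)
  qed
  have pd_iff: "positive_definite_on (sphere 0 1 \<times> sphere 0 1) K \<longleftrightarrow>
      positive_definite_on (sphere 0 1 \<times> sphere 0 1) (\<lambda>(p :: 'a \<times> 'b) q. F (fst p \<bullet> fst q) (snd p \<bullet> snd q))"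
    by (rule positive_definite_on_cong) (auto simp: iso intro!: Ff[symmetric] inner_unit_vectors_range)
  define a where "a k l = double_coeff m M F k l / (ultra_norm m k * ultra_norm M l)" for k l
  have g: "0 < gegenbauer m k 1" "0 < gegenbauer M l 1" for k l
    using gegenbauer_normalised(2) m M by auto
  have coeff: "fourier_coeff m M f k l * (gegenbauer m k 1 * gegenbauer M l 1) = a k l" for k l
    unfolding a_def by (rule fourier_coeff_eq_double_coeff[OF m(1) M(1) F Ff])
  have termwise: "fourier_coeff m M f k l * gegenbauer m k t * gegenbauer M l s
      = a k l * poly (ultra m k) t * poly (ultra M l) s" for k l t s
    unfolding coeff[symmetric] gegenbauer_normalised(1)[OF m(1), of k t] gegenbauer_normalised(1)[OF M(1), of l s]
    by (simp add: mult_ac)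
  show ?thesis
  proof (intro iffI conjI)
    assume "positive_definite_on (sphere 0 1 \<times> sphere 0 1) K"
    then have nonneg: "0 \<le> double_coeff m M F k l" for k l
      unfolding pd_iff by (rule double_coeff_nonneg[OF m M F])
    note expansion = nonneg_double_coeff_expansion[OF m M F nonneg, folded a_def]
    show "\<forall>t\<in>{-1..1}. \<forall>s\<in>{-1..1}.
       ((\<lambda>(k, l). fourier_coeff m M f k l * gegenbauer m k t * gegenbauer M l s) has_sum f t s) UNIV"
      unfolding termwise using expansion(2) Ff by simp
    show "\<forall>k l. 0 \<le> fourier_coeff m M f k l"
    proof (intro allI)
      fix k l
      have "0 \<le> a k l"
        using nonneg ultra_norm_pos[OF m(1), of k] ultra_norm_pos[OF M(1), of l] by (simp add: a_def)
      then show "0 \<le> fourier_coeff m M f k l"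
        unfolding coeff[symmetric] using mult_pos_pos[OF g, of k l] by (simp add: zero_le_mult_iff)
    qed
    show "(\<lambda>(k, l). fourier_coeff m M f k l * gegenbauer m k 1 * gegenbauer M l 1) summable_on UNIV"
      unfolding termwise using expansion(1) by (simp add: poly_ultra_1[OF m(1)] poly_ultra_1[OF M(1)])
  next
    assume "(\<forall>t\<in>{-1..1}. \<forall>s\<in>{-1..1}.
       ((\<lambda>(k, l). fourier_coeff m M f k l * gegenbauer m k t * gegenbauer M l s) has_sum f t s) UNIV) \<and>
      (\<forall>k l. 0 \<le> fourier_coeff m M f k l) \<and>
      (\<lambda>(k, l). fourier_coeff m M f k l * gegenbauer m k 1 * gegenbauer M l 1) summable_on UNIV"
    then have sums_f: "\<And>t s. t \<in> {-1..1} \<Longrightarrow> s \<in> {-1..1} \<Longrightarrow>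
          ((\<lambda>(k, l). a k l * poly (ultra m k) t * poly (ultra M l) s) has_sum f t s) UNIV"
      and nonneg: "\<And>k l. 0 \<le> fourier_coeff m M f k l"
      unfolding termwise by blast+
    have sums: "((\<lambda>(k, l). a k l * poly (ultra m k) t * poly (ultra M l) s) has_sum F t s) UNIV"
        if "t \<in> {-1..1}" "s \<in> {-1..1}" for t s
      using sums_f[OF that] Ff[OF that] by simp
    have a_nonneg: "0 \<le> a k l" for k l
      unfolding coeff[symmetric] by (intro mult_nonneg_nonneg nonneg less_imp_le[OF g(1)] less_imp_le[OF g(2)])
    have "0 \<le> (\<Sum>p\<in>A. \<Sum>q\<in>A. c p * c q * F (fst p \<bullet> fst q) (snd p \<bullet> snd q))"
      if A: "finite A \<and> A \<subseteq> sphere 0 1 \<times> sphere 0 1" for A :: "('a \<times> 'b) set" and c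
    proof -
      define T where "T p q = (\<lambda>(k, l). c p * c q * (a k l * poly (ultra m k) (fst p \<bullet> fst q) * poly (ultra M l) (snd p \<bullet> snd q)))"
        for p q :: "'a \<times> 'b"
      have "(T p q has_sum c p * c q * F (fst p \<bullet> fst q) (snd p \<bullet> snd q)) UNIV" if "p \<in> A" "q \<in> A" for p q
      proof -
        have "norm (fst p) = 1" "norm (snd p) = 1" "norm (fst q) = 1" "norm (snd q) = 1"
          using that A by auto
        then have "fst p \<bullet> fst q \<in> {-1..1}" "snd p \<bullet> snd q \<in> {-1..1}"
          using inner_unit_vectors_range by blast+
        from has_sum_cmult_right[OF sums[OF this], of "c p * c q"] show ?thesis
          by (simp add: T_def case_prod_unfold)
      qed
      then have "((\<lambda>x. \<Sum>p\<in>A. \<Sum>q\<in>A. T p q x) has_sum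
          (\<Sum>p\<in>A. \<Sum>q\<in>A. c p * c q * F (fst p \<bullet> fst q) (snd p \<bullet> snd q))) UNIV"
        using A by (intro has_sum_sum) auto
      then show ?thesis
      proof (rule has_sum_nonneg)
        fix x :: "nat \<times> nat"
        obtain k l where x: "x = (k, l)" by fastforce
        have "(\<Sum>p\<in>A. \<Sum>q\<in>A. T p q x) = a k l * (\<Sum>p\<in>A. \<Sum>q\<in>A. c p * c q *
            (poly (ultra m k) (fst p \<bullet> fst q) * poly (ultra M l) (snd p \<bullet> snd q)))"
          by (simp add: T_def x sum_distrib_left mult_ac)
        also have "\<dots> \<ge> 0"
          using A by (intro mult_nonneg_nonneg a_nonneg positive_definite_product_ultra[OF m M]) auto
        finally show "0 \<le> (\<Sum>p\<in>A. \<Sum>q\<in>A. T p q x)" .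
      qed
    qed
    then have "positive_definite_on (sphere 0 1 \<times> sphere 0 1) (\<lambda>(p :: 'a \<times> 'b) q. F (fst p \<bullet> fst q) (snd p \<bullet> snd q))"
      unfolding positive_definite_on_iff_finite by blast
    then show "positive_definite_on (sphere 0 1 \<times> sphere 0 1) K"
      by (simp add: pd_iff)
  qed
qed

end
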